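(* Let $(z,z')\in\mathbb C^2$ be admissible and $\xi\in(0,1)$. Regard elements of $\mathrm{Sym}$ as functions on $\mathbb Y$. (i) The z-measure $P_{z,z',\xi}$ is an orthogonality measure for the Meixner symmetric functions with the same parameters $(z,z',\xi)$, meaning that the formal moment functional $\varphi^{\mathsf M}_{z,z',\xi}$ on $\mathrm{Sym}$ coincides with expectation under $P_{z,z',\xi}$: $$\varphi^{\mathsf M}_{z,z',\xi}(F)=\sum_{\lambda\in\mathbb Y}F(\lambda)P_{z,z',\xi}(\lambda)\qquad\text{for all }F\in\mathrm{Sym}.$$ (ii) If $(z,z')$ is in the principal or complementary series, then the Meixner symmetric functions $\mathfrak M_\nu$, $\nu\in\mathbb Y$, with parameters $(z,z',\xi)$ form an orthogonal basis in the real weighted Hilbert space $\ell^2(\mathbb Y,P_{z,z',\xi})$.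
   Context: $\mathbb Y$ is the set of all partitions (Young diagrams); $|\nu|$ is the number of boxes and $\ell(\nu)$ the number of nonzero rows of $\nu$. For a box $\square=(i,j)$ (row $i$, column $j$), $c(\square)=j-i$; for $\mu\subseteq\nu$, $(z)_{\nu/\mu}=\prod_{\square\in\nu/\mu}(z+c(\square))$, $(z)_\nu=(z)_{\nu/\varnothing}$; $\dim\nu/\mu$ is the number of standard tableaux of skew shape $\nu/\mu$, $\dim\nu=\dim\nu/\varnothing$. $\mathrm{Sym}$ is the algebra of symmetric functions over $\mathbb R$, freely generated by the power sums $p_k$; $\mathrm{Sym}_{\mathbb C}$ is its complexification. Realization of $\mathrm{Sym}$ on $\mathbb Y$: for $\lambda\in\mathbb Y$ with $d$ diagonal boxes let $a_i=\lambda_i-i+\frac12$, $b_i=\lambda'_i-i+\frac12$, $1\le i\le d$ ($\lambda'$ the transposed diagram). Elements of $\mathrm{Sym}$ are regarded as functions on $\mathbb Y$ via the (injective) algebra morphism sending $p_k$ to $p_k(\lambda)=\sum_{i=1}^d[a_i^k-(-b_i)^k]$. Frobenius–Schur functions. Put $x^{\downarrow n}=x(x-1)\cdots(x-n+1)$. The factorial Schur polynomial is $S^{\mathsf f}_{\nu\mid N}(x_1,\dots,x_N)=\det[x_j^{\downarrow(\nu_i+N-i)}]_{i,j=1}^N/\prod_{i<j}(x_i-x_j)$ for $\ell(\nu)\le N$ (and $0$ if $\ell(\nu)>N$). The shifted Schur polynomial is $S^*_{\nu\mid N}(y_1,\dots,y_N)=S^{\mathsf f}_{\nu\mid N}(y_1+N-1,y_2+N-2,\dots,y_N)$;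 it satisfies $S^*_{\nu\mid N}|_{y_N=0}=S^*_{\nu\mid N-1}$. A polynomial in $y_1,\dots,y_N$ is shifted symmetric if it is symmetric in the variables $y_i+N-i$; $\mathrm{Sym}^*$ is the algebra of sequences $(f_N)_{N\ge1}$ of shifted symmetric polynomials in $N$ variables with $f_N|_{y_N=0}=f_{N-1}$ and $\sup_N\deg f_N<\infty$. Thus $S^*_\nu=(S^*_{\nu\mid N})_N\in\mathrm{Sym}^*$. The algebra $\mathrm{Sym}^*$ is freely generated by $p_k^*=\sum_{i\ge1}[(y_i-i+\frac12)^k-(-i+\frac12)^k]$, $k\ge1$, and $FS_\nu\in\mathrm{Sym}$ is the image of $S^*_\nu$ under the algebra isomorphism $\mathrm{Sym}^*\to\mathrm{Sym}$, $p^*_k\mapsto p_k$. The $FS_\nu$ form a basis of $\mathrm{Sym}$. Meixner symmetric functions: $\mathfrak M_\nu=\sum_{\mu\subseteq\nu}(-1)^{|\nu|-|\mu|}\left(\frac{\xi}{1-\xi}\right)^{|\nu|-|\mu|}\frac{\dim\nu/\mu}{(|\nu|-|\mu|)!}(z)_{\nu/\mu}(z')_{\nu/\mu}FS_\mu$. They form a basis of $\mathrm{Sym}_{\mathbb C}$, and $\varphi^{\mathsf M}_{z,z',\xi}:\mathrm{Sym}_{\mathbb C}\to\mathbb C$ is the linear functional with $\varphi^{\mathsf M}_{z,z',\xi}(\mathfrak M_\nu)=\delta_{\nu\varnothing}$. Admissibility: $(z,z')\in\mathbb C^2$ is admissible if $z\ne0$, $z'\ne0$ and $(z)_\nu(z')_\nu\ge0$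 for all $\nu\in\mathbb Y$ (then $zz'>0$). Principal series: $z'=\bar z\in\mathbb C\setminus\mathbb Z$. Complementary series: $z,z'$ real with $k<z,z'<k+1$ for some $k\in\mathbb Z$. The (mixed) z-measure on $\mathbb Y$ is $$P_{z,z',\xi}(\lambda)=(1-\xi)^{zz'}(z)_\lambda(z')_\lambda\,\xi^{|\lambda|}\left(\frac{\dim\lambda}{|\lambda|!}\right)^2,\qquad\lambda\in\mathbb Y;$$ for admissible $(z,z')$ and $\xi\in(0,1)$ it is a probability measure. *)

theory Defs
  imports
    "HOL-Analysis.Analysis"
    "HOL-Library.Poly_Mapping"
    "HOL-Library.Nonpos_Ints"
    "Jordan_Normal_Form.Determinant"
begin

section \<open>Young diagrams\<close>

text \<open>Rows and columns are numbered from 0, so \<open>yrow \<nu> i\<close> is $\nu_{i+1}$.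
  Contents \<open>j - i\<close> are unaffected by this shift.\<close>

typedef young = "{f :: nat \<Rightarrow> nat. antimono f \<and> finite {i. f i \<noteq> 0}}"
  morphisms yrow Young
  by (rule exI[of _ "\<lambda>_. 0"]) (simp add: antimono_def)

setup_lifting type_definition_young

lift_definition empty_young :: young is "\<lambda>_. 0"
  by (simp add: antimono_def)

definition boxes :: "young \<Rightarrow> (nat \<times> nat) set" where
  "boxes \<nu> = {(i, j). j < yrow \<nu> i}"

definition contained :: "young \<Rightarrow> young \<Rightarrow> bool" where
  "contained \<mu> \<nu> \<longleftrightarrow> boxes \<mu> \<subseteq> boxes \<nu>"

definition skew :: "young \<Rightarrow> young \<Rightarrow> (nat \<times> nat) set" where
  "skew \<nu> \<mu> = boxes \<nu> - boxes \<mu>"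

definition ysize :: "young \<Rightarrow> nat" where
  "ysize \<nu> = card (boxes \<nu>)"

definition ylength :: "young \<Rightarrow> nat" where
  "ylength \<nu> = card {i. yrow \<nu> i \<noteq> 0}"

definition ycol :: "young \<Rightarrow> nat \<Rightarrow> nat" where
  "ycol \<nu> j = card {i. (i, j) \<in> boxes \<nu>}"

definition diag_length :: "young \<Rightarrow> nat" where
  "diag_length \<nu> = card {i. (i, i) \<in> boxes \<nu>}"

definition standard_tableaux :: "(nat \<times> nat) set \<Rightarrow> (nat \<times> nat \<Rightarrow> nat) set" where
  "standard_tableaux D = {T \<in> D \<rightarrow>\<^sub>E {1..card D}. bij_betw T D {1..card D} \<and>
     (\<forall>i j j'. (i, j) \<in> D \<and> (i, j') \<in> D \<and> j < j' \<longrightarrow> T (i, j) < T (i, j')) \<and>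
     (\<forall>i i' j. (i, j) \<in> D \<and> (i', j) \<in> D \<and> i < i' \<longrightarrow> T (i, j) < T (i', j))}"

definition skew_dim :: "young \<Rightarrow> young \<Rightarrow> nat" where
  "skew_dim \<nu> \<mu> = card (standard_tableaux (skew \<nu> \<mu>))"

definition ydim :: "young \<Rightarrow> nat" where
  "ydim \<nu> = skew_dim \<nu> empty_young"

definition skew_poch :: "complex \<Rightarrow> young \<Rightarrow> young \<Rightarrow> complex" where
  "skew_poch z \<nu> \<mu> = (\<Prod>(i, j)\<in>skew \<nu> \<mu>. z + of_int (int j - int i))"

definition ypoch :: "complex \<Rightarrow> young \<Rightarrow> complex" where
  "ypoch z \<nu> = skew_poch z \<nu> empty_young"


section \<open>Polynomials in countably many variables\<close>

type_synonym 'a mpoly = "(nat \<Rightarrow>\<^sub>0 nat) \<Rightarrow>\<^sub>0 'a"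

definition Const :: "'a::zero \<Rightarrow> 'a mpoly" where
  "Const c = Poly_Mapping.single 0 c"

definition Var :: "nat \<Rightarrow> 'a::zero_neq_one mpoly" where
  "Var i = Poly_Mapping.single (Poly_Mapping.single i 1) 1"

text \<open>\<open>mpoly_eval h x F\<close> substitutes \<open>x i\<close> for the \<open>i\<close>-th variable and maps the coefficients
  by \<open>h\<close>.\<close>

definition mpoly_eval ::
  "('a::zero \<Rightarrow> 'b::comm_semiring_1) \<Rightarrow> (nat \<Rightarrow> 'b) \<Rightarrow> 'a mpoly \<Rightarrow> 'b" where
  "mpoly_eval h x F = (\<Sum>m\<in>Poly_Mapping.keys F.
     h (Poly_Mapping.lookup F m) *
     (\<Prod>i\<in>Poly_Mapping.keys m. x i ^ Poly_Mapping.lookup m i))"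


section \<open>The algebra of symmetric functions\<close>

text \<open>Sym is the free commutative algebra on $p_1, p_2, \dots$; the variable with index \<open>k\<close>
  stands for $p_{k+1}$.\<close>

type_synonym sym = "real mpoly"
type_synonym symC = "complex mpoly"

definition complexify :: "sym \<Rightarrow> symC" where
  "complexify = Poly_Mapping.map complex_of_real"

text \<open>Because rows are numbered from 0, $a_{i+1} = \lambda_{i+1} - (i+1) + \frac12$ reads
  \<open>yrow \<kappa> i - i - 1/2\<close>, and likewise for $b_{i+1}$.\<close>

definition power_sum :: "nat \<Rightarrow> young \<Rightarrow> real" where
  "power_sum k \<kappa> = (\<Sum>i<diag_length \<kappa>.
     (real (yrow \<kappa> i) - real i - 1/2) ^ k - (- (real (ycol \<kappa> i) - real i - 1/2)) ^ k)"

definition realize :: "sym \<Rightarrow> young \<Rightarrow> real" where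
  "realize F \<kappa> = mpoly_eval (\<lambda>c. c) (\<lambda>k. power_sum (Suc k) \<kappa>) F"


section \<open>Frobenius--Schur functions\<close>

definition falling :: "'a::comm_ring_1 \<Rightarrow> nat \<Rightarrow> 'a" where
  "falling x n = (\<Prod>k<n. x - of_nat k)"

text \<open>Polynomials in $x_1, \dots, x_N$ use the variables with index \<open>< N\<close>. The quotient of the
  determinant by the Vandermonde product is taken in the polynomial ring, an integral domain.\<close>

definition factorial_schur :: "young \<Rightarrow> nat \<Rightarrow> real mpoly" where
  "factorial_schur \<nu> N = (if ylength \<nu> > N then 0 else
     (THE P. P * (\<Prod>(i, j)\<in>{(i, j). i < j \<and> j < N}. Var i - Var j) =
        Determinant.det (Matrix.mat N N
          (\<lambda>(i, j). falling (Var j) (yrow \<nu> i + (N - Suc i))))))"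

definition shifted_schur :: "young \<Rightarrow> nat \<Rightarrow> real mpoly" where
  "shifted_schur \<nu> N =
     mpoly_eval Const (\<lambda>i. Var i + of_nat (N - Suc i)) (factorial_schur \<nu> N)"

definition shifted_power_sum :: "nat \<Rightarrow> nat \<Rightarrow> real mpoly" where
  "shifted_power_sum k N = (\<Sum>i<N.
     (Var i - Const (real i + 1/2)) ^ k - Const (- (real i + 1/2)) ^ k)"

text \<open>The algebra isomorphism from Sym to the algebra of shifted symmetric functions (sequences of
  polynomials indexed by \<open>N \<ge> 1\<close>) with $p_k \mapsto p^*_k$, and its inverse.\<close>

definition sym_to_shifted :: "sym \<Rightarrow> nat \<Rightarrow> real mpoly" where
  "sym_to_shifted F N = mpoly_eval Const (\<lambda>k. shifted_power_sum (Suc k) N) F"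

definition shifted_to_sym :: "(nat \<Rightarrow> real mpoly) \<Rightarrow> sym" where
  "shifted_to_sym f = (THE F. \<forall>N\<ge>1. sym_to_shifted F N = f N)"

definition FS :: "young \<Rightarrow> sym" where
  "FS \<nu> = shifted_to_sym (shifted_schur \<nu>)"


section \<open>Meixner symmetric functions\<close>

definition meixner_coeff ::
  "complex \<Rightarrow> complex \<Rightarrow> real \<Rightarrow> young \<Rightarrow> young \<Rightarrow> complex" where
  "meixner_coeff z z' \<xi> \<nu> \<mu> =
     (-1) ^ (ysize \<nu> - ysize \<mu>) * of_real (\<xi> / (1 - \<xi>)) ^ (ysize \<nu> - ysize \<mu>) *
     (of_nat (skew_dim \<nu> \<mu>) / fact (ysize \<nu> - ysize \<mu>)) *
     skew_poch z \<nu> \<mu> * skew_poch z' \<nu> \<mu>"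

definition meixner :: "complex \<Rightarrow> complex \<Rightarrow> real \<Rightarrow> young \<Rightarrow> symC" where
  "meixner z z' \<xi> \<nu> =
     (\<Sum>\<mu>\<in>{\<mu>. contained \<mu> \<nu>}. Const (meixner_coeff z z' \<xi> \<nu> \<mu>) * complexify (FS \<mu>))"

definition meixner_functional :: "complex \<Rightarrow> complex \<Rightarrow> real \<Rightarrow> symC \<Rightarrow> complex" where
  "meixner_functional z z' \<xi> =
     (THE \<phi>. Vector_Spaces.linear (\<lambda>c F. Const c * F) (*) \<phi> \<and>
        (\<forall>\<nu>. \<phi> (meixner z z' \<xi> \<nu>) = (if \<nu> = empty_young then 1 else 0)))"

text \<open>For admissible parameters the Meixner functions have real coefficients, see
  \<open>complexify_real_meixner\<close> below; this is the same function as an element of Sym.\<close>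

definition real_meixner :: "complex \<Rightarrow> complex \<Rightarrow> real \<Rightarrow> young \<Rightarrow> sym" where
  "real_meixner z z' \<xi> \<nu> = Poly_Mapping.map Re (meixner z z' \<xi> \<nu>)"


section \<open>Parameters and the z-measure\<close>

definition admissible :: "complex \<Rightarrow> complex \<Rightarrow> bool" where
  "admissible z z' \<longleftrightarrow> z \<noteq> 0 \<and> z' \<noteq> 0 \<and> (\<forall>\<nu>. ypoch z \<nu> * ypoch z' \<nu> \<in> \<real>\<^sub>\<ge>\<^sub>0)"

definition principal_series :: "complex \<Rightarrow> complex \<Rightarrow> bool" where
  "principal_series z z' \<longleftrightarrow> z \<notin> \<int> \<and> z' = cnj z"

definition complementary_series :: "complex \<Rightarrow> complex \<Rightarrow> bool" where
  "complementary_series z z' \<longleftrightarrow> z \<in> \<real> \<and> z' \<in> \<real> \<and>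
     (\<exists>k::int. of_int k < Re z \<and> Re z < of_int k + 1 \<and> of_int k < Re z' \<and> Re z' < of_int k + 1)"

definition z_weight :: "complex \<Rightarrow> complex \<Rightarrow> real \<Rightarrow> young \<Rightarrow> complex" where
  "z_weight z z' \<xi> \<kappa> =
     of_real (1 - \<xi>) powr (z * z') * ypoch z \<kappa> * ypoch z' \<kappa> * of_real \<xi> ^ ysize \<kappa> *
     (of_nat (ydim \<kappa>) / fact (ysize \<kappa>)) ^ 2"

text \<open>The weight is real and nonnegative for admissible parameters, see
  \<open>of_real_z_measure\<close> below.\<close>

definition z_measure :: "complex \<Rightarrow> complex \<Rightarrow> real \<Rightarrow> young \<Rightarrow> real" where
  "z_measure z z' \<xi> \<kappa> = Re (z_weight z z' \<xi> \<kappa>)"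


section \<open>Weighted real Hilbert spaces\<close>

definition ell2 :: "('a \<Rightarrow> real) \<Rightarrow> ('a \<Rightarrow> real) set" where
  "ell2 w = {f. (\<lambda>x. (f x)\<^sup>2 * w x) summable_on UNIV}"

definition ell2_inner :: "('a \<Rightarrow> real) \<Rightarrow> ('a \<Rightarrow> real) \<Rightarrow> ('a \<Rightarrow> real) \<Rightarrow> real" where
  "ell2_inner w f g = (\<Sum>\<^sub>\<infinity>x. f x * g x * w x)"

definition ell2_norm :: "('a \<Rightarrow> real) \<Rightarrow> ('a \<Rightarrow> real) \<Rightarrow> real" where
  "ell2_norm w f = sqrt (ell2_inner w f f)"

text \<open>Pairwise orthogonal nonzero vectors with dense linear span.\<close>

definition orthogonal_basis :: "('a \<Rightarrow> real) \<Rightarrow> ('i \<Rightarrow> 'a \<Rightarrow> real) \<Rightarrow> bool" where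
  "orthogonal_basis w e \<longleftrightarrow>
     (\<forall>i. e i \<in> ell2 w \<and> ell2_norm w (e i) \<noteq> 0) \<and>
     (\<forall>i j. i \<noteq> j \<longrightarrow> ell2_inner w (e i) (e j) = 0) \<and>
     (\<forall>f\<in>ell2 w. \<forall>\<epsilon>>0. \<exists>A c. finite A \<and>
        ell2_norm w (\<lambda>x. f x - (\<Sum>i\<in>A. c i * e i x)) < \<epsilon>)"


section \<open>Real-valuedness for admissible parameters\<close>

lift_definition row_young :: "nat \<Rightarrow> young" is "\<lambda>n i. if i = 0 then n else 0"
  by (auto simp: antimono_def)

lemma ypoch_row_young: "ypoch z (row_young n) = (\<Prod>j<n. z + of_nat j)"
proof -
  have "skew (row_young n) empty_young = Pair 0 ` {..<n}"
    by (auto simp: skew_def boxes_def row_young.rep_eq empty_young.rep_eq split: if_splits)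
  then show ?thesis
    by (simp add: ypoch_def skew_poch_def prod.reindex inj_on_def)
qed

lemma admissible_cases:
  assumes "admissible z z'"
  shows "(z \<in> \<real> \<and> z' \<in> \<real>) \<or> z' = cnj z"
proof -
  have h: "ypoch z (row_young n) * ypoch z' (row_young n) \<in> \<real>" for n
    using assms nonneg_Reals_subset_Reals by (auto simp: admissible_def)
  have zz: "z * z' \<in> \<real>" using h[of 1] by (simp add: ypoch_row_young)
  have "z * (z + 1) * (z' * (z' + 1)) \<in> \<real>"
    using h[of 2] by (simp add: ypoch_row_young lessThan_Suc numeral_2_eq_2 ac_simps)
  also have "z * (z + 1) * (z' * (z' + 1)) = (z * z') * (z * z' + (z + z') + 1)"
    by (simp add: algebra_simps)
  finally have "(z * z') * (z * z' + (z + z') + 1) / (z * z') \<in> \<real>"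
    using zz by (rule Reals_divide)
  then have "z * z' + (z + z') + 1 \<in> \<real>"
    using assms by (simp add: admissible_def)
  then have "(z * z' + (z + z') + 1) - z * z' - 1 \<in> \<real>"
    using zz by (intro Reals_diff) auto
  then have s: "Im z' = - Im z" by (simp add: complex_is_Real_iff)
  have "Im z * (Re z' - Re z) = 0"
    using zz s by (simp add: complex_is_Real_iff algebra_simps)
  then show ?thesis
    using s by (auto simp: complex_is_Real_iff complex_eq_iff)
qed

lemma skew_poch_real:
  assumes "admissible z z'"
  shows "skew_poch z \<nu> \<mu> * skew_poch z' \<nu> \<mu> \<in> \<real>"
  using admissible_cases[OF assms]
proof
  assume "z \<in> \<real> \<and> z' \<in> \<real>"
  then show ?thesis
    unfolding skew_poch_def by (intro Reals_mult prod_in_Reals) (auto intro!: Reals_add Reals_diff)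
next
  assume "z' = cnj z"
  then have "skew_poch z' \<nu> \<mu> = cnj (skew_poch z \<nu> \<mu>)"
    unfolding skew_poch_def by (simp add: case_prod_beta)
  then show ?thesis by (simp add: complex_mult_cnj complex_is_Real_iff)
qed

lemma lookup_Const_mult:
  "Poly_Mapping.lookup (Const c * F) m = c * Poly_Mapping.lookup F m"
  for F :: "'a::comm_semiring_1 mpoly"
  by (simp add: Const_def flip: mult_map_scale_conv_mult)
     (simp add: Poly_Mapping.map.rep_eq when_def)

lemma complexify_real_meixner:
  assumes "admissible z z'"
  shows "complexify (real_meixner z z' \<xi> \<nu>) = meixner z z' \<xi> \<nu>"
proof -
  have c: "meixner_coeff z z' \<xi> \<nu> \<mu> \<in> \<real>" for \<mu>
  proof -
    have "(-1) ^ n * of_real r ^ n * (of_nat k / fact n) = complex_of_real ((-1) ^ n * r ^ n * (real k / fact n))"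
      for n k r by simp
    then have "meixner_coeff z z' \<xi> \<nu> \<mu> =
      complex_of_real ((-1) ^ (ysize \<nu> - ysize \<mu>) * (\<xi> / (1 - \<xi>)) ^ (ysize \<nu> - ysize \<mu>) *
        (real (skew_dim \<nu> \<mu>) / fact (ysize \<nu> - ysize \<mu>))) *
      (skew_poch z \<nu> \<mu> * skew_poch z' \<nu> \<mu>)"
      unfolding meixner_coeff_def by (simp only: mult.assoc)
    then show ?thesis
      by (simp only: Reals_mult[OF Reals_of_real skew_poch_real[OF assms]])
  qed
  have "Poly_Mapping.lookup (meixner z z' \<xi> \<nu>) m \<in> \<real>" for m
    unfolding meixner_def lookup_sum lookup_Const_mult
    by (intro sum_in_Reals Reals_mult c)
       (simp add: complexify_def Poly_Mapping.map.rep_eq when_def)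
  then show ?thesis
    by (intro poly_mapping_eqI)
       (auto simp: complexify_def real_meixner_def Poly_Mapping.map.rep_eq when_def
          complex_is_Real_iff complex_eq_iff)
qed

lemma of_real_z_measure:
  assumes "admissible z z'" "0 < \<xi>" "\<xi> < 1"
  shows "complex_of_real (z_measure z z' \<xi> \<kappa>) = z_weight z z' \<xi> \<kappa>"
    and "z_measure z z' \<xi> \<kappa> \<ge> 0"
proof -
  have "ypoch z (row_young 1) * ypoch z' (row_young 1) \<in> \<real>\<^sub>\<ge>\<^sub>0"
    using assms(1) unfolding admissible_def by blast
  then have "z * z' \<in> \<real>" by (auto simp: ypoch_row_young)
  then obtain r where r: "z * z' = of_real r" by (auto elim: Reals_cases)
  have p: "of_real (1 - \<xi>) powr (z * z') = complex_of_real ((1 - \<xi>) powr r)"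
    unfolding r using assms by (subst powr_of_real) auto
  have q: "ypoch z \<kappa> * ypoch z' \<kappa> \<in> \<real>\<^sub>\<ge>\<^sub>0"
    using assms(1) unfolding admissible_def by blast
  have "z_weight z z' \<xi> \<kappa> = complex_of_real ((1 - \<xi>) powr r) *
      (ypoch z \<kappa> * ypoch z' \<kappa>) *
      complex_of_real (\<xi> ^ ysize \<kappa> * (real (ydim \<kappa>) / fact (ysize \<kappa>)) ^ 2)"
    unfolding z_weight_def p by (simp add: mult.assoc)
  also have "\<dots> \<in> \<real>\<^sub>\<ge>\<^sub>0"
    using assms(2)
    by (intro nonneg_Reals_mult_I[OF nonneg_Reals_mult_I[OF _ q]])
      (simp_all only: nonneg_Reals_of_real_iff, simp_all)
  finally have "z_weight z z' \<xi> \<kappa> \<in> \<real>\<^sub>\<ge>\<^sub>0" .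
  then show "complex_of_real (z_measure z z' \<xi> \<kappa>) = z_weight z z' \<xi> \<kappa>"
    and "z_measure z z' \<xi> \<kappa> \<ge> 0"
    by (auto simp: z_measure_def complex_nonneg_Reals_iff complex_eq_iff)
qed

end

theory Submission
  imports Defs
begin

text \<open>Write \<open>M\<^sub>\<nu>\<close> for the Meixner functions. They span the complexified algebra Sym, so part (i) says that
the z-measure has mass 1 and that the expectations of all \<open>M\<^sub>\<nu>\<close> with \<open>\<nu> \<noteq> \<emptyset>\<close> vanish, which is
orthogonality of \<open>M\<^sub>\<nu>\<close> to \<open>M\<^sub>\<emptyset> = 1\<close>. Part (ii) says that the
expectation of \<open>M\<^sub>\<mu> M\<^sub>\<nu>\<close> vanishes for \<open>\<mu> \<noteq> \<nu>\<close>, is positive for \<open>\<mu> = \<nu>\<close>, and that the system is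
complete.

Everything is expressed through the normalized dimensions
\<open>d(\<kappa>,\<mu>) = dim(\<kappa>/\<mu>) / (|\<kappa>| - |\<mu>|)!\<close>, the matrix entries of \<open>exp(D)\<close>, where \<open>D\<close> removes a box in all
possible ways. Let \<open>U\<close> add a box of content \<open>c\<close> with weight \<open>(z + c)(z' + c)\<close>. Then \<open>D\<close> and \<open>U\<close>
generate a copy of \<open>sl(2)\<close>: the commutator \<open>[D, U]\<close> is diagonal with entries \<open>zz' + 2|\<kappa>|\<close>
(\<open>sum_ups_downs\<close>, \<open>up_down_exchange\<close>). The commutation rule for \<open>exp(D)\<close> and \<open>U\<close>
(\<open>ndim_commutator\<close>) gives a recursion in \<open>n\<close> for
\<open>\<Sum>\<^bsub>|\<kappa>| = n\<^esub> d(\<kappa>,\<mu>) d(\<kappa>,\<nu>) (z)\<^sub>\<kappa>(z')\<^sub>\<kappa>\<close>, which is solved in closed form (\<open>level_sum_eq\<close>) and summed against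
\<open>\<xi>\<^sup>n\<close> by the binomial series. Since \<open>FS\<^sub>\<mu>(\<kappa>) = d(\<kappa>,\<mu>) / d(\<kappa>,\<emptyset>)\<close>, this is the Gram matrix of the
\<open>FS\<^sub>\<mu>\<close>. It comes out factored as \<open>L H L\<^sup>T\<close> with \<open>H\<close> diagonal and \<open>L\<close> unitriangular
(\<open>fs_value_product_has_sum\<close>), and the coefficients of \<open>M\<^sub>\<nu>\<close> form the inverse of \<open>L\<close>
(\<open>meixner_entry_fs_entry_inverse\<close>); hence the Meixner functions are orthogonal. Up to factors that
depend on \<open>\<nu>\<close> alone or on \<open>\<kappa>\<close> alone, \<open>M\<^sub>\<nu>(\<kappa>)\<close> is symmetric in \<open>\<nu>\<close> and \<open>\<kappa>\<close>
(\<open>meixner_value_autodual\<close>), so orthogonality also holds in the dual form, which is Parseval's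
identity for functions of finite support, and completeness follows.

It remains to evaluate \<open>FS\<^sub>\<mu>\<close> on diagrams (\<open>realize_FS\<close>). On diagrams with at most \<open>N\<close> rows,
\<open>d(\<kappa>,\<mu>)\<close> is the determinant of the inverse factorials \<open>1 / (l\<^sub>j - m\<^sub>i)!\<close> with \<open>l\<^sub>j = \<kappa>\<^sub>j + N - j\<close> and
\<open>m\<^sub>i = \<mu>\<^sub>i + N - i\<close>. Multiplication by a power sum in the \<open>l\<^sub>j\<close> only raises the \<open>m\<^sub>i\<close>, so an element
of Sym of weight at most \<open>n\<close> is a combination of the functions \<open>d(_,\<mu>) / d(_,\<emptyset>)\<close> with
\<open>|\<mu>| \<le> n\<close> (\<open>realize_expansion\<close>). Elements of Sym are determined by their values on diagrams
(\<open>realize_eq_0\<close>), and there are as many monomials in the power sums of weight at most \<open>n\<close> as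
diagrams of size at most \<open>n\<close>; so, conversely, each of these functions comes from Sym. A comparison
with the quotient of determinants that defines the factorial Schur polynomial shows that the
corresponding element is \<open>FS\<^sub>\<mu>\<close>.\<close>

section \<open>Young diagrams and the covering relation\<close>

lemma yrow_antimono: "i \<le> j \<Longrightarrow> yrow \<nu> j \<le> yrow \<nu> i"
  using yrow[of \<nu>] by (auto simp: antimono_def)

lemma finite_yrow: "finite {i. yrow \<nu> i \<noteq> 0}"
  using yrow[of \<nu>] by auto

lemma young_eqI: "(\<And>i. yrow \<mu> i = yrow \<nu> i) \<Longrightarrow> \<mu> = \<nu>"
  by (metis yrow_inject ext)

text \<open>Rows, columns and the diagonal of a diagram are down-closed finite sets of naturals; this is how
  their lengths, defined as cardinalities, are compared with positions.\<close>

lemma downset_nat_eq_lessThan_card: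
  fixes S :: "nat set"
  assumes "finite S" "\<And>i j. i \<in> S \<Longrightarrow> j \<le> i \<Longrightarrow> j \<in> S"
  shows "S = {..<card S}"
proof (cases "S = {}")
  case False
  have "S = {..Max S}"
    using assms False Max_in[OF assms(1) False] Max_ge[OF assms(1)] by blast
  then show ?thesis
    by (metis card_atMost lessThan_Suc_atMost)
qed auto

lemma yrow_eq_0_iff: "yrow \<nu> i = 0 \<longleftrightarrow> ylength \<nu> \<le> i"
proof -
  have "{i. yrow \<nu> i \<noteq> 0} = {..<ylength \<nu>}"
    unfolding ylength_def
  proof (rule downset_nat_eq_lessThan_card[OF finite_yrow])
    fix i j assume "i \<in> {i. yrow \<nu> i \<noteq> 0}" "j \<le> i"
    then show "j \<in> {i. yrow \<nu> i \<noteq> 0}" using yrow_antimono[of j i \<nu>] by auto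
  qed
  then show ?thesis by (metis (mono_tags, lifting) lessThan_iff mem_Collect_eq not_less)
qed

lemma boxes_eq_Sigma: "ylength \<nu> \<le> N \<Longrightarrow> boxes \<nu> = (SIGMA i:{..<N}. {..<yrow \<nu> i})"
  unfolding boxes_def using yrow_eq_0_iff[of \<nu>] by (auto simp: Sigma_def) (metis le_trans not_le not_less_zero)

lemma finite_boxes [simp]: "finite (boxes \<nu>)"
  by (subst boxes_eq_Sigma[of \<nu> "ylength \<nu>"]) auto

lemma ysize_eq_sum: "ylength \<nu> \<le> N \<Longrightarrow> ysize \<nu> = (\<Sum>i<N. yrow \<nu> i)"
  unfolding ysize_def by (subst boxes_eq_Sigma[of \<nu> N]) auto

lemma contained_iff: "contained \<mu> \<nu> \<longleftrightarrow> (\<forall>i. yrow \<mu> i \<le> yrow \<nu> i)"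
proof
  assume c: "contained \<mu> \<nu>"
  show "\<forall>i. yrow \<mu> i \<le> yrow \<nu> i"
  proof
    fix i
    show "yrow \<mu> i \<le> yrow \<nu> i"
    proof (cases "yrow \<mu> i")
      case (Suc k)
      then have "(i, k) \<in> boxes \<mu>" by (simp add: boxes_def)
      then have "(i, k) \<in> boxes \<nu>" using c by (auto simp: contained_def)
      then show ?thesis using Suc by (simp add: boxes_def)
    qed simp
  qed
next
  assume "\<forall>i. yrow \<mu> i \<le> yrow \<nu> i"
  then show "contained \<mu> \<nu>"
    unfolding contained_def boxes_def using less_le_trans by blast
qed

lemma contained_refl [simp]: "contained \<nu> \<nu>"
  by (simp add: contained_def)

lemma contained_trans: "contained \<mu> \<nu> \<Longrightarrow> contained \<nu> \<kappa> \<Longrightarrow> contained \<mu> \<kappa>"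
  by (auto simp: contained_def)

lemma contained_antisym: "contained \<mu> \<nu> \<Longrightarrow> contained \<nu> \<mu> \<Longrightarrow> \<mu> = \<nu>"
  by (auto simp: contained_iff intro!: young_eqI antisym)

lemma boxes_inject: "boxes \<mu> = boxes \<nu> \<longleftrightarrow> \<mu> = \<nu>"
  using contained_antisym by (auto simp: contained_def)

lemma boxes_empty_young [simp]: "boxes empty_young = {}"
  by (auto simp: boxes_def empty_young.rep_eq)

lemma contained_empty_young [simp]: "contained empty_young \<nu>"
  by (simp add: contained_def)

lemma ysize_empty_young [simp]: "ysize empty_young = 0"
  by (simp add: ysize_def)

lemma ysize_eq_0_iff [simp]: "ysize \<nu> = 0 \<longleftrightarrow> \<nu> = empty_young"
  using boxes_inject[of \<nu> empty_young] by (auto simp: ysize_def)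

lemma ysize_mono: "contained \<mu> \<nu> \<Longrightarrow> ysize \<mu> \<le> ysize \<nu>"
  by (simp add: ysize_def contained_def card_mono)

text \<open>Sizes detect equality of nested diagrams; most identifications of diagrams below use this.\<close>

lemma contained_eqI: "contained \<mu> \<nu> \<Longrightarrow> ysize \<nu> \<le> ysize \<mu> \<Longrightarrow> \<mu> = \<nu>"
  unfolding ysize_def contained_def boxes_inject[symmetric]
  by (rule card_seteq) auto

lemma ylength_mono: "contained \<mu> \<nu> \<Longrightarrow> ylength \<mu> \<le> ylength \<nu>"
  by (metis contained_iff le_zero_eq order_refl yrow_eq_0_iff)

lemma finite_skew [simp]: "finite (skew \<nu> \<mu>)"
  by (simp add: skew_def)

lemma card_skew: "contained \<mu> \<nu> \<Longrightarrow> card (skew \<nu> \<mu>) = ysize \<nu> - ysize \<mu>"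
  by (simp add: skew_def ysize_def contained_def card_Diff_subset)

text \<open>Union and intersection of diagrams, row by row.\<close>

definition ysup :: "young \<Rightarrow> young \<Rightarrow> young" where
  "ysup \<mu> \<nu> = Young (\<lambda>i. max (yrow \<mu> i) (yrow \<nu> i))"

definition yinf :: "young \<Rightarrow> young \<Rightarrow> young" where
  "yinf \<mu> \<nu> = Young (\<lambda>i. min (yrow \<mu> i) (yrow \<nu> i))"

lemma yrow_ysup: "yrow (ysup \<mu> \<nu>) i = max (yrow \<mu> i) (yrow \<nu> i)"
proof -
  have "finite {i. max (yrow \<mu> i) (yrow \<nu> i) \<noteq> 0}"
    by (rule finite_subset[of _ "{i. yrow \<mu> i \<noteq> 0} \<union> {i. yrow \<nu> i \<noteq> 0}"])
       (use finite_yrow[of \<mu>] finite_yrow[of \<nu>] in auto)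
  moreover have "antimono (\<lambda>i. max (yrow \<mu> i) (yrow \<nu> i))"
    unfolding antimono_def by (intro allI impI max.mono yrow_antimono)
  ultimately show ?thesis unfolding ysup_def by (subst Young_inverse) (blast, simp)
qed

lemma yrow_yinf: "yrow (yinf \<mu> \<nu>) i = min (yrow \<mu> i) (yrow \<nu> i)"
proof -
  have "finite {i. min (yrow \<mu> i) (yrow \<nu> i) \<noteq> 0}"
    by (rule finite_subset[OF _ finite_yrow[of \<mu>]]) auto
  moreover have "antimono (\<lambda>i. min (yrow \<mu> i) (yrow \<nu> i))"
    unfolding antimono_def by (intro allI impI min.mono yrow_antimono)
  ultimately show ?thesis unfolding yinf_def by (subst Young_inverse) simp_all
qed

lemma boxes_ysup: "boxes (ysup \<mu> \<nu>) = boxes \<mu> \<union> boxes \<nu>"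
  by (auto simp: boxes_def yrow_ysup)

lemma boxes_yinf: "boxes (yinf \<mu> \<nu>) = boxes \<mu> \<inter> boxes \<nu>"
  by (auto simp: boxes_def yrow_yinf)

lemma ysize_sup_inf: "ysize (ysup \<mu> \<nu>) + ysize (yinf \<mu> \<nu>) = ysize \<mu> + ysize \<nu>"
  using card_Un_Int[of "boxes \<mu>" "boxes \<nu>"] by (simp add: ysize_def boxes_ysup boxes_yinf)

lemma finite_contained [simp]: "finite {\<mu>. contained \<mu> \<nu>}"
proof (rule finite_imageD[of boxes])
  show "finite (boxes ` {\<mu>. contained \<mu> \<nu>})"
    by (rule finite_subset[of _ "Pow (boxes \<nu>)"]) (auto simp: contained_def)
qed (auto simp: inj_on_def boxes_inject)

lemma boxes_subset_square: "boxes \<nu> \<subseteq> {..<ysize \<nu>} \<times> {..<ysize \<nu>}"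
proof (clarify)
  fix i j assume ij: "(i, j) \<in> boxes \<nu>"
  have "Pair i ` {..j} \<subseteq> boxes \<nu>" using ij by (auto simp: boxes_def)
  then have 1: "card (Pair i ` {..j}) \<le> ysize \<nu>"
    unfolding ysize_def by (rule card_mono[rotated]) simp
  have "(\<lambda>i. (i, j)) ` {..i} \<subseteq> boxes \<nu>"
    using ij yrow_antimono[of _ i \<nu>] less_le_trans by (fastforce simp: boxes_def)
  then have 2: "card ((\<lambda>i. (i, j)) ` {..i}) \<le> ysize \<nu>"
    unfolding ysize_def by (rule card_mono[rotated]) simp
  show "i \<in> {..<ysize \<nu>} \<and> j \<in> {..<ysize \<nu>}"
    using 1 2 by (simp add: card_image inj_on_def)
qed

lemma finite_ysize_le [simp]: "finite {\<nu>. ysize \<nu> \<le> n}"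
proof (rule finite_imageD[of boxes])
  have "boxes ` {\<nu>. ysize \<nu> \<le> n} \<subseteq> Pow ({..<n} \<times> {..<n})"
    using boxes_subset_square by fastforce
  then show "finite (boxes ` {\<nu>. ysize \<nu> \<le> n})"
    by (rule finite_subset) simp
qed (auto simp: inj_on_def boxes_inject)

lemma finite_ysize_eq [simp]: "finite {\<nu>. ysize \<nu> = n}"
  by (rule finite_subset[OF _ finite_ysize_le[of n]]) auto

lemma ylength_le_ysize: "ylength \<nu> \<le> ysize \<nu>"
proof -
  have "yrow \<nu> (ysize \<nu>) = 0"
    using boxes_subset_square[of \<nu>] by (auto simp: boxes_def)
  then show ?thesis by (simp add: yrow_eq_0_iff)
qed

text \<open>The covering relation of Young's lattice: \<open>\<nu>\<close> arises from \<open>\<kappa>\<close> by adding one box.\<close>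

definition covers :: "young \<Rightarrow> young \<Rightarrow> bool" where
  "covers \<kappa> \<nu> \<longleftrightarrow> contained \<kappa> \<nu> \<and> ysize \<nu> = Suc (ysize \<kappa>)"

text \<open>The diagrams obtained by adding, respectively removing, one box.\<close>

definition ups :: "young \<Rightarrow> young set" where "ups \<kappa> = {\<nu>. covers \<kappa> \<nu>}"
definition downs :: "young \<Rightarrow> young set" where "downs \<nu> = {\<kappa>. covers \<kappa> \<nu>}"

lemma finite_ups [simp]: "finite (ups \<kappa>)"
  by (rule finite_subset[OF _ finite_ysize_le[of "Suc (ysize \<kappa>)"]]) (auto simp: ups_def covers_def)

lemma finite_downs [simp]: "finite (downs \<nu>)"
  by (rule finite_subset[OF _ finite_contained[of \<nu>]]) (auto simp: downs_def covers_def)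

lemma ysize_ups: "\<nu> \<in> ups \<kappa> \<Longrightarrow> ysize \<nu> = Suc (ysize \<kappa>)"
  and ysize_downs: "\<kappa> \<in> downs \<nu> \<Longrightarrow> ysize \<nu> = Suc (ysize \<kappa>)"
  and contained_downs: "\<kappa> \<in> downs \<nu> \<Longrightarrow> contained \<kappa> \<nu>"
  by (auto simp: ups_def downs_def covers_def)

text \<open>Row \<open>i\<close> of \<open>\<kappa>\<close> can be lengthened, respectively row \<open>i\<close> of \<open>\<nu>\<close> can be shortened, by one box.\<close>

definition addable :: "young \<Rightarrow> nat \<Rightarrow> bool" where
  "addable \<kappa> i \<longleftrightarrow> i = 0 \<or> yrow \<kappa> i < yrow \<kappa> (i - 1)"

definition removable :: "young \<Rightarrow> nat \<Rightarrow> bool" where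
  "removable \<nu> i \<longleftrightarrow> yrow \<nu> (Suc i) < yrow \<nu> i"

text \<open>The diagram with row \<open>i\<close> changed by one box. The definitions are meaningful only for addable,
  respectively removable, rows; otherwise \<open>Young\<close> is applied outside its domain.\<close>

definition yinc :: "young \<Rightarrow> nat \<Rightarrow> young" where
  "yinc \<kappa> i = Young ((yrow \<kappa>)(i := Suc (yrow \<kappa> i)))"

definition ydec :: "young \<Rightarrow> nat \<Rightarrow> young" where
  "ydec \<nu> i = Young ((yrow \<nu>)(i := yrow \<nu> i - 1))"

lemma yrow_yinc:
  assumes "addable \<kappa> i"
  shows "yrow (yinc \<kappa> i) = (yrow \<kappa>)(i := Suc (yrow \<kappa> i))"
proof -
  have "antimono ((yrow \<kappa>)(i := Suc (yrow \<kappa> i)))"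
    unfolding antimono_def
  proof (intro allI impI)
    fix a b :: nat assume ab: "a \<le> b"
    have "yrow \<kappa> i < yrow \<kappa> a" if "a < i"
      using that assms yrow_antimono[of a "i - 1" \<kappa>] by (cases i) (auto simp: addable_def)
    then show "((yrow \<kappa>)(i := Suc (yrow \<kappa> i))) b \<le> ((yrow \<kappa>)(i := Suc (yrow \<kappa> i))) a"
      using ab yrow_antimono[OF ab, of \<kappa>] by auto
  qed
  moreover have "finite {a. ((yrow \<kappa>)(i := Suc (yrow \<kappa> i))) a \<noteq> 0}"
    by (rule finite_subset[of _ "insert i {a. yrow \<kappa> a \<noteq> 0}"]) (use finite_yrow[of \<kappa>] in auto)
  ultimately show ?thesis unfolding yinc_def by (intro Young_inverse) simp
qed

lemma yrow_ydec:
  assumes "removable \<nu> i"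
  shows "yrow (ydec \<nu> i) = (yrow \<nu>)(i := yrow \<nu> i - 1)"
proof -
  have "antimono ((yrow \<nu>)(i := yrow \<nu> i - 1))"
    unfolding antimono_def
  proof (intro allI impI)
    fix a b :: nat assume ab: "a \<le> b"
    have "yrow \<nu> b < yrow \<nu> i" if "i < b"
      using that assms yrow_antimono[of "Suc i" b \<nu>] by (auto simp: removable_def)
    then show "((yrow \<nu>)(i := yrow \<nu> i - 1)) b \<le> ((yrow \<nu>)(i := yrow \<nu> i - 1)) a"
      using ab yrow_antimono[OF ab, of \<nu>] by auto
  qed
  moreover have "finite {a. ((yrow \<nu>)(i := yrow \<nu> i - 1)) a \<noteq> 0}"
    by (rule finite_subset[OF _ finite_yrow[of \<nu>]]) auto
  ultimately show ?thesis unfolding ydec_def by (intro Young_inverse) simp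
qed

lemma skew_yinc: "addable \<kappa> i \<Longrightarrow> skew (yinc \<kappa> i) \<kappa> = {(i, yrow \<kappa> i)}"
  by (auto simp: skew_def boxes_def yrow_yinc split: if_splits)

lemma skew_ydec: "removable \<nu> i \<Longrightarrow> skew \<nu> (ydec \<nu> i) = {(i, yrow \<nu> i - 1)}"
  by (auto simp: skew_def boxes_def yrow_ydec removable_def split: if_splits)

lemma covers_iff_skew: "covers \<kappa> \<nu> \<longleftrightarrow> contained \<kappa> \<nu> \<and> card (skew \<nu> \<kappa>) = 1"
  using ysize_mono[of \<kappa> \<nu>] by (auto simp: covers_def card_skew)

lemma yrow_covers:
  assumes "covers \<kappa> \<nu>"
  obtains i where "yrow \<nu> = (yrow \<kappa>)(i := Suc (yrow \<kappa> i))"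
proof -
  obtain b where b: "skew \<nu> \<kappa> = {b}"
    using assms by (auto simp: covers_iff_skew card_1_singleton_iff)
  obtain i j where ij: "b = (i, j)" by fastforce
  have le: "yrow \<kappa> k \<le> yrow \<nu> k" for k
    using assms by (auto simp: covers_def contained_iff)
  have mem: "(k, l) \<in> skew \<nu> \<kappa> \<longleftrightarrow> yrow \<kappa> k \<le> l \<and> l < yrow \<nu> k" for k l
    by (auto simp: skew_def boxes_def)
  have eq: "yrow \<kappa> k \<le> l \<and> l < yrow \<nu> k \<longleftrightarrow> k = i \<and> l = j" for k l
    unfolding mem[symmetric] b ij by auto
  have "yrow \<nu> k = yrow \<kappa> k" if "k \<noteq> i" for k
    using eq[of k "yrow \<kappa> k"] le[of k] that by auto
  moreover have "yrow \<nu> i = Suc (yrow \<kappa> i)"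
    using eq[of i "yrow \<kappa> i"] eq[of i "Suc (yrow \<kappa> i)"] eq[of i j] by auto
  ultimately show ?thesis by (intro that[of i]) auto
qed

lemma ups_eq: "ups \<kappa> = yinc \<kappa> ` {i. addable \<kappa> i}"
proof (intro equalityI subsetI)
  fix \<nu> assume "\<nu> \<in> ups \<kappa>"
  then obtain i where i: "yrow \<nu> = (yrow \<kappa>)(i := Suc (yrow \<kappa> i))"
    by (auto simp: ups_def elim: yrow_covers)
  have "addable \<kappa> i"
    using yrow_antimono[of "i - 1" i \<nu>] by (auto simp: i addable_def split: if_splits)
  then show "\<nu> \<in> yinc \<kappa> ` {i. addable \<kappa> i}"
    by (auto intro!: image_eqI[of _ _ i] young_eqI simp: yrow_yinc i)
next
  fix \<nu> assume "\<nu> \<in> yinc \<kappa> ` {i. addable \<kappa> i}"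
  then obtain i where "addable \<kappa> i" "\<nu> = yinc \<kappa> i" by auto
  then show "\<nu> \<in> ups \<kappa>"
    by (auto simp: ups_def covers_iff_skew skew_yinc contained_iff yrow_yinc)
qed

lemma downs_eq: "downs \<nu> = ydec \<nu> ` {i. removable \<nu> i}"
proof (intro equalityI subsetI)
  fix \<kappa> assume "\<kappa> \<in> downs \<nu>"
  then obtain i where i: "yrow \<nu> = (yrow \<kappa>)(i := Suc (yrow \<kappa> i))"
    by (auto simp: downs_def elim: yrow_covers)
  have "removable \<nu> i"
    using yrow_antimono[of i "Suc i" \<kappa>] by (auto simp: i removable_def)
  then show "\<kappa> \<in> ydec \<nu> ` {i. removable \<nu> i}"
    by (auto intro!: image_eqI[of _ _ i] young_eqI simp: yrow_ydec i)
next
  fix \<kappa> assume "\<kappa> \<in> ydec \<nu> ` {i. removable \<nu> i}"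
  then obtain i where "removable \<nu> i" "\<kappa> = ydec \<nu> i" by auto
  then show "\<kappa> \<in> downs \<nu>"
    by (auto simp: downs_def covers_iff_skew skew_ydec contained_iff yrow_ydec)
qed

lemma inj_on_yinc: "inj_on (yinc \<kappa>) {i. addable \<kappa> i}"
proof (rule inj_onI, clarsimp)
  fix i j assume *: "addable \<kappa> i" "addable \<kappa> j" "yinc \<kappa> i = yinc \<kappa> j"
  then have "{(i, yrow \<kappa> i)} = {(j, yrow \<kappa> j)}" by (metis skew_yinc)
  then show "i = j" by simp
qed

lemma inj_on_ydec: "inj_on (ydec \<nu>) {i. removable \<nu> i}"
proof (rule inj_onI, clarsimp)
  fix i j assume *: "removable \<nu> i" "removable \<nu> j" "ydec \<nu> i = ydec \<nu> j"
  then have "{(i, yrow \<nu> i - 1)} = {(j, yrow \<nu> j - 1)}" by (metis skew_ydec)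
  then show "i = j" by simp
qed

lemma removable_less: "removable \<nu> i \<Longrightarrow> i < ylength \<nu>"
  by (metis removable_def not_le not_less_zero yrow_eq_0_iff)

lemma downs_nonempty: "\<nu> \<noteq> empty_young \<Longrightarrow> downs \<nu> \<noteq> {}"
proof -
  assume "\<nu> \<noteq> empty_young"
  then have "ylength \<nu> \<noteq> 0"
    by (metis boxes_inject boxes_empty_young boxes_eq_Sigma le_zero_eq lessThan_0 Sigma_empty1)
  then have "removable \<nu> (ylength \<nu> - 1)"
    using yrow_eq_0_iff[of \<nu> "ylength \<nu>"] yrow_eq_0_iff[of \<nu> "ylength \<nu> - 1"]
    by (cases "ylength \<nu>") (auto simp: removable_def)
  then show ?thesis by (auto simp: downs_eq)
qed

lemma young_size_induct [case_names step]:
  assumes "\<And>\<nu>. (\<And>\<kappa>. ysize \<kappa> < ysize \<nu> \<Longrightarrow> P \<kappa>) \<Longrightarrow> P \<nu>"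
  shows "P \<nu>"
  using assms by (rule measure_induct_rule[of ysize])


section \<open>Dimensions of skew diagrams\<close>

lemma standard_tableaux_iff:
  "T \<in> standard_tableaux D \<longleftrightarrow> T \<in> extensional D \<and> bij_betw T D {1..card D} \<and>
     (\<forall>i j j'. (i, j) \<in> D \<and> (i, j') \<in> D \<and> j < j' \<longrightarrow> T (i, j) < T (i, j')) \<and>
     (\<forall>i i' j. (i, j) \<in> D \<and> (i', j) \<in> D \<and> i < i' \<longrightarrow> T (i, j) < T (i', j))"
  unfolding standard_tableaux_def by (auto simp: PiE_def bij_betw_def)

lemma standard_tableaux_empty: "standard_tableaux {} = {\<lambda>_. undefined}"
  by (auto simp: standard_tableaux_def bij_betw_def)

lemma finite_standard_tableaux: "finite D \<Longrightarrow> finite (standard_tableaux D)"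
  by (rule finite_subset[of _ "D \<rightarrow>\<^sub>E {1..card D}"]) (auto simp: standard_tableaux_def intro: finite_PiE)

text \<open>Deleting the largest entry of a standard tableau, when it sits in a given corner box.\<close>

lemma card_tableaux_remove_corner:
  assumes D: "finite D" "(a, b) \<in> D"
    and row: "\<And>j. (a, j) \<in> D \<Longrightarrow> j \<le> b" and col: "\<And>i. (i, b) \<in> D \<Longrightarrow> i \<le> a"
  shows "card {T \<in> standard_tableaux D. T (a, b) = card D} = card (standard_tableaux (D - {(a, b)}))"
proof -
  obtain n where n: "card D = Suc n" using D by (metis card_gt_0_iff empty_iff gr0_implies_Suc)
  have n': "card (D - {(a, b)}) = n" using D n by simp
  have ins: "(D - {(a, b)}) \<union> {(a, b)} = D" using D by auto
  have "bij_betw (\<lambda>T. restrict T (D - {(a, b)})) {T \<in> standard_tableaux D. T (a, b) = Suc n}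
      (standard_tableaux (D - {(a, b)}))"
  proof (rule bij_betw_byWitness[where f' = "\<lambda>T. T((a, b) := Suc n)"])
    show "\<forall>T\<in>{T \<in> standard_tableaux D. T (a, b) = Suc n}.
        (restrict T (D - {(a, b)}))((a, b) := Suc n) = T"
      by (auto simp: standard_tableaux_iff extensional_def fun_eq_iff)
    show "\<forall>T\<in>standard_tableaux (D - {(a, b)}). restrict (T((a, b) := Suc n)) (D - {(a, b)}) = T"
      by (auto simp: standard_tableaux_iff extensional_def fun_eq_iff)
    show "(\<lambda>T. restrict T (D - {(a, b)})) ` {T \<in> standard_tableaux D. T (a, b) = Suc n}
        \<subseteq> standard_tableaux (D - {(a, b)})"
    proof (rule image_subsetI)
      fix T assume "T \<in> {T \<in> standard_tableaux D. T (a, b) = Suc n}"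
      then have T: "T \<in> standard_tableaux D" "T (a, b) = Suc n" by auto
      then have bij: "bij_betw T D {1..Suc n}" by (auto simp: standard_tableaux_iff n)
      have "T ` (D - {(a, b)}) = T ` D - {Suc n}"
        using bij D(2) T(2) by (subst inj_on_image_set_diff[of T D]) (auto simp: bij_betw_def)
      also have "\<dots> = {1..n}" using bij by (auto simp: bij_betw_def)
      finally have "bij_betw T (D - {(a, b)}) {1..n}"
        using bij by (auto simp: bij_betw_def intro: inj_on_subset)
      then have "bij_betw (restrict T (D - {(a, b)})) (D - {(a, b)}) {1..n}"
        using bij_betw_cong[of "D - {(a, b)}" "restrict T (D - {(a, b)})" T] by simp
      then show "restrict T (D - {(a, b)}) \<in> standard_tableaux (D - {(a, b)})"
        using T(1) unfolding standard_tableaux_iff n' by (auto simp del: One_nat_def)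
    qed
    show "(\<lambda>T. T((a, b) := Suc n)) ` standard_tableaux (D - {(a, b)})
        \<subseteq> {T \<in> standard_tableaux D. T (a, b) = Suc n}"
    proof (rule image_subsetI)
      fix T assume T: "T \<in> standard_tableaux (D - {(a, b)})"
      define T' where "T' = T((a, b) := Suc n)"
      have bij: "bij_betw T (D - {(a, b)}) {1..n}"
        using T unfolding standard_tableaux_iff n' by blast
      then have le: "T x \<le> n" if "x \<in> D" "x \<noteq> (a, b)" for x
        using that by (auto simp: bij_betw_def)
      have "bij_betw T' (D - {(a, b)}) {1..n}"
        using bij bij_betw_cong[of "D - {(a, b)}" T' T] by (simp add: T'_def)
      then have "bij_betw T' ((D - {(a, b)}) \<union> {(a, b)}) ({1..n} \<union> {T' (a, b)})"
        by (intro notIn_Un_bij_betw) (auto simp: T'_def)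
      then have "bij_betw T' D {1..Suc n}"
        unfolding ins by (simp add: T'_def atLeastAtMostSuc_conv)
      moreover have "T' \<in> extensional D"
        using T D(2) by (auto simp: standard_tableaux_iff extensional_def T'_def)
      moreover have "T' (i, j) < T' (i, j')" if "(i, j) \<in> D" "(i, j') \<in> D" "j < j'" for i j j'
        using T that le[of "(i, j)"] row[of j'] unfolding T'_def standard_tableaux_iff by force
      moreover have "T' (i, j) < T' (i', j)" if "(i, j) \<in> D" "(i', j) \<in> D" "i < i'" for i i' j
        using T that le[of "(i, j)"] col[of i'] unfolding T'_def standard_tableaux_iff by force
      ultimately have "T' \<in> standard_tableaux D"
        unfolding standard_tableaux_iff n by blast
      then show "T((a, b) := Suc n) \<in> {T \<in> standard_tableaux D. T (a, b) = Suc n}"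
        by (simp add: T'_def)
    qed
  qed
  then show ?thesis using n by (simp add: bij_betw_same_card)
qed

text \<open>The largest entry of a standard tableau of shape \<open>\<nu>/\<mu>\<close> occupies a corner of \<open>\<nu>\<close>.\<close>

lemma skew_dim_rec:
  assumes "contained \<mu> \<nu>" "\<mu> \<noteq> \<nu>"
  shows "skew_dim \<nu> \<mu> = (\<Sum>\<kappa>\<in>{\<kappa>\<in>downs \<nu>. contained \<mu> \<kappa>}. skew_dim \<kappa> \<mu>)"
proof -
  define D where "D = skew \<nu> \<mu>"
  define box where "box \<kappa> = the_elem (skew \<nu> \<kappa>)" for \<kappa>
  define K where "K = {\<kappa>\<in>downs \<nu>. contained \<mu> \<kappa>}"
  have finD: "finite D" by (simp add: D_def)
  have "boxes \<mu> \<noteq> boxes \<nu>" using assms by (simp add: boxes_inject)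
  then have D0: "D \<noteq> {}" using assms(1) by (auto simp: D_def skew_def contained_def)
  have sk: "skew \<nu> \<kappa> = {box \<kappa>}" if "\<kappa> \<in> downs \<nu>" for \<kappa>
    using that by (auto simp: box_def downs_eq skew_ydec)
  have K: "box \<kappa> \<in> D" "D - {box \<kappa>} = skew \<kappa> \<mu>" if "\<kappa> \<in> K" for \<kappa>
  proof -
    have "skew \<nu> \<kappa> = {box \<kappa>}" "contained \<kappa> \<nu>" "contained \<mu> \<kappa>"
      using that sk contained_downs by (auto simp: K_def)
    then show "box \<kappa> \<in> D" "D - {box \<kappa>} = skew \<kappa> \<mu>"
      unfolding D_def skew_def contained_def by blast+
  qed
  have corner: "card {T \<in> standard_tableaux D. T (box \<kappa>) = card D} = skew_dim \<kappa> \<mu>"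
    if \<kappa>: "\<kappa> \<in> K" for \<kappa>
  proof -
    obtain i where i: "removable \<nu> i" "\<kappa> = ydec \<nu> i"
      using \<kappa> by (auto simp: K_def downs_eq)
    then have b: "box \<kappa> = (i, yrow \<nu> i - 1)" by (simp add: box_def skew_ydec)
    have "card {T \<in> standard_tableaux D. T (i, yrow \<nu> i - 1) = card D}
        = card (standard_tableaux (D - {(i, yrow \<nu> i - 1)}))"
    proof (rule card_tableaux_remove_corner[OF finD])
      show "(i, yrow \<nu> i - 1) \<in> D" using K(1)[OF \<kappa>] b by simp
      show "j \<le> yrow \<nu> i - 1" if "(i, j) \<in> D" for j
        using that by (auto simp: D_def skew_def boxes_def)
      show "k \<le> i" if "(k, yrow \<nu> i - 1) \<in> D" for k
      proof (rule ccontr)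
        assume "\<not> k \<le> i"
        then have "yrow \<nu> k \<le> yrow \<nu> (Suc i)" by (intro yrow_antimono) simp
        then show False using that i(1) by (auto simp: D_def skew_def boxes_def removable_def)
      qed
    qed
    then show ?thesis using K(2)[OF \<kappa>] by (simp add: b skew_dim_def)
  qed
  have "standard_tableaux D = (\<Union>\<kappa>\<in>K. {T \<in> standard_tableaux D. T (box \<kappa>) = card D})"
  proof (intro equalityI subsetI)
    fix T assume T: "T \<in> standard_tableaux D"
    then have bij: "bij_betw T D {1..card D}" by (simp add: standard_tableaux_iff)
    have "card D \<in> {1..card D}" using D0 finD by (simp add: Suc_leI card_gt_0_iff)
    then obtain b where b: "b \<in> D" "T b = card D"
      using bij by (metis bij_betw_imp_surj_on imageE)
    obtain i j where ij: "b = (i, j)" by fastforce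
    have le: "T x \<le> card D" if "x \<in> D" for x using bij that by (auto simp: bij_betw_def)
    have not\<mu>: "yrow \<mu> i \<le> j" and j: "j < yrow \<nu> i"
      using b(1) by (auto simp: D_def ij skew_def boxes_def)
    have "(i, Suc j) \<notin> D"
      using T b(1) le[of "(i, Suc j)"] b(2) unfolding standard_tableaux_iff ij by force
    then have j': "Suc j = yrow \<nu> i"
      using not\<mu> j by (auto simp: D_def skew_def boxes_def)
    have "(Suc i, j) \<notin> D"
      using T b(1) le[of "(Suc i, j)"] b(2) unfolding standard_tableaux_iff ij by force
    then have "yrow \<nu> (Suc i) \<le> j"
      using not\<mu> yrow_antimono[of i "Suc i" \<mu>] by (auto simp: D_def skew_def boxes_def)
    then have rem: "removable \<nu> i" using j by (simp add: removable_def)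
    have "contained \<mu> (ydec \<nu> i)"
      using assms(1) not\<mu> j' by (auto simp: contained_iff yrow_ydec[OF rem])
    then have "ydec \<nu> i \<in> K" using rem by (auto simp: K_def downs_eq)
    moreover have "box (ydec \<nu> i) = b" using j' by (auto simp: box_def skew_ydec[OF rem] ij)
    ultimately show "T \<in> (\<Union>\<kappa>\<in>K. {T \<in> standard_tableaux D. T (box \<kappa>) = card D})"
      using T b(2) by blast
  qed auto
  then have "card (standard_tableaux D) = card (\<Union>\<kappa>\<in>K. {T \<in> standard_tableaux D. T (box \<kappa>) = card D})"
    by simp
  also have "\<dots> = (\<Sum>\<kappa>\<in>K. card {T \<in> standard_tableaux D. T (box \<kappa>) = card D})"
  proof (rule card_UN_disjoint)
    show "finite K" by (simp add: K_def)
    show "\<forall>\<kappa>\<in>K. finite {T \<in> standard_tableaux D. T (box \<kappa>) = card D}"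
      using finite_standard_tableaux[OF finD] by simp
    show "\<forall>\<kappa>\<in>K. \<forall>\<kappa>'\<in>K. \<kappa> \<noteq> \<kappa>' \<longrightarrow> {T \<in> standard_tableaux D. T (box \<kappa>) = card D} \<inter>
        {T \<in> standard_tableaux D. T (box \<kappa>') = card D} = {}"
    proof (intro ballI impI, rule ccontr)
      fix \<kappa> \<kappa>' assume *: "\<kappa> \<in> K" "\<kappa>' \<in> K" "\<kappa> \<noteq> \<kappa>'"
        "{T \<in> standard_tableaux D. T (box \<kappa>) = card D} \<inter>
        {T \<in> standard_tableaux D. T (box \<kappa>') = card D} \<noteq> {}"
      then obtain T where T: "T \<in> standard_tableaux D" "T (box \<kappa>) = T (box \<kappa>')"
        by (metis (mono_tags, lifting) IntE equals0I mem_Collect_eq)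
      then have "inj_on T D" by (simp add: standard_tableaux_iff bij_betw_def)
      then have "box \<kappa> = box \<kappa>'" using T(2) K(1)[OF *(1)] K(1)[OF *(2)] by (meson inj_onD)
      then have "skew \<nu> \<kappa> = skew \<nu> \<kappa>'" using sk * by (auto simp: K_def)
      moreover have "contained \<kappa> \<nu>" "contained \<kappa>' \<nu>" using * contained_downs by (auto simp: K_def)
      ultimately have "boxes \<kappa> = boxes \<kappa>'" unfolding skew_def contained_def by blast
      then show False using *(3) by (simp add: boxes_inject)
    qed
  qed
  also have "\<dots> = (\<Sum>\<kappa>\<in>K. skew_dim \<kappa> \<mu>)" by (simp add: corner)
  finally show ?thesis by (simp add: skew_dim_def D_def K_def)
qed

text \<open>The normalized dimension \<open>dim(\<nu>/\<mu>) / (|\<nu>| - |\<mu>|)!\<close>. The value is set to 0 unless \<open>\<mu> \<subseteq> \<nu>\<close>,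
  because \<open>skew_dim\<close> counts tableaux on the set difference of the boxes for any pair of diagrams.\<close>

definition ndim :: "young \<Rightarrow> young \<Rightarrow> real" where
  "ndim \<nu> \<mu> = (if contained \<mu> \<nu> then real (skew_dim \<nu> \<mu>) / fact (ysize \<nu> - ysize \<mu>) else 0)"

lemma ndim_refl [simp]: "ndim \<nu> \<nu> = 1"
  by (simp add: ndim_def skew_dim_def skew_def standard_tableaux_empty)

lemma ndim_not_contained: "\<not> contained \<mu> \<nu> \<Longrightarrow> ndim \<nu> \<mu> = 0"
  by (simp add: ndim_def)

lemma ndim_nonneg: "ndim \<nu> \<mu> \<ge> 0"
  by (simp add: ndim_def)

lemma ndim_eq_size: "ysize \<nu> \<le> ysize \<mu> \<Longrightarrow> ndim \<nu> \<mu> = of_bool (\<nu> = \<mu>)"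
  using contained_eqI[of \<mu> \<nu>] ndim_not_contained[of \<mu> \<nu>] by auto

text \<open>The branching rule. It holds without assumptions on \<open>\<mu>\<close> and \<open>\<nu>\<close>: the factor on the left
  makes both sides vanish when \<open>\<mu> = \<nu>\<close>.\<close>

lemma ndim_rec: "(real (ysize \<nu>) - real (ysize \<mu>)) * ndim \<nu> \<mu> = (\<Sum>\<kappa>\<in>downs \<nu>. ndim \<kappa> \<mu>)"
proof (cases "contained \<mu> \<nu> \<and> \<mu> \<noteq> \<nu>")
  case False
  have "ndim \<kappa> \<mu> = 0" if "\<kappa> \<in> downs \<nu>" for \<kappa>
  proof (rule ndim_not_contained)
    show "\<not> contained \<mu> \<kappa>"
      using that False contained_downs[OF that] ysize_downs[OF that] ysize_mono[of \<mu> \<kappa>]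
        contained_trans[of \<mu> \<kappa> \<nu>] by auto
  qed
  then show ?thesis using False by (auto simp: ndim_not_contained)
next
  case True
  then have lt: "ysize \<mu> < ysize \<nu>"
    using contained_eqI[of \<mu> \<nu>] by (meson not_le)
  have "(real (ysize \<nu>) - real (ysize \<mu>)) * ndim \<nu> \<mu>
      = real (ysize \<nu> - ysize \<mu>) * (real (skew_dim \<nu> \<mu>) / fact (ysize \<nu> - ysize \<mu>))"
    using True lt by (simp add: ndim_def of_nat_diff)
  also have "\<dots> = real (skew_dim \<nu> \<mu>) / fact (ysize \<nu> - ysize \<mu> - 1)"
    using lt by (simp add: fact_reduce)
  also have "\<dots> = (\<Sum>\<kappa>\<in>{\<kappa>\<in>downs \<nu>. contained \<mu> \<kappa>}. ndim \<kappa> \<mu>)"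
    using True by (auto simp: skew_dim_rec sum_divide_distrib ndim_def ysize_downs intro!: sum.cong)
  also have "\<dots> = (\<Sum>\<kappa>\<in>downs \<nu>. ndim \<kappa> \<mu>)"
    by (rule sum.mono_neutral_left) (auto simp: ndim_not_contained)
  finally show ?thesis .
qed

lemma ndim_empty_pos: "ndim \<nu> empty_young > 0"
proof (induction \<nu> rule: young_size_induct)
  case (step \<nu>)
  show ?case
  proof (cases "\<nu> = empty_young")
    case False
    have "(\<Sum>\<kappa>\<in>downs \<nu>. ndim \<kappa> empty_young) > 0"
      using downs_nonempty[OF False] step by (intro sum_pos) (auto simp: ysize_downs)
    then have "real (ysize \<nu>) * ndim \<nu> empty_young > 0"
      using ndim_rec[of \<nu> empty_young] by simp
    then show ?thesis by (simp add: zero_less_mult_iff)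
  qed simp
qed

text \<open>The solutions of the branching rule with parameter \<open>k\<close> are exactly the combinations of the
  functions \<open>ndim _ \<mu>\<close> with \<open>|\<mu>| = k\<close>, the coefficients being the values on diagrams of size \<open>k\<close>.
  The predicate \<open>Q\<close> restricts the statement to a set of diagrams closed under removing boxes, such as
  those with at most \<open>N\<close> rows. For negative \<open>k\<close> the sum is empty.\<close>

lemma ndim_expansion:
  fixes g :: "young \<Rightarrow> real" and k :: int
  assumes Q: "\<And>\<nu> \<kappa>. Q \<nu> \<Longrightarrow> \<kappa> \<in> downs \<nu> \<Longrightarrow> Q \<kappa>"
    and g: "\<And>\<nu>. Q \<nu> \<Longrightarrow> (real (ysize \<nu>) - of_int k) * g \<nu> = (\<Sum>\<kappa>\<in>downs \<nu>. g \<kappa>)"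
    and "Q \<nu>"
  shows "g \<nu> = (\<Sum>\<mu>\<in>{\<mu>. int (ysize \<mu>) = k \<and> Q \<mu>}. g \<mu> * ndim \<nu> \<mu>)"
  using \<open>Q \<nu>\<close>
proof (induction \<nu> rule: young_size_induct)
  case (step \<nu>)
  let ?S = "{\<mu>. int (ysize \<mu>) = k \<and> Q \<mu>}"
  have fin: "finite ?S" by (rule finite_subset[OF _ finite_ysize_le[of "nat k"]]) auto
  show ?case
  proof (cases "int (ysize \<nu>) = k")
    case True
    have "(\<Sum>\<mu>\<in>?S. g \<mu> * ndim \<nu> \<mu>) = (\<Sum>\<mu>\<in>?S. if \<mu> = \<nu> then g \<nu> else 0)"
      using True by (intro sum.cong) (auto simp: ndim_eq_size)
    then show ?thesis using fin True step.prems by simp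
  next
    case False
    have "(real (ysize \<nu>) - of_int k) * g \<nu> = (\<Sum>\<kappa>\<in>downs \<nu>. \<Sum>\<mu>\<in>?S. g \<mu> * ndim \<kappa> \<mu>)"
      unfolding g[OF step.prems] using step by (intro sum.cong) (auto simp: ysize_downs Q)
    also have "\<dots> = (\<Sum>\<mu>\<in>?S. g \<mu> * (\<Sum>\<kappa>\<in>downs \<nu>. ndim \<kappa> \<mu>))"
      by (subst sum.swap) (simp add: sum_distrib_left)
    also have "\<dots> = (\<Sum>\<mu>\<in>?S. (real (ysize \<nu>) - of_int k) * (g \<mu> * ndim \<nu> \<mu>))"
      by (intro sum.cong) (auto simp flip: ndim_rec)
    also have "\<dots> = (real (ysize \<nu>) - of_int k) * (\<Sum>\<mu>\<in>?S. g \<mu> * ndim \<nu> \<mu>)"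
      by (simp add: sum_distrib_left)
    finally show ?thesis using False by simp
  qed
qed

text \<open>Tableaux of shape \<open>\<nu>/\<mu>\<close> are cut into two at the diagram of size \<open>k\<close>; the binomial coefficient
  accounts for the normalization.\<close>

lemma ndim_composition:
  assumes "ysize \<mu> \<le> k"
  shows "(\<Sum>\<kappa>\<in>{\<kappa>. ysize \<kappa> = k}. ndim \<nu> \<kappa> * ndim \<kappa> \<mu>)
    = real ((ysize \<nu> - ysize \<mu>) choose (k - ysize \<mu>)) * ndim \<nu> \<mu>"
proof -
  define g where "g \<nu> = real ((ysize \<nu> - ysize \<mu>) choose (k - ysize \<mu>)) * ndim \<nu> \<mu>" for \<nu>
  have "(real (ysize \<nu>) - of_int (int k)) * g \<nu> = (\<Sum>\<kappa>\<in>downs \<nu>. g \<kappa>)" for \<nu>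
  proof (cases "ysize \<mu> < ysize \<nu>")
    case True
    define a where "a = ysize \<nu> - ysize \<mu>"
    define b where "b = k - ysize \<mu>"
    have a: "a > 0" using True by (simp add: a_def)
    have "(\<Sum>\<kappa>\<in>downs \<nu>. g \<kappa>) = real ((a - 1) choose b) * (\<Sum>\<kappa>\<in>downs \<nu>. ndim \<kappa> \<mu>)"
      unfolding sum_distrib_left by (intro sum.cong) (auto simp: g_def ysize_downs a_def b_def)
    also have "\<dots> = (real a * real ((a - 1) choose b)) * ndim \<nu> \<mu>"
      using True by (simp add: a_def of_nat_diff flip: ndim_rec)
    also have "real a * real ((a - 1) choose b) = (real a - real b) * real (a choose b)"
    proof (cases "b \<le> a")
      case True
      have "real ((a - b) * (a choose b)) = real (a * ((a - 1) choose b))"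
        by (simp only: binomial_absorb_comp)
      then show ?thesis using True by (simp add: of_nat_diff)
    next
      case False
      then show ?thesis by (simp add: binomial_eq_0)
    qed
    also have "real a - real b = real (ysize \<nu>) - of_int (int k)"
      using True assms by (simp add: a_def b_def of_nat_diff)
    finally show ?thesis by (simp add: g_def a_def b_def)
  next
    case False
    then have "g \<kappa> = 0" if "\<kappa> \<in> downs \<nu>" for \<kappa>
      using ysize_downs[OF that] by (auto simp: g_def ndim_eq_size)
    then show ?thesis
      using False assms by (cases "k = ysize \<mu>") (auto simp: g_def[of \<nu>] ndim_eq_size)
  qed
  then have "g \<nu> = (\<Sum>\<kappa>\<in>{\<kappa>. int (ysize \<kappa>) = int k \<and> True}. g \<kappa> * ndim \<nu> \<kappa>)"
    by (intro ndim_expansion[where Q = "\<lambda>_. True"]) auto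
  also have "\<dots> = (\<Sum>\<kappa>\<in>{\<kappa>. ysize \<kappa> = k}. ndim \<nu> \<kappa> * ndim \<kappa> \<mu>)"
    by (intro sum.cong) (auto simp: g_def)
  finally show ?thesis by (simp add: g_def)
qed

lemma sum_young_levels:
  assumes "finite S" "\<And>\<kappa>. \<kappa> \<in> S \<Longrightarrow> ysize \<kappa> \<le> n"
  shows "(\<Sum>\<kappa>\<in>S. f \<kappa>) = (\<Sum>k\<le>n. \<Sum>\<kappa>\<in>{\<kappa>\<in>S. ysize \<kappa> = k}. f \<kappa>)"
  using assms by (intro sum.group[symmetric]) auto

text \<open>In terms of the operator \<open>D\<close> that removes a box: \<open>exp(D)\<close> and \<open>exp(- D)\<close> are inverse to each other.\<close>

lemma ndim_inversion:
  assumes S: "finite S" "{\<kappa>. contained \<kappa> \<nu>} \<subseteq> S"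
  shows "(\<Sum>\<kappa>\<in>S. (-1) ^ ysize \<kappa> * (ndim \<nu> \<kappa> * ndim \<kappa> \<mu>)) = (-1) ^ ysize \<nu> * of_bool (\<nu> = \<mu>)"
proof (cases "contained \<mu> \<nu>")
  case False
  have "ndim \<nu> \<kappa> * ndim \<kappa> \<mu> = 0" for \<kappa>
    using False contained_trans[of \<mu> \<kappa> \<nu>] by (auto simp: ndim_def)
  then have "(\<Sum>\<kappa>\<in>S. (-1) ^ ysize \<kappa> * (ndim \<nu> \<kappa> * ndim \<kappa> \<mu>)) = 0"
    by (intro sum.neutral) auto
  then show ?thesis using False by auto
next
  case True
  define n m where "n = ysize \<nu>" and "m = ysize \<mu>"
  have mn: "m \<le> n" using True ysize_mono by (simp add: n_def m_def)
  have "(\<Sum>\<kappa>\<in>S. (-1) ^ ysize \<kappa> * (ndim \<nu> \<kappa> * ndim \<kappa> \<mu>))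
      = (\<Sum>\<kappa>\<in>{\<kappa>. ysize \<kappa> \<le> n}. (-1) ^ ysize \<kappa> * (ndim \<nu> \<kappa> * ndim \<kappa> \<mu>))"
    by (rule sum.mono_neutral_cong[OF finite_ysize_le S(1)])
       (use S(2) ysize_mono in \<open>auto simp: n_def intro!: ndim_not_contained\<close>)
  also have "\<dots> = (\<Sum>k\<le>n. \<Sum>\<kappa>\<in>{\<kappa>\<in>{\<kappa>. ysize \<kappa> \<le> n}. ysize \<kappa> = k}. (-1) ^ ysize \<kappa> * (ndim \<nu> \<kappa> * ndim \<kappa> \<mu>))"
    by (rule sum_young_levels) auto
  also have "\<dots> = (\<Sum>k\<le>n. (-1) ^ k * (\<Sum>\<kappa>\<in>{\<kappa>. ysize \<kappa> = k}. ndim \<nu> \<kappa> * ndim \<kappa> \<mu>))"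
    unfolding sum_distrib_left by (intro sum.cong) auto
  also have "\<dots> = (\<Sum>k\<in>{m..n}. (-1) ^ k * (\<Sum>\<kappa>\<in>{\<kappa>. ysize \<kappa> = k}. ndim \<nu> \<kappa> * ndim \<kappa> \<mu>))"
    by (intro sum.mono_neutral_right) (auto simp: m_def ndim_eq_size intro!: sum.neutral)
  also have "\<dots> = (\<Sum>k\<in>{m..n}. (-1) ^ k * (real ((n - m) choose (k - m)) * ndim \<nu> \<mu>))"
    by (intro sum.cong) (auto simp: ndim_composition n_def m_def)
  also have "\<dots> = (\<Sum>j\<in>{0..n-m}. (-1) ^ (j + m) * (real ((n - m) choose j) * ndim \<nu> \<mu>))"
    using mn by (intro sum.reindex_bij_witness[of _ "\<lambda>j. j + m" "\<lambda>k. k - m"]) auto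
  also have "\<dots> = (-1) ^ m * ndim \<nu> \<mu> * (\<Sum>j\<le>n-m. (-1) ^ j * real ((n - m) choose j))"
    by (simp add: sum_distrib_left power_add mult_ac atMost_atLeast0)
  also have "\<dots> = (-1) ^ n * of_bool (\<nu> = \<mu>)"
  proof (cases "n = m")
    case True
    then show ?thesis using \<open>contained \<mu> \<nu>\<close> contained_eqI[of \<mu> \<nu>] by (auto simp: n_def m_def)
  next
    case False
    then show ?thesis using mn choose_alternating_sum[of "n - m", where 'a = real]
      by (auto simp: n_def m_def)
  qed
  finally show ?thesis by (simp add: n_def)
qed


section \<open>Adding and removing boxes\<close>

text \<open>Two different diagrams below a common cover have that cover as their union, and their intersection
  is covered by both; dually in the next lemma. So pairs (add a box, then remove another one)
  correspond to pairs (remove first, then add).\<close>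

lemma covers_sup_inf:
  assumes "covers \<kappa> \<nu>" "covers \<kappa>' \<nu>" "\<kappa> \<noteq> \<kappa>'"
  shows "ysup \<kappa> \<kappa>' = \<nu>" "covers (yinf \<kappa> \<kappa>') \<kappa>" "covers (yinf \<kappa> \<kappa>') \<kappa>'"
proof -
  have c: "contained \<kappa> \<nu>" "contained \<kappa>' \<nu>" "ysize \<nu> = Suc (ysize \<kappa>)" "ysize \<nu> = Suc (ysize \<kappa>')"
    using assms by (auto simp: covers_def)
  have le: "contained (ysup \<kappa> \<kappa>') \<nu>" "contained \<kappa> (ysup \<kappa> \<kappa>')" "contained \<kappa>' (ysup \<kappa> \<kappa>')"
    "contained (yinf \<kappa> \<kappa>') \<kappa>" "contained (yinf \<kappa> \<kappa>') \<kappa>'"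
    using c by (auto simp: contained_def boxes_ysup boxes_yinf)
  have "\<not> ysize (ysup \<kappa> \<kappa>') \<le> ysize \<kappa>"
    using contained_eqI[OF le(2)] contained_eqI[OF le(3)] c assms(3) by auto
  then show eq: "ysup \<kappa> \<kappa>' = \<nu>" using contained_eqI[OF le(1)] c(3) by simp
  show "covers (yinf \<kappa> \<kappa>') \<kappa>" "covers (yinf \<kappa> \<kappa>') \<kappa>'"
    using ysize_sup_inf[of \<kappa> \<kappa>'] c le by (auto simp: covers_def eq)
qed

lemma covers_inf_sup:
  assumes "covers \<rho> \<kappa>" "covers \<rho> \<kappa>'" "\<kappa> \<noteq> \<kappa>'"
  shows "yinf \<kappa> \<kappa>' = \<rho>" "covers \<kappa> (ysup \<kappa> \<kappa>')" "covers \<kappa>' (ysup \<kappa> \<kappa>')"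
proof -
  have c: "contained \<rho> \<kappa>" "contained \<rho> \<kappa>'" "ysize \<kappa> = Suc (ysize \<rho>)" "ysize \<kappa>' = Suc (ysize \<rho>)"
    using assms by (auto simp: covers_def)
  have le: "contained \<rho> (yinf \<kappa> \<kappa>')" "contained \<kappa> (ysup \<kappa> \<kappa>')" "contained \<kappa>' (ysup \<kappa> \<kappa>')"
    "contained (yinf \<kappa> \<kappa>') \<kappa>" "contained (yinf \<kappa> \<kappa>') \<kappa>'"
    using c by (auto simp: contained_def boxes_ysup boxes_yinf)
  have "\<not> ysize \<kappa> \<le> ysize (yinf \<kappa> \<kappa>')"
    using contained_eqI[OF le(4)] contained_eqI[OF le(5)] c assms(3) by auto
  then show eq: "yinf \<kappa> \<kappa>' = \<rho>" using contained_eqI[OF le(1)] c(3) by simp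
  show "covers \<kappa> (ysup \<kappa> \<kappa>')" "covers \<kappa>' (ysup \<kappa> \<kappa>')"
    using ysize_sup_inf[of \<kappa> \<kappa>'] c le by (auto simp: covers_def eq)
qed

text \<open>The weight \<open>(z + c)(z' + c)\<close> of a box of content \<open>c\<close> enters only through the real numbers
  \<open>s = z + z'\<close> and \<open>t = zz'\<close>, which are the parameters here.\<close>

locale content_weight =
  fixes s t :: real
begin

definition box_weight :: "real \<Rightarrow> real" where
  "box_weight c = c\<^sup>2 + s * c + t"

text \<open>The product \<open>(z)\<^bsub>\<nu>/\<mu>\<^esub> (z')\<^bsub>\<nu>/\<mu>\<^esub>\<close>.\<close>

definition skew_weight :: "young \<Rightarrow> young \<Rightarrow> real" where
  "skew_weight \<nu> \<mu> = (\<Prod>(i, j)\<in>skew \<nu> \<mu>. box_weight (real j - real i))"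

lemma skew_weight_refl [simp]: "skew_weight \<nu> \<nu> = 1"
  by (simp add: skew_weight_def skew_def)

lemma skew_weight_trans:
  assumes "contained \<mu> \<kappa>" "contained \<kappa> \<nu>"
  shows "skew_weight \<nu> \<kappa> * skew_weight \<kappa> \<mu> = skew_weight \<nu> \<mu>"
proof -
  have "skew \<nu> \<mu> = skew \<nu> \<kappa> \<union> skew \<kappa> \<mu>" "skew \<nu> \<kappa> \<inter> skew \<kappa> \<mu> = {}"
    using assms by (auto simp: skew_def contained_def)
  then show ?thesis by (simp add: skew_weight_def prod.union_disjoint)
qed

lemma skew_weight_ysup: "skew_weight (ysup \<kappa> \<kappa>') \<kappa> = skew_weight \<kappa>' (yinf \<kappa> \<kappa>')"
proof -
  have "skew (ysup \<kappa> \<kappa>') \<kappa> = skew \<kappa>' (yinf \<kappa> \<kappa>')"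
    by (auto simp: skew_def boxes_ysup boxes_yinf)
  then show ?thesis by (simp add: skew_weight_def)
qed

text \<open>The diagonal part of the commutator of adding and removing a box.\<close>

lemma sum_ups_downs: "(\<Sum>\<nu>\<in>ups \<kappa>. skew_weight \<nu> \<kappa>) = (\<Sum>\<rho>\<in>downs \<kappa>. skew_weight \<kappa> \<rho>) + (t + 2 * real (ysize \<kappa>))"
proof -
  define N where "N = ylength \<kappa>"
  define f where "f i = box_weight (real (yrow \<kappa> i) - real i)" for i
  define h where "h i = box_weight (real (yrow \<kappa> i) - 1 - real i)" for i
  define rem where "rem = {i. removable \<kappa> i}"
  have rem: "rem \<subseteq> {..<N}" using removable_less by (auto simp: N_def rem_def)
  \<comment> \<open>Row \<open>i + 1\<close> can be lengthened if and only if row \<open>i\<close> can be shortened.\<close>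
  have add: "{i. addable \<kappa> i} = insert 0 (Suc ` rem)"
  proof (rule Set.set_eqI)
    fix i show "i \<in> {i. addable \<kappa> i} \<longleftrightarrow> i \<in> insert 0 (Suc ` rem)"
      by (cases i) (auto simp: addable_def removable_def rem_def)
  qed
  have fin: "finite rem" using rem finite_subset by blast
  have "(\<Sum>\<nu>\<in>ups \<kappa>. skew_weight \<nu> \<kappa>) = (\<Sum>i\<in>{i. addable \<kappa> i}. f i)"
    unfolding ups_eq by (subst sum.reindex[OF inj_on_yinc]) (auto simp: skew_weight_def skew_yinc f_def intro!: sum.cong)
  also have "\<dots> = f 0 + (\<Sum>i\<in>rem. f (Suc i))"
    using fin by (simp add: add sum.reindex)
  finally have up: "(\<Sum>\<nu>\<in>ups \<kappa>. skew_weight \<nu> \<kappa>) = f 0 + (\<Sum>i\<in>rem. f (Suc i))" .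
  have down: "(\<Sum>\<rho>\<in>downs \<kappa>. skew_weight \<kappa> \<rho>) = (\<Sum>i\<in>rem. h i)"
    unfolding downs_eq rem_def
    by (subst sum.reindex[OF inj_on_ydec])
       (auto simp: skew_weight_def skew_ydec h_def removable_def of_nat_diff intro!: sum.cong)
  have "(\<Sum>i\<in>rem. f (Suc i)) - (\<Sum>i\<in>rem. h i) = (\<Sum>i\<in>rem. f (Suc i) - h i)"
    by (simp add: sum_subtractf)
  also have "\<dots> = (\<Sum>i<N. f (Suc i) - h i)"
  \<comment> \<open>The rows added here contribute 0, and the sum over all rows telescopes.\<close>
  proof (rule sum.mono_neutral_left)
    show "\<forall>i\<in>{..<N} - rem. f (Suc i) - h i = 0"
    proof
      fix i assume "i \<in> {..<N} - rem"
      then have "yrow \<kappa> (Suc i) = yrow \<kappa> i"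
        using yrow_antimono[of i "Suc i" \<kappa>] by (auto simp: rem_def removable_def)
      then show "f (Suc i) - h i = 0" by (simp add: f_def h_def algebra_simps)
    qed
  qed (use rem in auto)
  also have "\<dots> = f N - f 0 + (\<Sum>i<N. f i - h i)"
    by (induction N) (auto simp: algebra_simps)
  also have "(\<Sum>i<N. f i - h i) = (\<Sum>i<N. 2 * real (yrow \<kappa> i) + (s - 1 - 2 * real i))"
    by (intro sum.cong) (auto simp: f_def h_def box_weight_def power2_eq_square algebra_simps)
  also have "\<dots> = 2 * real (ysize \<kappa>) + (\<Sum>i<N. s - 1 - 2 * real i)"
    by (simp add: sum.distrib sum_distrib_left ysize_eq_sum[of \<kappa> N] N_def)
  also have "(\<Sum>i<N. s - 1 - 2 * real i) = s * N - (real N)\<^sup>2"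
    by (induction N) (auto simp: algebra_simps power2_eq_square)
  also have "f N = (real N)\<^sup>2 - s * N + t"
    using yrow_eq_0_iff[of \<kappa> N] by (simp add: f_def box_weight_def N_def)
  finally show ?thesis using up down by simp
qed

text \<open>The full commutation relation: the off-diagonal terms agree because union and intersection are
  exchanged and \<open>\<nu>/\<kappa>\<close> and \<open>\<kappa>'/\<rho>\<close> are the same set of boxes.\<close>

lemma up_down_exchange:
  "(\<Sum>\<nu>\<in>ups \<kappa>. skew_weight \<nu> \<kappa> * (\<Sum>\<kappa>'\<in>downs \<nu>. F \<kappa>'))
    = (\<Sum>\<rho>\<in>downs \<kappa>. \<Sum>\<kappa>'\<in>ups \<rho>. skew_weight \<kappa>' \<rho> * F \<kappa>') + (t + 2 * real (ysize \<kappa>)) * F \<kappa>"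
proof -
  have off: "(\<Sum>\<nu>\<in>ups \<kappa>. \<Sum>\<kappa>'\<in>downs \<nu> - {\<kappa>}. skew_weight \<nu> \<kappa> * F \<kappa>')
      = (\<Sum>\<rho>\<in>downs \<kappa>. \<Sum>\<kappa>'\<in>ups \<rho> - {\<kappa>}. skew_weight \<kappa>' \<rho> * F \<kappa>')"
    unfolding sum.Sigma[OF finite_ups ballI[OF finite_Diff[OF finite_downs]]]
      sum.Sigma[OF finite_downs ballI[OF finite_Diff[OF finite_ups]]]
  proof (rule sum.reindex_bij_witness[where j = "\<lambda>(\<nu>, \<kappa>'). (yinf \<kappa> \<kappa>', \<kappa>')"
        and i = "\<lambda>(\<rho>, \<kappa>'). (ysup \<kappa> \<kappa>', \<kappa>')"])
    fix x assume "x \<in> (SIGMA \<nu>:ups \<kappa>. downs \<nu> - {\<kappa>})"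
    then obtain \<nu> \<kappa>' where x: "x = (\<nu>, \<kappa>')" "covers \<kappa> \<nu>" "covers \<kappa>' \<nu>" "\<kappa> \<noteq> \<kappa>'"
      by (auto simp: ups_def downs_def)
    note * = covers_sup_inf[OF x(2-4)]
    show "(case case x of (\<nu>, \<kappa>') \<Rightarrow> (yinf \<kappa> \<kappa>', \<kappa>') of (\<rho>, \<kappa>') \<Rightarrow> (ysup \<kappa> \<kappa>', \<kappa>')) = x"
      using * by (simp add: x)
    show "(case x of (\<nu>, \<kappa>') \<Rightarrow> (yinf \<kappa> \<kappa>', \<kappa>')) \<in> (SIGMA \<rho>:downs \<kappa>. ups \<rho> - {\<kappa>})"
      using * x by (simp add: ups_def downs_def)
    show "(case case x of (\<nu>, \<kappa>') \<Rightarrow> (yinf \<kappa> \<kappa>', \<kappa>') of (\<rho>, \<kappa>') \<Rightarrow> skew_weight \<kappa>' \<rho> * F \<kappa>') = (case x of (\<nu>, \<kappa>') \<Rightarrow> skew_weight \<nu> \<kappa> * F \<kappa>')"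
      using *(1) skew_weight_ysup[of \<kappa> \<kappa>'] by (simp add: x)
  next
    fix x assume "x \<in> (SIGMA \<rho>:downs \<kappa>. ups \<rho> - {\<kappa>})"
    then obtain \<rho> \<kappa>' where x: "x = (\<rho>, \<kappa>')" "covers \<rho> \<kappa>" "covers \<rho> \<kappa>'" "\<kappa> \<noteq> \<kappa>'"
      by (auto simp: ups_def downs_def)
    note * = covers_inf_sup[OF x(2-4)]
    show "(case case x of (\<rho>, \<kappa>') \<Rightarrow> (ysup \<kappa> \<kappa>', \<kappa>') of (\<nu>, \<kappa>') \<Rightarrow> (yinf \<kappa> \<kappa>', \<kappa>')) = x"
      using * by (simp add: x)
    show "(case x of (\<rho>, \<kappa>') \<Rightarrow> (ysup \<kappa> \<kappa>', \<kappa>')) \<in> (SIGMA \<nu>:ups \<kappa>. downs \<nu> - {\<kappa>})"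
      using * x by (simp add: ups_def downs_def)
  qed
  have "(\<Sum>\<nu>\<in>ups \<kappa>. skew_weight \<nu> \<kappa> * (\<Sum>\<kappa>'\<in>downs \<nu>. F \<kappa>'))
      = (\<Sum>\<nu>\<in>ups \<kappa>. skew_weight \<nu> \<kappa> * F \<kappa> + (\<Sum>\<kappa>'\<in>downs \<nu> - {\<kappa>}. skew_weight \<nu> \<kappa> * F \<kappa>'))"
  proof (intro sum.cong refl)
    fix \<nu> assume "\<nu> \<in> ups \<kappa>"
    then have "\<kappa> \<in> downs \<nu>" by (simp add: ups_def downs_def)
    then show "skew_weight \<nu> \<kappa> * (\<Sum>\<kappa>'\<in>downs \<nu>. F \<kappa>') = skew_weight \<nu> \<kappa> * F \<kappa> + (\<Sum>\<kappa>'\<in>downs \<nu> - {\<kappa>}. skew_weight \<nu> \<kappa> * F \<kappa>')"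
      by (simp add: sum.remove[of _ \<kappa>] sum_distrib_left distrib_left)
  qed
  also have "\<dots> = (\<Sum>\<nu>\<in>ups \<kappa>. skew_weight \<nu> \<kappa>) * F \<kappa>
      + (\<Sum>\<rho>\<in>downs \<kappa>. \<Sum>\<kappa>'\<in>ups \<rho> - {\<kappa>}. skew_weight \<kappa>' \<rho> * F \<kappa>')"
    by (simp add: sum.distrib sum_distrib_right off)
  also have "\<dots> = (\<Sum>\<rho>\<in>downs \<kappa>. skew_weight \<kappa> \<rho> * F \<kappa> + (\<Sum>\<kappa>'\<in>ups \<rho> - {\<kappa>}. skew_weight \<kappa>' \<rho> * F \<kappa>'))
      + (t + 2 * real (ysize \<kappa>)) * F \<kappa>"
    by (simp add: sum_ups_downs sum.distrib sum_distrib_right distrib_right)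
  also have "(\<Sum>\<rho>\<in>downs \<kappa>. skew_weight \<kappa> \<rho> * F \<kappa> + (\<Sum>\<kappa>'\<in>ups \<rho> - {\<kappa>}. skew_weight \<kappa>' \<rho> * F \<kappa>'))
      = (\<Sum>\<rho>\<in>downs \<kappa>. \<Sum>\<kappa>'\<in>ups \<rho>. skew_weight \<kappa>' \<rho> * F \<kappa>')"
  proof (intro sum.cong refl)
    fix \<rho> assume "\<rho> \<in> downs \<kappa>"
    then have "\<kappa> \<in> ups \<rho>" by (simp add: ups_def downs_def)
    then show "skew_weight \<kappa> \<rho> * F \<kappa> + (\<Sum>\<kappa>'\<in>ups \<rho> - {\<kappa>}. skew_weight \<kappa>' \<rho> * F \<kappa>') = (\<Sum>\<kappa>'\<in>ups \<rho>. skew_weight \<kappa>' \<rho> * F \<kappa>')"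
      by (simp add: sum.remove[of _ \<kappa>])
  qed
  finally show ?thesis .
qed

text \<open>The operator \<open>U\<close> that adds a weighted box is moved through \<open>exp(D)\<close>, whose entries are the
  normalized dimensions.\<close>

lemma ndim_commutator:
  "(\<Sum>\<kappa>'\<in>ups \<kappa>. skew_weight \<kappa>' \<kappa> * ndim \<kappa>' \<nu>)
    = (\<Sum>\<nu>'\<in>downs \<nu>. skew_weight \<nu> \<nu>' * ndim \<kappa> \<nu>') + (t + real (ysize \<kappa>) + real (ysize \<nu>)) * ndim \<kappa> \<nu>"
proof (induction \<kappa> rule: young_size_induct)
  case (step \<kappa>)
  define L where "L \<kappa> = (\<Sum>\<kappa>'\<in>ups \<kappa>. skew_weight \<kappa>' \<kappa> * ndim \<kappa>' \<nu>)" for \<kappa>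
  define X where "X \<kappa> = (\<Sum>\<nu>'\<in>downs \<nu>. skew_weight \<nu> \<nu>' * ndim \<kappa> \<nu>')" for \<kappa>
  define x y where "x = real (ysize \<kappa>)" and "y = real (ysize \<nu>)"
  show ?case
  proof (cases "Suc (ysize \<kappa>) = ysize \<nu>")
    case True
    have "L \<kappa> = (\<Sum>\<kappa>'\<in>ups \<kappa>. if \<kappa>' = \<nu> then skew_weight \<nu> \<kappa> else 0)"
      unfolding L_def using True by (intro sum.cong) (auto simp: ysize_ups ndim_eq_size)
    moreover have "X \<kappa> = (\<Sum>\<nu>'\<in>downs \<nu>. if \<nu>' = \<kappa> then skew_weight \<nu> \<kappa> else 0)"
      unfolding X_def using True
      by (intro sum.cong) (auto simp: ndim_eq_size dest!: ysize_downs)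
    moreover have "\<nu> \<in> ups \<kappa> \<longleftrightarrow> \<kappa> \<in> downs \<nu>" by (simp add: ups_def downs_def)
    ultimately have "L \<kappa> = X \<kappa>" by simp
    moreover have "ndim \<kappa> \<nu> = 0" using True by (auto simp: ndim_eq_size)
    ultimately show ?thesis by (simp add: L_def X_def)
  next
    case False
    have "(x + 1 - y) * L \<kappa> = (\<Sum>\<kappa>'\<in>ups \<kappa>. skew_weight \<kappa>' \<kappa> * ((real (ysize \<kappa>') - real (ysize \<nu>)) * ndim \<kappa>' \<nu>))"
      unfolding L_def sum_distrib_left by (intro sum.cong) (auto simp: ysize_ups x_def y_def)
    also have "\<dots> = (\<Sum>\<rho>\<in>downs \<kappa>. L \<rho>) + (t + 2 * x) * ndim \<kappa> \<nu>"
      by (simp only: ndim_rec up_down_exchange L_def x_def)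
    also have "(\<Sum>\<rho>\<in>downs \<kappa>. L \<rho>) = (\<Sum>\<rho>\<in>downs \<kappa>. X \<rho> + (t + (x - 1) + y) * ndim \<rho> \<nu>)"
      unfolding L_def X_def using step by (intro sum.cong) (auto simp: ysize_downs x_def y_def)
    also have "\<dots> = (\<Sum>\<rho>\<in>downs \<kappa>. X \<rho>) + (t + (x - 1) + y) * ((x - y) * ndim \<kappa> \<nu>)"
      by (simp add: sum.distrib sum_distrib_left ndim_rec x_def y_def)
    also have "(\<Sum>\<rho>\<in>downs \<kappa>. X \<rho>) = (\<Sum>\<nu>'\<in>downs \<nu>. skew_weight \<nu> \<nu>' * (\<Sum>\<rho>\<in>downs \<kappa>. ndim \<rho> \<nu>'))"
      unfolding X_def by (subst sum.swap) (simp add: sum_distrib_left)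
    also have "\<dots> = (\<Sum>\<nu>'\<in>downs \<nu>. (x - y + 1) * (skew_weight \<nu> \<nu>' * ndim \<kappa> \<nu>'))"
      by (intro sum.cong) (auto simp: x_def y_def ysize_downs simp flip: ndim_rec)
    also have "\<dots> = (x - y + 1) * X \<kappa>"
      by (simp add: X_def sum_distrib_left)
    finally have "(x + 1 - y) * L \<kappa> = (x + 1 - y) * (X \<kappa> + (t + x + y) * ndim \<kappa> \<nu>)"
      by (simp add: algebra_simps)
    moreover have "x + 1 - y \<noteq> 0" using False by (simp add: x_def y_def)
    ultimately show ?thesis by (simp add: L_def X_def x_def y_def)
  qed
qed

end


section \<open>Sums over diagrams of a given size\<close>

text \<open>The coefficient of \<open>x\<^bsup>p - q\<^esup>\<close> in \<open>(1 - x)\<^bsup>- A\<^esup>\<close>, which is 0 for \<open>p < q\<close>.\<close>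

definition rising_coef :: "real \<Rightarrow> nat \<Rightarrow> nat \<Rightarrow> real" where
  "rising_coef A p q = (if q \<le> p then pochhammer A (p - q) / fact (p - q) else 0)"

lemma rising_coef_Suc_Suc: "rising_coef A (Suc p) (Suc q) = rising_coef A p q"
  by (simp add: rising_coef_def)

text \<open>The identity that makes the closed form in \<open>level_sum_eq\<close> satisfy the recursion
  \<open>level_sum_rec\<close>.\<close>

lemma rising_coef_rec:
  "(real (Suc p) - real q + d) * rising_coef A (Suc p) q
    = d * rising_coef (A - 1) (Suc p) q + (A + real p - real q + d) * rising_coef A p q"
proof -
  consider "q \<le> p" | "q = Suc p" | "q > Suc p" by linarith
  then show ?thesis
  proof cases
    case 1
    then obtain s where s: "p = q + s" using le_Suc_ex by blast
    define c where "c = pochhammer A s / fact s"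
    have c': "(real s + 1) * (x * y / fact (Suc s)) = x * (y / fact s)" for x y :: real
    proof -
      have "fact (Suc s) = (real s + 1) * (fact s :: real)" by simp
      moreover have "real s + 1 \<noteq> 0" by linarith
      ultimately show ?thesis by (simp del: fact_Suc)
    qed
    have diff: "Suc p - q = Suc s" "q \<le> Suc p" "p - q = s" "q \<le> p" using s by auto
    have 1: "(real s + 1) * rising_coef A (Suc p) q = (A + real s) * c"
      using c'[of "A + real s" "pochhammer A s"]
      by (simp only: rising_coef_def diff if_True pochhammer_Suc c_def mult.commute[of "pochhammer A s"])
    have 2: "(real s + 1) * rising_coef (A - 1) (Suc p) q = (A - 1) * c"
      using c'[of "A - 1" "pochhammer A s"] pochhammer_rec[of "A - 1" s]
      by (simp only: rising_coef_def diff if_True c_def diff_add_cancel)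
    have 3: "rising_coef A p q = c" by (simp add: diff rising_coef_def c_def)
    have "(real s + 1) * ((real s + 1 + d) * rising_coef A (Suc p) q)
        = (real s + 1) * (d * rising_coef (A - 1) (Suc p) q + (A + real s + d) * rising_coef A p q)"
    proof -
      have "(real s + 1) * ((real s + 1 + d) * rising_coef A (Suc p) q)
         = (real s + 1 + d) * ((A + real s) * c)"
        by (simp flip: 1)
      also have "\<dots> = d * ((A - 1) * c) + (real s + 1) * ((A + real s + d) * c)"
        by (simp add: algebra_simps)
      also have "\<dots> = (real s + 1) * (d * rising_coef (A - 1) (Suc p) q + (A + real s + d) * rising_coef A p q)"
        by (simp add: 3 distrib_left flip: 2)
      finally show ?thesis .
    qed
    moreover have "real s + 1 \<noteq> 0" by linarith
    ultimately have "(real s + 1 + d) * rising_coef A (Suc p) q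
        = d * rising_coef (A - 1) (Suc p) q + (A + real s + d) * rising_coef A p q"
      by (simp only: mult_cancel_left simp_thms)
    moreover have "real (Suc p) - real q = real s + 1" "A + real p - real q = A + real s" using s by auto
    ultimately show ?thesis by (simp only:)
  qed (auto simp: rising_coef_def)
qed

lemma rising_coef_sums:
  assumes "k \<le> q" "0 < \<xi>" "\<xi> < 1"
  shows "(\<lambda>n. \<xi> ^ n * rising_coef A (n + k) q) sums (\<xi> ^ (q - k) * (1 - \<xi>) powr (- A))"
proof -
  have "(\<lambda>n. (- A gchoose n) * (- \<xi>) ^ n) sums (1 + (- \<xi>)) powr (- A)"
    using assms by (intro gen_binomial_real) auto
  moreover have "(- A gchoose n) * (- \<xi>) ^ n = \<xi> ^ n * (pochhammer A n / fact n)" for n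
    by (simp add: gbinomial_pochhammer power_minus[of \<xi> n])
  ultimately have "(\<lambda>n. \<xi> ^ n * (pochhammer A n / fact n)) sums (1 - \<xi>) powr (- A)"
    by simp
  then have "(\<lambda>n. \<xi> ^ (q - k) * (\<xi> ^ n * (pochhammer A n / fact n))) sums (\<xi> ^ (q - k) * (1 - \<xi>) powr (- A))"
    by (rule sums_mult)
  also have "(\<lambda>n. \<xi> ^ (q - k) * (\<xi> ^ n * (pochhammer A n / fact n)))
      = (\<lambda>n. \<xi> ^ (n + (q - k)) * rising_coef A (n + (q - k) + k) q)"
  proof
    fix n
    have "n + (q - k) + k - q = n" "q \<le> n + (q - k) + k" using assms(1) by auto
    then show "\<xi> ^ (q - k) * (\<xi> ^ n * (pochhammer A n / fact n))
        = \<xi> ^ (n + (q - k)) * rising_coef A (n + (q - k) + k) q"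
      by (simp only: rising_coef_def if_True power_add) simp
  qed
  finally show ?thesis
    using assms(1) by (subst (asm) sums_zero_iff_shift) (auto simp: rising_coef_def)
qed

context content_weight
begin

text \<open>The part of \<open>\<Sum>\<^sub>\<kappa> d(\<kappa>,\<mu>) d(\<kappa>,\<nu>) (z)\<^sub>\<kappa>(z')\<^sub>\<kappa>\<close> that comes from diagrams of size \<open>n\<close>.\<close>

definition level_sum :: "young \<Rightarrow> young \<Rightarrow> nat \<Rightarrow> real" where
  "level_sum \<mu> \<nu> n = (\<Sum>\<kappa>\<in>{\<kappa>. ysize \<kappa> = n}. ndim \<kappa> \<mu> * ndim \<kappa> \<nu> * skew_weight \<kappa> empty_young)"

text \<open>The weight of \<open>\<kappa>\<close> in the closed form of \<open>level_sum\<close>. The three factors \<open>skew_weight\<close> replace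
  the quotient \<open>(z)\<^sub>\<mu>(z')\<^sub>\<mu>(z)\<^sub>\<nu>(z')\<^sub>\<nu> / ((z)\<^sub>\<kappa>(z')\<^sub>\<kappa>)\<close>, whose denominator may vanish.\<close>

definition level_coef :: "young \<Rightarrow> young \<Rightarrow> young \<Rightarrow> real" where
  "level_coef \<mu> \<nu> \<kappa> = ndim \<mu> \<kappa> * skew_weight \<mu> \<kappa> * (ndim \<nu> \<kappa> * skew_weight \<nu> \<kappa>) * skew_weight \<kappa> empty_young"

text \<open>A diagram of size \<open>n + 1\<close> is reached from one of size \<open>n\<close> by the branching rule for \<open>\<mu>\<close>; the sum
  over the added box is then removed by \<open>ndim_commutator\<close>.\<close>

lemma level_sum_rec:
  "(real (Suc n) - real (ysize \<mu>)) * level_sum \<mu> \<nu> (Suc n)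
    = (\<Sum>\<nu>'\<in>downs \<nu>. skew_weight \<nu> \<nu>' * level_sum \<mu> \<nu>' n) + (t + real n + real (ysize \<nu>)) * level_sum \<mu> \<nu> n"
proof -
  define K where "K = t + real n + real (ysize \<nu>)"
  have "(real (Suc n) - real (ysize \<mu>)) * level_sum \<mu> \<nu> (Suc n)
      = (\<Sum>\<rho>\<in>{\<rho>. ysize \<rho> = Suc n}. ((real (ysize \<rho>) - real (ysize \<mu>)) * ndim \<rho> \<mu>) * (ndim \<rho> \<nu> * skew_weight \<rho> empty_young))"
    unfolding level_sum_def sum_distrib_left by (intro sum.cong) auto
  also have "\<dots> = (\<Sum>\<rho>\<in>{\<rho>. ysize \<rho> = Suc n}. \<Sum>\<kappa>\<in>downs \<rho>. ndim \<kappa> \<mu> * skew_weight \<kappa> empty_young * (skew_weight \<rho> \<kappa> * ndim \<rho> \<nu>))"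
    unfolding ndim_rec sum_distrib_right
  proof (intro sum.cong refl)
    fix \<rho> \<kappa> assume "\<kappa> \<in> downs \<rho>"
    then have "skew_weight \<rho> empty_young = skew_weight \<rho> \<kappa> * skew_weight \<kappa> empty_young"
      using skew_weight_trans[of empty_young \<kappa> \<rho>] by (simp add: contained_downs)
    then show "ndim \<kappa> \<mu> * (ndim \<rho> \<nu> * skew_weight \<rho> empty_young)
        = ndim \<kappa> \<mu> * skew_weight \<kappa> empty_young * (skew_weight \<rho> \<kappa> * ndim \<rho> \<nu>)" by simp
  qed
  also have "\<dots> = (\<Sum>\<kappa>\<in>{\<kappa>. ysize \<kappa> = n}. \<Sum>\<rho>\<in>ups \<kappa>. ndim \<kappa> \<mu> * skew_weight \<kappa> empty_young * (skew_weight \<rho> \<kappa> * ndim \<rho> \<nu>))"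
    unfolding sum.Sigma[OF finite_ysize_eq ballI[OF finite_ups]] sum.Sigma[OF finite_ysize_eq ballI[OF finite_downs]]
    by (rule sum.reindex_bij_witness[where i = prod.swap and j = prod.swap])
       (auto simp: ups_def downs_def covers_def)
  also have "\<dots> = (\<Sum>\<kappa>\<in>{\<kappa>. ysize \<kappa> = n}. ndim \<kappa> \<mu> * skew_weight \<kappa> empty_young *
      ((\<Sum>\<nu>'\<in>downs \<nu>. skew_weight \<nu> \<nu>' * ndim \<kappa> \<nu>') + K * ndim \<kappa> \<nu>))"
    by (intro sum.cong refl) (simp only: sum_distrib_left[symmetric] ndim_commutator mem_Collect_eq K_def)
  also have "\<dots> = (\<Sum>\<kappa>\<in>{\<kappa>. ysize \<kappa> = n}. \<Sum>\<nu>'\<in>downs \<nu>. skew_weight \<nu> \<nu>' * (ndim \<kappa> \<mu> * ndim \<kappa> \<nu>' * skew_weight \<kappa> empty_young))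
      + K * level_sum \<mu> \<nu> n"
    by (simp add: level_sum_def distrib_left sum.distrib sum_distrib_left mult_ac)
  also have "(\<Sum>\<kappa>\<in>{\<kappa>. ysize \<kappa> = n}. \<Sum>\<nu>'\<in>downs \<nu>. skew_weight \<nu> \<nu>' * (ndim \<kappa> \<mu> * ndim \<kappa> \<nu>' * skew_weight \<kappa> empty_young))
      = (\<Sum>\<nu>'\<in>downs \<nu>. skew_weight \<nu> \<nu>' * level_sum \<mu> \<nu>' n)"
    by (subst sum.swap) (simp add: level_sum_def sum_distrib_left)
  finally show ?thesis by (simp add: K_def)
qed

lemma level_sum_eq:
  "level_sum \<mu> \<nu> n = (\<Sum>\<kappa>\<in>{\<kappa>. contained \<kappa> \<mu>}. level_coef \<mu> \<nu> \<kappa> *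
      rising_coef (t + real (ysize \<mu>) + real (ysize \<nu>)) (n + ysize \<kappa>) (ysize \<mu> + ysize \<nu>))"
proof -
  define m where "m = ysize \<mu>"
  define rhs where "rhs n \<nu> = (\<Sum>\<kappa>\<in>{\<kappa>. contained \<kappa> \<mu>}. level_coef \<mu> \<nu> \<kappa> *
      rising_coef (t + real m + real (ysize \<nu>)) (n + ysize \<kappa>) (m + ysize \<nu>))" for n \<nu>
  have coef0: "level_coef \<mu> \<nu> \<kappa> = 0" if "\<not> contained \<kappa> \<nu>" for \<nu> \<kappa>
    using that by (simp add: level_coef_def ndim_not_contained)
  \<comment> \<open>The recursion starts at \<open>n = |\<mu>|\<close>, where only \<open>\<kappa> = \<mu>\<close> contributes on the left and only
    \<open>\<kappa> = \<nu>\<close> on the right.\<close>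
  have base: "level_sum \<mu> \<nu> m = rhs m \<nu>" for \<nu>
  proof -
    have "level_sum \<mu> \<nu> m = (\<Sum>\<kappa>\<in>{\<kappa>. ysize \<kappa> = m}. if \<kappa> = \<mu> then ndim \<mu> \<nu> * skew_weight \<mu> empty_young else 0)"
      unfolding level_sum_def by (intro sum.cong) (auto simp: m_def ndim_eq_size)
    also have "\<dots> = ndim \<mu> \<nu> * skew_weight \<mu> empty_young" by (simp add: m_def)
    also have "\<dots> = level_coef \<mu> \<nu> \<nu>"
    proof (cases "contained \<nu> \<mu>")
      case True
      then show ?thesis using skew_weight_trans[of empty_young \<nu> \<mu>] by (simp add: level_coef_def)
    qed (simp add: level_coef_def ndim_not_contained)
    also have "\<dots> = (\<Sum>\<kappa>\<in>{\<kappa>. contained \<kappa> \<mu>}. if \<kappa> = \<nu> then level_coef \<mu> \<nu> \<nu> else 0)"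
      by (simp add: level_coef_def ndim_not_contained)
    also have "\<dots> = rhs m \<nu>"
      unfolding rhs_def
    proof (intro sum.cong refl)
      fix \<kappa>
      show "(if \<kappa> = \<nu> then level_coef \<mu> \<nu> \<nu> else 0) = level_coef \<mu> \<nu> \<kappa> *
         rising_coef (t + real m + real (ysize \<nu>)) (m + ysize \<kappa>) (m + ysize \<nu>)"
        using coef0[of \<kappa> \<nu>] contained_eqI[of \<kappa> \<nu>] by (auto simp: rising_coef_def)
    qed
    finally show ?thesis .
  qed
  have step: "(real (Suc n) - real m) * rhs (Suc n) \<nu>
      = (\<Sum>\<nu>'\<in>downs \<nu>. skew_weight \<nu> \<nu>' * rhs n \<nu>') + (t + real n + real (ysize \<nu>)) * rhs n \<nu>" for n \<nu>
  proof -
    define v where "v = ysize \<nu>"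
    define A where "A = t + real m + real v"
    define e where "e \<kappa> = ndim \<mu> \<kappa> * skew_weight \<mu> \<kappa> * skew_weight \<kappa> empty_young" for \<kappa>
    have "(\<Sum>\<nu>'\<in>downs \<nu>. skew_weight \<nu> \<nu>' * rhs n \<nu>')
        = (\<Sum>\<kappa>\<in>{\<kappa>. contained \<kappa> \<mu>}. \<Sum>\<nu>'\<in>downs \<nu>. skew_weight \<nu> \<nu>' * (level_coef \<mu> \<nu>' \<kappa> *
             rising_coef (t + real m + real (ysize \<nu>')) (n + ysize \<kappa>) (m + ysize \<nu>')))"
      unfolding rhs_def sum_distrib_left by (rule sum.swap)
    also have "\<dots> = (\<Sum>\<kappa>\<in>{\<kappa>. contained \<kappa> \<mu>}. \<Sum>\<nu>'\<in>downs \<nu>.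
        e \<kappa> * skew_weight \<nu> \<kappa> * rising_coef (A - 1) (Suc (n + ysize \<kappa>)) (m + v) * ndim \<nu>' \<kappa>)"
    proof (intro sum.cong refl)
      fix \<kappa> \<nu>' assume \<nu>': "\<nu>' \<in> downs \<nu>"
      have *: "skew_weight \<nu> \<nu>' * (ndim \<nu>' \<kappa> * skew_weight \<nu>' \<kappa>) = skew_weight \<nu> \<kappa> * ndim \<nu>' \<kappa>"
      proof (cases "contained \<kappa> \<nu>'")
        case True
        then show ?thesis using skew_weight_trans[of \<kappa> \<nu>' \<nu>] contained_downs[OF \<nu>'] by simp
      qed (simp add: ndim_not_contained)
      have a2: "rising_coef (t + real m + real (ysize \<nu>')) (n + ysize \<kappa>) (m + ysize \<nu>')
          = rising_coef (A - 1) (Suc (n + ysize \<kappa>)) (m + v)"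
        using ysize_downs[OF \<nu>'] by (simp add: A_def v_def rising_coef_Suc_Suc algebra_simps)
      have a3: "skew_weight \<nu> \<nu>' * (level_coef \<mu> \<nu>' \<kappa> * p)
          = e \<kappa> * p * (skew_weight \<nu> \<nu>' * (ndim \<nu>' \<kappa> * skew_weight \<nu>' \<kappa>))" for p
        by (simp add: level_coef_def e_def mult_ac)
      show "skew_weight \<nu> \<nu>' * (level_coef \<mu> \<nu>' \<kappa> *
             rising_coef (t + real m + real (ysize \<nu>')) (n + ysize \<kappa>) (m + ysize \<nu>'))
          = e \<kappa> * skew_weight \<nu> \<kappa> * rising_coef (A - 1) (Suc (n + ysize \<kappa>)) (m + v) * ndim \<nu>' \<kappa>"
        unfolding a2 a3 * by (simp add: mult_ac)
    qed
    also have "\<dots> = (\<Sum>\<kappa>\<in>{\<kappa>. contained \<kappa> \<mu>}.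
        e \<kappa> * skew_weight \<nu> \<kappa> * rising_coef (A - 1) (Suc (n + ysize \<kappa>)) (m + v) * ((real v - real (ysize \<kappa>)) * ndim \<nu> \<kappa>))"
      unfolding sum_distrib_left[symmetric] by (simp add: v_def flip: ndim_rec)
    finally have 1: "(\<Sum>\<nu>'\<in>downs \<nu>. skew_weight \<nu> \<nu>' * rhs n \<nu>') = \<dots>" .
    have "(real (Suc n) - real m) * rhs (Suc n) \<nu> = (\<Sum>\<kappa>\<in>{\<kappa>. contained \<kappa> \<mu>}.
        e \<kappa> * skew_weight \<nu> \<kappa> * ndim \<nu> \<kappa> * ((real (Suc (n + ysize \<kappa>)) - real (m + v) + (real v - real (ysize \<kappa>))) *
          rising_coef A (Suc (n + ysize \<kappa>)) (m + v)))"
      unfolding rhs_def sum_distrib_left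
      by (intro sum.cong refl) (simp add: level_coef_def e_def A_def v_def mult_ac)
    also have "\<dots> = (\<Sum>\<kappa>\<in>{\<kappa>. contained \<kappa> \<mu>}.
        e \<kappa> * skew_weight \<nu> \<kappa> * ndim \<nu> \<kappa> * ((real v - real (ysize \<kappa>)) * rising_coef (A - 1) (Suc (n + ysize \<kappa>)) (m + v)
          + (A + real (n + ysize \<kappa>) - real (m + v) + (real v - real (ysize \<kappa>))) * rising_coef A (n + ysize \<kappa>) (m + v)))"
      by (simp only: rising_coef_rec)
    also have "\<dots> = (\<Sum>\<kappa>\<in>{\<kappa>. contained \<kappa> \<mu>}.
        e \<kappa> * skew_weight \<nu> \<kappa> * rising_coef (A - 1) (Suc (n + ysize \<kappa>)) (m + v) * ((real v - real (ysize \<kappa>)) * ndim \<nu> \<kappa>)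
         + (t + real n + real v) * (level_coef \<mu> \<nu> \<kappa> * rising_coef A (n + ysize \<kappa>) (m + v)))"
      by (intro sum.cong refl) (simp add: level_coef_def e_def A_def algebra_simps)
    also have "\<dots> = (\<Sum>\<nu>'\<in>downs \<nu>. skew_weight \<nu> \<nu>' * rhs n \<nu>') + (t + real n + real (ysize \<nu>)) * rhs n \<nu>"
    proof -
      have "(t + real n + real (ysize \<nu>)) * rhs n \<nu> = (\<Sum>\<kappa>\<in>{\<kappa>. contained \<kappa> \<mu>}.
          (t + real n + real v) * (level_coef \<mu> \<nu> \<kappa> * rising_coef A (n + ysize \<kappa>) (m + v)))"
        by (simp add: rhs_def sum_distrib_left A_def v_def)
      then show ?thesis by (simp only: sum.distrib 1)
    qed
    finally show ?thesis .
  qed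
  have ge: "level_sum \<mu> \<nu> (m + j) = rhs (m + j) \<nu>" for j \<nu>
  proof (induction j arbitrary: \<nu>)
    case (Suc j)
    have "(real (Suc (m + j)) - real m) * level_sum \<mu> \<nu> (Suc (m + j))
        = (real (Suc (m + j)) - real m) * rhs (Suc (m + j)) \<nu>"
      by (simp only: step level_sum_rec[where \<mu> = \<mu>, folded m_def] Suc)
    then show ?case by simp
  qed (simp add: base)
  have "level_sum \<mu> \<nu> n = rhs n \<nu>"
  proof (cases "m \<le> n")
    case True
    then show ?thesis using ge[where j = "n - m"] by simp
  next
    case False
    have "level_coef \<mu> \<nu> \<kappa> * rising_coef A (n + ysize \<kappa>) (m + ysize \<nu>) = 0" for \<kappa> A
      using False coef0[of \<kappa> \<nu>] ysize_mono[of \<kappa> \<nu>] by (cases "contained \<kappa> \<nu>") (auto simp: rising_coef_def)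
    moreover have "level_sum \<mu> \<nu> n = 0"
      unfolding level_sum_def using False
      by (intro sum.neutral) (auto simp: ndim_eq_size m_def)
    ultimately show ?thesis unfolding rhs_def by (simp only: sum.neutral_const)
  qed
  then show ?thesis by (simp add: rhs_def m_def)
qed

lemma level_sum_sums:
  assumes "0 < \<xi>" "\<xi> < 1"
  shows "(\<lambda>n. \<xi> ^ n * level_sum \<mu> \<nu> n) sums
    (\<Sum>\<kappa>\<in>{\<kappa>. contained \<kappa> \<mu>}. level_coef \<mu> \<nu> \<kappa> *
      (\<xi> ^ (ysize \<mu> + ysize \<nu> - ysize \<kappa>) * (1 - \<xi>) powr (- (t + real (ysize \<mu>) + real (ysize \<nu>)))))"
proof -
  have "(\<lambda>n. \<Sum>\<kappa>\<in>{\<kappa>. contained \<kappa> \<mu>}. level_coef \<mu> \<nu> \<kappa> *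
      (\<xi> ^ n * rising_coef (t + real (ysize \<mu>) + real (ysize \<nu>)) (n + ysize \<kappa>) (ysize \<mu> + ysize \<nu>))) sums
    (\<Sum>\<kappa>\<in>{\<kappa>. contained \<kappa> \<mu>}. level_coef \<mu> \<nu> \<kappa> *
      (\<xi> ^ (ysize \<mu> + ysize \<nu> - ysize \<kappa>) * (1 - \<xi>) powr (- (t + real (ysize \<mu>) + real (ysize \<nu>)))))"
    using assms ysize_mono[of _ \<mu>]
    by (intro sums_sum sums_mult rising_coef_sums) (auto intro: le_trans trans_le_add1)
  then show ?thesis
    by (simp add: level_sum_eq sum_distrib_left mult_ac)
qed

end

text \<open>For nonnegative functions the unordered sum over all diagrams may be taken size by size.\<close>

lemma has_sum_young_levels:
  fixes f :: "young \<Rightarrow> real"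
  assumes nonneg: "\<And>\<kappa>. f \<kappa> \<ge> 0" and sums: "(\<lambda>n. \<Sum>\<kappa>\<in>{\<kappa>. ysize \<kappa> = n}. f \<kappa>) sums S"
  shows "(f has_sum S) UNIV"
proof -
  define g where "g n = (\<Sum>\<kappa>\<in>{\<kappa>. ysize \<kappa> = n}. f \<kappa>)" for n
  have g: "g sums S" using sums unfolding g_def .
  have g0: "g n \<ge> 0" for n using nonneg by (simp add: g_def sum_nonneg)
  have part: "(\<Sum>\<kappa>\<in>{\<kappa>. ysize \<kappa> \<le> n}. f \<kappa>) = (\<Sum>k\<le>n. g k)" for n
    unfolding g_def by (subst sum_young_levels[of _ n]) (auto intro!: sum.cong)
  have le: "sum f F \<le> S" if "finite F" for F
  proof -
    have "finite (ysize ` F)" using that by simp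
    then obtain n where n: "\<And>\<kappa>. \<kappa> \<in> F \<Longrightarrow> ysize \<kappa> \<le> n"
      unfolding finite_nat_set_iff_bounded_le by blast
    have "sum f F \<le> (\<Sum>\<kappa>\<in>{\<kappa>. ysize \<kappa> \<le> n}. f \<kappa>)"
      using n nonneg by (intro sum_mono2) auto
    also have "\<dots> \<le> suminf g"
      unfolding part lessThan_Suc_atMost[symmetric] using g g0
      by (intro sum_le_suminf) (auto simp: sums_iff)
    finally show ?thesis using g by (simp add: sums_iff)
  qed
  have summable: "f summable_on UNIV"
    using le nonneg by (intro nonneg_bdd_above_summable_on) (auto simp: bdd_above_def)
  have "infsum f UNIV \<le> S"
    using le by (intro infsum_le_finite_sums summable) auto
  moreover have "S \<le> infsum f UNIV"
  proof (rule LIMSEQ_le_const2)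
    show "(\<lambda>n. \<Sum>k<n. g k) \<longlonglongrightarrow> S" using g by (simp add: sums_def)
    have "(\<Sum>k<n. g k) \<le> infsum f UNIV" for n
    proof -
      have "(\<Sum>k<n. g k) \<le> (\<Sum>k\<le>n. g k)" using g0 by (intro sum_mono2) auto
      also have "\<dots> \<le> infsum f UNIV"
        unfolding part[symmetric] using nonneg by (intro finite_sum_le_infsum summable) auto
      finally show ?thesis .
    qed
    then show "\<exists>N. \<forall>n\<ge>N. (\<Sum>k<n. g k) \<le> infsum f UNIV" by blast
  qed
  ultimately show ?thesis using summable has_sum_infsum by fastforce
qed


section \<open>Orthogonality of the Meixner functions\<close>

text \<open>The value of \<open>FS\<^sub>\<mu>\<close> at \<open>\<kappa>\<close>, as proved in \<open>realize_FS\<close>. The denominator is positive.\<close>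

definition fs_value :: "young \<Rightarrow> young \<Rightarrow> real" where
  "fs_value \<mu> \<kappa> = ndim \<kappa> \<mu> / ndim \<kappa> empty_young"

lemma fs_value_empty [simp]: "fs_value empty_young \<kappa> = 1"
  using ndim_empty_pos[of \<kappa>] by (simp add: fs_value_def)

lemma has_sum_sum_finite:
  fixes f :: "'i \<Rightarrow> 'a \<Rightarrow> 'b::{topological_comm_monoid_add}"
  assumes "finite I" "\<And>i. i \<in> I \<Longrightarrow> (f i has_sum S i) A"
  shows "((\<lambda>x. \<Sum>i\<in>I. f i x) has_sum (\<Sum>i\<in>I. S i)) A"
  using assms by (induction I rule: finite_induct) (auto intro: has_sum_add)

text \<open>Parameters for which the z-measure is nonnegative. Some weights may vanish.\<close>

locale meixner_weight = content_weight +
  fixes \<xi> :: real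
  assumes xi: "0 < \<xi>" "\<xi> < 1"
    and skew_weight_nonneg: "skew_weight \<kappa> empty_young \<ge> 0"
begin

definition eta :: real where "eta = \<xi> / (1 - \<xi>)"

text \<open>The z-measure in terms of \<open>s\<close>, \<open>t\<close> and \<open>\<xi>\<close>.\<close>

definition zweight :: "young \<Rightarrow> real" where
  "zweight \<kappa> = (1 - \<xi>) powr t * skew_weight \<kappa> empty_young * \<xi> ^ ysize \<kappa> * (ndim \<kappa> empty_young)\<^sup>2"

text \<open>The coefficient of the Meixner function \<open>M\<^sub>\<kappa>\<close> in \<open>FS\<^sub>\<nu>\<close>.\<close>

definition fs_entry :: "young \<Rightarrow> young \<Rightarrow> real" where
  "fs_entry \<nu> \<kappa> = eta ^ (ysize \<nu> - ysize \<kappa>) * (ndim \<nu> \<kappa> * skew_weight \<nu> \<kappa>)"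

text \<open>The coefficient of \<open>FS\<^sub>\<kappa>\<close> in the Meixner function \<open>M\<^sub>\<nu>\<close>.\<close>

definition meixner_entry :: "young \<Rightarrow> young \<Rightarrow> real" where
  "meixner_entry \<nu> \<kappa> = (- eta) ^ (ysize \<nu> - ysize \<kappa>) * (ndim \<nu> \<kappa> * skew_weight \<nu> \<kappa>)"

text \<open>The expectation of the square of the Meixner function \<open>M\<^sub>\<kappa>\<close>.\<close>

definition meixner_norm :: "young \<Rightarrow> real" where
  "meixner_norm \<kappa> = skew_weight \<kappa> empty_young * \<xi> ^ ysize \<kappa> / (1 - \<xi>) ^ (2 * ysize \<kappa>)"

text \<open>The value of the Meixner function \<open>M\<^sub>\<nu>\<close> at the diagram \<open>\<kappa>\<close>.\<close>

definition meixner_value :: "young \<Rightarrow> young \<Rightarrow> real" where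
  "meixner_value \<nu> \<kappa> = (\<Sum>\<mu>\<in>{\<mu>. contained \<mu> \<nu>}. meixner_entry \<nu> \<mu> * fs_value \<mu> \<kappa>)"

lemma eta_pos: "eta > 0"
  using xi by (simp add: eta_def)

lemma zweight_nonneg: "zweight \<kappa> \<ge> 0"
  using skew_weight_nonneg xi by (simp add: zweight_def)

text \<open>The Gram matrix of the functions \<open>FS\<^sub>\<mu>\<close>, factored as a unitriangular matrix times a diagonal
  matrix times the transpose of the first one.\<close>

lemma fs_value_product_has_sum:
  "((\<lambda>\<kappa>. fs_value \<mu> \<kappa> * fs_value \<nu> \<kappa> * zweight \<kappa>) has_sum
      (\<Sum>\<kappa>\<in>{\<kappa>. contained \<kappa> \<mu>}. fs_entry \<mu> \<kappa> * fs_entry \<nu> \<kappa> * meixner_norm \<kappa>)) UNIV"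
proof -
  define m v where "m = ysize \<mu>" and "v = ysize \<nu>"
  have eq: "fs_value \<mu> \<kappa> * fs_value \<nu> \<kappa> * zweight \<kappa>
      = (1 - \<xi>) powr t * (\<xi> ^ ysize \<kappa> * (ndim \<kappa> \<mu> * ndim \<kappa> \<nu> * skew_weight \<kappa> empty_young))" for \<kappa>
    using ndim_empty_pos[of \<kappa>] by (simp add: fs_value_def zweight_def power2_eq_square)
  have "(\<lambda>n. (1 - \<xi>) powr t * (\<xi> ^ n * level_sum \<mu> \<nu> n)) sums ((1 - \<xi>) powr t *
      (\<Sum>\<kappa>\<in>{\<kappa>. contained \<kappa> \<mu>}. level_coef \<mu> \<nu> \<kappa> *
      (\<xi> ^ (m + v - ysize \<kappa>) * (1 - \<xi>) powr (- (t + real m + real v)))))"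
    unfolding m_def v_def by (intro sums_mult level_sum_sums xi)
  also have "(\<lambda>n. (1 - \<xi>) powr t * (\<xi> ^ n * level_sum \<mu> \<nu> n))
      = (\<lambda>n. \<Sum>\<kappa>\<in>{\<kappa>. ysize \<kappa> = n}. fs_value \<mu> \<kappa> * fs_value \<nu> \<kappa> * zweight \<kappa>)"
    by (rule ext) (simp add: eq level_sum_def sum_distrib_left)
  also have "(1 - \<xi>) powr t *
      (\<Sum>\<kappa>\<in>{\<kappa>. contained \<kappa> \<mu>}. level_coef \<mu> \<nu> \<kappa> *
      (\<xi> ^ (m + v - ysize \<kappa>) * (1 - \<xi>) powr (- (t + real m + real v))))
    = (\<Sum>\<kappa>\<in>{\<kappa>. contained \<kappa> \<mu>}. fs_entry \<mu> \<kappa> * fs_entry \<nu> \<kappa> * meixner_norm \<kappa>)"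
    unfolding sum_distrib_left
  proof (intro sum.cong refl)
    fix \<kappa> assume "\<kappa> \<in> {\<kappa>. contained \<kappa> \<mu>}"
    then have \<kappa>: "ysize \<kappa> \<le> m" using ysize_mono by (auto simp: m_def)
    show "(1 - \<xi>) powr t * (level_coef \<mu> \<nu> \<kappa> *
        (\<xi> ^ (m + v - ysize \<kappa>) * (1 - \<xi>) powr (- (t + real m + real v))))
        = fs_entry \<mu> \<kappa> * fs_entry \<nu> \<kappa> * meixner_norm \<kappa>"
    proof (cases "contained \<kappa> \<nu>")
      case False
      then show ?thesis by (simp add: level_coef_def fs_entry_def ndim_not_contained)
    next
      case True
      then have \<kappa>': "ysize \<kappa> \<le> v" using ysize_mono by (auto simp: v_def)
      define k where "k = ysize \<kappa>"
      obtain a where a: "m = k + a" using \<kappa> le_Suc_ex k_def by blast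
      obtain b where b: "v = k + b" using \<kappa>' le_Suc_ex k_def by blast
      have "(1 - \<xi>) powr t * (1 - \<xi>) powr (- (t + real m + real v)) = (1 - \<xi>) powr (- real (m + v))"
        using xi by (simp flip: powr_add)
      also have "\<dots> = 1 / (1 - \<xi>) ^ (m + v)"
        using xi powr_realpow[of "1 - \<xi>" "m + v"] powr_minus[of "1 - \<xi>" "real (m + v)"]
        by (simp only: inverse_eq_divide)
      finally have p: "(1 - \<xi>) powr t * (1 - \<xi>) powr (- (t + real m + real v)) = 1 / (1 - \<xi>) ^ (m + v)" .
      have e: "eta ^ a * eta ^ b * (\<xi> ^ k / (1 - \<xi>) ^ (2 * k)) = \<xi> ^ (m + v - k) * (1 / (1 - \<xi>) ^ (m + v))"
      proof -
        have "m + v - k = k + a + b" "(1 - \<xi>) ^ (2 * k) = (1 - \<xi>) ^ k * (1 - \<xi>) ^ k"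
          by (simp_all add: a b mult_2 power_add)
        then show ?thesis by (simp add: a b eta_def power_divide power_add mult_ac)
      qed
      have "(1 - \<xi>) powr t * (level_coef \<mu> \<nu> \<kappa> *
        (\<xi> ^ (m + v - k) * (1 - \<xi>) powr (- (t + real m + real v))))
        = level_coef \<mu> \<nu> \<kappa> * (\<xi> ^ (m + v - k) * (1 / (1 - \<xi>) ^ (m + v)))"
        by (simp flip: p)
      also have "\<dots> = fs_entry \<mu> \<kappa> * fs_entry \<nu> \<kappa> * meixner_norm \<kappa>"
        unfolding e[symmetric] fs_entry_def meixner_norm_def level_coef_def m_def[symmetric] v_def[symmetric] k_def[symmetric]
        by (simp add: a b)
      finally show ?thesis by (simp add: k_def)
    qed
  qed
  finally show ?thesis
    using ndim_nonneg zweight_nonneg by (intro has_sum_young_levels) (auto simp: fs_value_def)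
qed

lemma fs_entry_triangular: "\<not> contained \<kappa> \<nu> \<Longrightarrow> fs_entry \<nu> \<kappa> = 0"
  and meixner_entry_triangular: "\<not> contained \<kappa> \<nu> \<Longrightarrow> meixner_entry \<nu> \<kappa> = 0"
  by (simp_all add: fs_entry_def meixner_entry_def ndim_not_contained)

lemma meixner_entry_fs_entry_inverse:
  assumes S: "finite S" "{\<kappa>. contained \<kappa> \<nu>} \<subseteq> S"
  shows "(\<Sum>\<kappa>\<in>S. meixner_entry \<nu> \<kappa> * fs_entry \<kappa> \<mu>) = of_bool (\<nu> = \<mu>)"
proof -
  have "meixner_entry \<nu> \<kappa> * fs_entry \<kappa> \<mu>
     = (-1) ^ ysize \<nu> * eta ^ (ysize \<nu> - ysize \<mu>) * skew_weight \<nu> \<mu> * ((-1) ^ ysize \<kappa> * (ndim \<nu> \<kappa> * ndim \<kappa> \<mu>))" for \<kappa>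
  proof (cases "contained \<kappa> \<nu> \<and> contained \<mu> \<kappa>")
    case False
    then show ?thesis by (auto simp: meixner_entry_def fs_entry_def ndim_not_contained)
  next
    case True
    then have le: "ysize \<mu> \<le> ysize \<kappa>" "ysize \<kappa> \<le> ysize \<nu>" using ysize_mono by auto
    have eta: "eta ^ (ysize \<nu> - ysize \<kappa>) * eta ^ (ysize \<kappa> - ysize \<mu>) = eta ^ (ysize \<nu> - ysize \<mu>)"
      using le by (simp flip: power_add)
    have sgn: "(-1) ^ (ysize \<nu> - ysize \<kappa>) = (-1) ^ ysize \<nu> * (-1 :: real) ^ ysize \<kappa>"
      using le by (simp add: minus_one_power_iff)
    have "meixner_entry \<nu> \<kappa> * fs_entry \<kappa> \<mu> = (-1) ^ (ysize \<nu> - ysize \<kappa>)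
        * (eta ^ (ysize \<nu> - ysize \<kappa>) * eta ^ (ysize \<kappa> - ysize \<mu>)) * (skew_weight \<nu> \<kappa> * skew_weight \<kappa> \<mu>) * (ndim \<nu> \<kappa> * ndim \<kappa> \<mu>)"
      by (simp add: meixner_entry_def fs_entry_def power_minus[of eta "ysize \<nu> - ysize \<kappa>"])
    also have "\<dots> = (-1) ^ ysize \<nu> * eta ^ (ysize \<nu> - ysize \<mu>) * skew_weight \<nu> \<mu> * ((-1) ^ ysize \<kappa> * (ndim \<nu> \<kappa> * ndim \<kappa> \<mu>))"
      using True by (simp add: eta sgn skew_weight_trans)
    finally show ?thesis .
  qed
  then have "(\<Sum>\<kappa>\<in>S. meixner_entry \<nu> \<kappa> * fs_entry \<kappa> \<mu>)
      = (-1) ^ ysize \<nu> * eta ^ (ysize \<nu> - ysize \<mu>) * skew_weight \<nu> \<mu> * ((-1) ^ ysize \<nu> * of_bool (\<nu> = \<mu>))"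
    by (simp only: sum_distrib_left[symmetric] ndim_inversion[OF S])
  then show ?thesis by auto
qed

lemma meixner_value_eq_sum:
  assumes "finite U" "{\<mu>. contained \<mu> \<nu>} \<subseteq> U"
  shows "meixner_value \<nu> \<kappa> = (\<Sum>\<mu>\<in>U. meixner_entry \<nu> \<mu> * fs_value \<mu> \<kappa>)"
  unfolding meixner_value_def using assms
proof (rule sum.mono_neutral_left)
  show "\<forall>\<mu>\<in>U - {\<mu>. contained \<mu> \<nu>}. meixner_entry \<nu> \<mu> * fs_value \<mu> \<kappa> = 0"
    by (simp add: meixner_entry_triangular)
qed

theorem meixner_value_orthogonal:
  "((\<lambda>\<kappa>. meixner_value \<nu> \<kappa> * meixner_value \<nu>' \<kappa> * zweight \<kappa>) has_sum (of_bool (\<nu> = \<nu>') * meixner_norm \<nu>)) UNIV"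
proof -
  define n where "n = max (ysize \<nu>) (ysize \<nu>')"
  define U where "U = {\<mu>. ysize \<mu> \<le> n}"
  have U: "finite U" "{\<kappa>. contained \<kappa> \<nu>} \<subseteq> U" "{\<kappa>. contained \<kappa> \<nu>'} \<subseteq> U"
    using ysize_mono by (auto simp: U_def n_def le_max_iff_disj)
  have U': "{\<kappa>. contained \<kappa> \<mu>} \<subseteq> U" if "\<mu> \<in> U" for \<mu>
    using that ysize_mono by (fastforce simp: U_def)
  have meixner_value: "meixner_value \<nu> \<kappa> = (\<Sum>\<mu>\<in>U. meixner_entry \<nu> \<mu> * fs_value \<mu> \<kappa>)" "meixner_value \<nu>' \<kappa> = (\<Sum>\<mu>\<in>U. meixner_entry \<nu>' \<mu> * fs_value \<mu> \<kappa>)" for \<kappa>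
    by (intro meixner_value_eq_sum U)+
  have "((\<lambda>\<kappa>. \<Sum>\<mu>\<in>U. \<Sum>\<mu>'\<in>U. meixner_entry \<nu> \<mu> * meixner_entry \<nu>' \<mu>' * (fs_value \<mu> \<kappa> * fs_value \<mu>' \<kappa> * zweight \<kappa>)) has_sum
     (\<Sum>\<mu>\<in>U. \<Sum>\<mu>'\<in>U. meixner_entry \<nu> \<mu> * meixner_entry \<nu>' \<mu>' * (\<Sum>\<kappa>\<in>{\<kappa>. contained \<kappa> \<mu>}. fs_entry \<mu> \<kappa> * fs_entry \<mu>' \<kappa> * meixner_norm \<kappa>))) UNIV"
    by (intro has_sum_sum_finite U has_sum_cmult_right fs_value_product_has_sum)
  also have "(\<lambda>\<kappa>. \<Sum>\<mu>\<in>U. \<Sum>\<mu>'\<in>U. meixner_entry \<nu> \<mu> * meixner_entry \<nu>' \<mu>' * (fs_value \<mu> \<kappa> * fs_value \<mu>' \<kappa> * zweight \<kappa>))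
      = (\<lambda>\<kappa>. meixner_value \<nu> \<kappa> * meixner_value \<nu>' \<kappa> * zweight \<kappa>)"
  proof
    fix \<kappa>
    have "meixner_value \<nu> \<kappa> * meixner_value \<nu>' \<kappa> * zweight \<kappa>
        = (\<Sum>\<mu>\<in>U. \<Sum>\<mu>'\<in>U. meixner_entry \<nu> \<mu> * fs_value \<mu> \<kappa> * (meixner_entry \<nu>' \<mu>' * fs_value \<mu>' \<kappa>) * zweight \<kappa>)"
      unfolding meixner_value by (subst sum_product) (simp only: sum_distrib_right)
    then show "(\<Sum>\<mu>\<in>U. \<Sum>\<mu>'\<in>U. meixner_entry \<nu> \<mu> * meixner_entry \<nu>' \<mu>' * (fs_value \<mu> \<kappa> * fs_value \<mu>' \<kappa> * zweight \<kappa>))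
        = meixner_value \<nu> \<kappa> * meixner_value \<nu>' \<kappa> * zweight \<kappa>"
      by (simp only: mult_ac)
  qed
  also have "(\<Sum>\<mu>\<in>U. \<Sum>\<mu>'\<in>U. meixner_entry \<nu> \<mu> * meixner_entry \<nu>' \<mu>' * (\<Sum>\<kappa>\<in>{\<kappa>. contained \<kappa> \<mu>}. fs_entry \<mu> \<kappa> * fs_entry \<mu>' \<kappa> * meixner_norm \<kappa>))
      = (\<Sum>\<mu>\<in>U. \<Sum>\<mu>'\<in>U. \<Sum>\<kappa>\<in>U. meixner_norm \<kappa> * ((meixner_entry \<nu> \<mu> * fs_entry \<mu> \<kappa>) * (meixner_entry \<nu>' \<mu>' * fs_entry \<mu>' \<kappa>)))"
  proof (intro sum.cong refl)
    fix \<mu> \<mu>' assume "\<mu> \<in> U"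
    then have "(\<Sum>\<kappa>\<in>{\<kappa>. contained \<kappa> \<mu>}. fs_entry \<mu> \<kappa> * fs_entry \<mu>' \<kappa> * meixner_norm \<kappa>) = (\<Sum>\<kappa>\<in>U. fs_entry \<mu> \<kappa> * fs_entry \<mu>' \<kappa> * meixner_norm \<kappa>)"
      using U(1) U' by (intro sum.mono_neutral_left) (auto simp: fs_entry_triangular)
    then show "meixner_entry \<nu> \<mu> * meixner_entry \<nu>' \<mu>' * (\<Sum>\<kappa>\<in>{\<kappa>. contained \<kappa> \<mu>}. fs_entry \<mu> \<kappa> * fs_entry \<mu>' \<kappa> * meixner_norm \<kappa>)
        = (\<Sum>\<kappa>\<in>U. meixner_norm \<kappa> * ((meixner_entry \<nu> \<mu> * fs_entry \<mu> \<kappa>) * (meixner_entry \<nu>' \<mu>' * fs_entry \<mu>' \<kappa>)))"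
      by (simp add: sum_distrib_left mult_ac)
  qed
  also have "\<dots> = (\<Sum>\<mu>\<in>U. \<Sum>\<kappa>\<in>U. \<Sum>\<mu>'\<in>U. meixner_norm \<kappa> * ((meixner_entry \<nu> \<mu> * fs_entry \<mu> \<kappa>) * (meixner_entry \<nu>' \<mu>' * fs_entry \<mu>' \<kappa>)))"
    by (intro sum.cong refl sum.swap)
  also have "\<dots> = (\<Sum>\<kappa>\<in>U. \<Sum>\<mu>\<in>U. \<Sum>\<mu>'\<in>U. meixner_norm \<kappa> * ((meixner_entry \<nu> \<mu> * fs_entry \<mu> \<kappa>) * (meixner_entry \<nu>' \<mu>' * fs_entry \<mu>' \<kappa>)))"
    by (rule sum.swap)
  also have "\<dots> = (\<Sum>\<kappa>\<in>U. meixner_norm \<kappa> * ((\<Sum>\<mu>\<in>U. meixner_entry \<nu> \<mu> * fs_entry \<mu> \<kappa>) * (\<Sum>\<mu>'\<in>U. meixner_entry \<nu>' \<mu>' * fs_entry \<mu>' \<kappa>)))"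
    by (intro sum.cong refl) (subst sum_product, simp only: sum_distrib_left)
  also have "\<dots> = (\<Sum>\<kappa>\<in>U. if \<kappa> = \<nu> then of_bool (\<nu> = \<nu>') * meixner_norm \<nu> else 0)"
    unfolding meixner_entry_fs_entry_inverse[OF U(1,2)] meixner_entry_fs_entry_inverse[OF U(1,3)] by (intro sum.cong) auto
  also have "\<dots> = of_bool (\<nu> = \<nu>') * meixner_norm \<nu>"
  proof -
    have "\<nu> \<in> U" by (simp add: U_def n_def)
    then show ?thesis using U(1) by simp
  qed
  finally show ?thesis .
qed

lemma meixner_value_empty [simp]: "meixner_value empty_young \<kappa> = 1"
proof -
  have "{\<mu>. contained \<mu> empty_young} = {empty_young}"
    using contained_antisym by auto
  then show ?thesis by (simp add: meixner_value_def meixner_entry_def)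
qed

lemma meixner_norm_empty [simp]: "meixner_norm empty_young = 1"
  by (simp add: meixner_norm_def)

lemma meixner_value_expectation: "((\<lambda>\<kappa>. meixner_value \<nu> \<kappa> * zweight \<kappa>) has_sum of_bool (\<nu> = empty_young)) UNIV"
  using meixner_value_orthogonal[of \<nu> empty_young] by (auto split: if_splits)

lemma meixner_value_square_summable: "(\<lambda>\<kappa>. (meixner_value \<nu> \<kappa>)\<^sup>2 * zweight \<kappa>) summable_on UNIV"
  using meixner_value_orthogonal[of \<nu> \<nu>] by (auto simp: summable_on_def power2_eq_square)

lemma fs_value_summable: "(\<lambda>\<kappa>. fs_value \<mu> \<kappa> * zweight \<kappa>) summable_on UNIV"
  using fs_value_product_has_sum[of \<mu> empty_young] by (auto simp: summable_on_def)

end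


section \<open>Completeness of the Meixner functions\<close>

text \<open>The z-measure charges every diagram; this is the situation of the principal and complementary
  series.\<close>

locale positive_meixner_weight = meixner_weight +
  assumes skew_weight_pos: "skew_weight \<kappa> empty_young > 0"
begin

lemma zweight_pos: "zweight \<kappa> > 0"
  using skew_weight_pos[of \<kappa>] xi ndim_empty_pos[of \<kappa>] by (simp add: zweight_def)

lemma meixner_norm_pos: "meixner_norm \<kappa> > 0"
  using skew_weight_pos[of \<kappa>] xi by (simp add: meixner_norm_def)

text \<open>The part of \<open>M\<^sub>\<nu>(\<kappa>)\<close> that is symmetric in \<open>\<nu>\<close> and \<open>\<kappa>\<close>.\<close>

definition autodual_kernel :: "young \<Rightarrow> young \<Rightarrow> real" where
  "autodual_kernel \<kappa> \<nu> = (\<Sum>\<mu>\<in>{\<mu>. contained \<mu> \<nu> \<and> contained \<mu> \<kappa>}.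
     ndim \<nu> \<mu> * ndim \<kappa> \<mu> / ((- eta) ^ ysize \<mu> * skew_weight \<mu> empty_young))"

lemma autodual_kernel_commute: "autodual_kernel \<kappa> \<nu> = autodual_kernel \<nu> \<kappa>"
  unfolding autodual_kernel_def by (intro sum.cong) (auto simp: mult_ac)

lemma meixner_value_autodual: "meixner_value \<nu> \<kappa> = (- eta) ^ ysize \<nu> * skew_weight \<nu> empty_young * autodual_kernel \<kappa> \<nu> / ndim \<kappa> empty_young"
proof -
  have "meixner_value \<nu> \<kappa> = (\<Sum>\<mu>\<in>{\<mu>. contained \<mu> \<nu> \<and> contained \<mu> \<kappa>}. meixner_entry \<nu> \<mu> * fs_value \<mu> \<kappa>)"
    unfolding meixner_value_def
    by (rule sum.mono_neutral_right) (auto simp: fs_value_def ndim_not_contained)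
  also have "\<dots> = (\<Sum>\<mu>\<in>{\<mu>. contained \<mu> \<nu> \<and> contained \<mu> \<kappa>}. (- eta) ^ ysize \<nu> * skew_weight \<nu> empty_young / ndim \<kappa> empty_young *
      (ndim \<nu> \<mu> * ndim \<kappa> \<mu> / ((- eta) ^ ysize \<mu> * skew_weight \<mu> empty_young)))"
  proof (intro sum.cong refl)
    fix \<mu> assume "\<mu> \<in> {\<mu>. contained \<mu> \<nu> \<and> contained \<mu> \<kappa>}"
    then have \<mu>: "contained \<mu> \<nu>" by simp
    have 1: "skew_weight \<nu> empty_young = skew_weight \<nu> \<mu> * skew_weight \<mu> empty_young" using \<mu> by (simp add: skew_weight_trans)
    have 2: "(- eta) ^ ysize \<nu> = (- eta) ^ (ysize \<nu> - ysize \<mu>) * (- eta) ^ ysize \<mu>"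
      using ysize_mono[OF \<mu>] by (simp flip: power_add)
    have 3: "eta \<noteq> 0" "skew_weight \<mu> empty_young \<noteq> 0"
      using eta_pos skew_weight_pos[of \<mu>] by auto
    show "meixner_entry \<nu> \<mu> * fs_value \<mu> \<kappa> = (- eta) ^ ysize \<nu> * skew_weight \<nu> empty_young / ndim \<kappa> empty_young *
      (ndim \<nu> \<mu> * ndim \<kappa> \<mu> / ((- eta) ^ ysize \<mu> * skew_weight \<mu> empty_young))"
      unfolding meixner_entry_def fs_value_def 1 2 using 3 by (simp add: field_simps)
  qed
  finally show ?thesis by (simp only: autodual_kernel_def flip: sum_distrib_left) simp
qed

text \<open>Orthogonality of the rows of the matrix \<open>M\<^sub>\<nu>(\<kappa>)\<close>; by autoduality it is the orthogonality of
  its columns in another normalization.\<close>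

lemma meixner_value_dual_orthogonal:
  "((\<lambda>\<nu>. meixner_value \<nu> \<kappa> * meixner_value \<nu> \<kappa>' / meixner_norm \<nu>) has_sum (of_bool (\<kappa> = \<kappa>') / zweight \<kappa>)) UNIV"
proof -
  define b where "b \<kappa> = (- eta) ^ ysize \<kappa> * skew_weight \<kappa> empty_young * ndim \<kappa> empty_young" for \<kappa>
  define p where "p = (1 - \<xi>) powr t"
  have p: "p \<noteq> 0" using xi by (simp add: p_def)
  have nz: "ndim \<kappa> empty_young \<noteq> 0" "skew_weight \<kappa> empty_young \<noteq> 0" for \<kappa>
    using ndim_empty_pos[of \<kappa>] skew_weight_pos[of \<kappa>] by auto
  have x: "eta \<noteq> 0" "\<xi> \<noteq> 0" "1 - \<xi> \<noteq> 0" using xi eta_pos by auto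
  have b: "b \<kappa> \<noteq> 0" for \<kappa> using nz x by (simp add: b_def)
  have sq: "(- eta) ^ n * (- eta) ^ n = eta ^ (2 * n)" for n
    by (simp add: mult_2 flip: power_add power_mult_distrib)
  have eq: "meixner_value \<kappa> \<nu> * meixner_value \<kappa>' \<nu> * zweight \<nu> / (b \<kappa> * b \<kappa>' * p) = meixner_value \<nu> \<kappa> * meixner_value \<nu> \<kappa>' / meixner_norm \<nu>" for \<nu>
  proof -
    have mx1: "meixner_value \<kappa> \<nu> = b \<kappa> * autodual_kernel \<kappa> \<nu> / (ndim \<kappa> empty_young * ndim \<nu> empty_young)" for \<kappa>
      using nz by (simp add: meixner_value_autodual[of \<kappa> \<nu>] autodual_kernel_commute[of \<nu> \<kappa>] b_def)
    have "meixner_value \<kappa> \<nu> * meixner_value \<kappa>' \<nu> * zweight \<nu> / (b \<kappa> * b \<kappa>' * p)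
        = autodual_kernel \<kappa> \<nu> * autodual_kernel \<kappa>' \<nu> * \<xi> ^ ysize \<nu> * skew_weight \<nu> empty_young / (ndim \<kappa> empty_young * ndim \<kappa>' empty_young)"
      unfolding mx1 zweight_def p_def[symmetric] using nz p b by (simp add: power2_eq_square)
    also have "\<dots> = meixner_value \<nu> \<kappa> * meixner_value \<nu> \<kappa>' / meixner_norm \<nu>"
    proof -
      have "meixner_value \<nu> \<kappa> * meixner_value \<nu> \<kappa>' = ((- eta) ^ ysize \<nu> * (- eta) ^ ysize \<nu>) * (skew_weight \<nu> empty_young)\<^sup>2 * (autodual_kernel \<kappa> \<nu> * autodual_kernel \<kappa>' \<nu>)
          / (ndim \<kappa> empty_young * ndim \<kappa>' empty_young)"
        by (simp add: meixner_value_autodual power2_eq_square)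
      then show ?thesis unfolding sq
        using nz x by (simp add: meixner_norm_def eta_def power_divide power2_eq_square mult_2 power_add)
    qed
    finally show ?thesis .
  qed
  have "((\<lambda>\<nu>. meixner_value \<kappa> \<nu> * meixner_value \<kappa>' \<nu> * zweight \<nu> / (b \<kappa> * b \<kappa>' * p)) has_sum (of_bool (\<kappa> = \<kappa>') * meixner_norm \<kappa> / (b \<kappa> * b \<kappa>' * p))) UNIV"
    using has_sum_cmult_right[OF meixner_value_orthogonal[of \<kappa> \<kappa>'], of "1 / (b \<kappa> * b \<kappa>' * p)"] by simp
  moreover have "of_bool (\<kappa> = \<kappa>') * meixner_norm \<kappa> / (b \<kappa> * b \<kappa>' * p) = of_bool (\<kappa> = \<kappa>') / zweight \<kappa>"
  proof (cases "\<kappa> = \<kappa>'")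
    case True
    have "b \<kappa> * b \<kappa> = eta ^ (2 * ysize \<kappa>) * (skew_weight \<kappa> empty_young)\<^sup>2 * (ndim \<kappa> empty_young)\<^sup>2"
      unfolding b_def sq[symmetric] by (simp add: power2_eq_square)
    then have "meixner_norm \<kappa> / (b \<kappa> * b \<kappa> * p) = 1 / zweight \<kappa>"
      using nz x p unfolding meixner_norm_def zweight_def eta_def p_def[symmetric]
      by (simp add: power_divide power2_eq_square mult_2 power_add)
    then show ?thesis using True by simp
  qed simp
  ultimately show ?thesis by (simp only: eq)
qed

lemma ell2_inner_meixner_value: "ell2_inner zweight (meixner_value \<nu>) (meixner_value \<nu>') = of_bool (\<nu> = \<nu>') * meixner_norm \<nu>"
  unfolding ell2_inner_def using meixner_value_orthogonal by (rule infsumI)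

lemma diff_le_if_dist_le: "dist a b \<le> c \<Longrightarrow> b - a \<le> (c :: real)"
  by (simp add: dist_real_def)

text \<open>The expansion of a function supported on \<open>B\<close> in Meixner functions satisfies Parseval's identity,
  so its partial sums converge in the weighted norm.\<close>

lemma finite_support_approx:
  assumes B: "finite B" and e: "e > 0"
  obtains A c where "finite A"
    "(\<lambda>\<kappa>. ((if \<kappa> \<in> B then f \<kappa> else 0) - (\<Sum>\<nu>\<in>A. c \<nu> * meixner_value \<nu> \<kappa>))\<^sup>2 * zweight \<kappa>) summable_on UNIV"
    "infsum (\<lambda>\<kappa>. ((if \<kappa> \<in> B then f \<kappa> else 0) - (\<Sum>\<nu>\<in>A. c \<nu> * meixner_value \<nu> \<kappa>))\<^sup>2 * zweight \<kappa>) UNIV < e"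
proof -
  define g where "g \<kappa> = (if \<kappa> \<in> B then f \<kappa> else 0)" for \<kappa>
  define c where "c \<nu> = (\<Sum>\<kappa>\<in>B. f \<kappa> * meixner_value \<nu> \<kappa> * zweight \<kappa>) / meixner_norm \<nu>" for \<nu>
  define G where "G = (\<Sum>\<kappa>\<in>B. (f \<kappa>)\<^sup>2 * zweight \<kappa>)"
  have meixner_norm: "meixner_norm \<nu> \<noteq> 0" for \<nu> using meixner_norm_pos[of \<nu>] by simp
  have zweight: "zweight \<nu> \<noteq> 0" for \<nu> using zweight_pos[of \<nu>] by simp
  have "((\<lambda>\<nu>. \<Sum>\<kappa>\<in>B. \<Sum>\<kappa>'\<in>B. (f \<kappa> * zweight \<kappa>) * (f \<kappa>' * zweight \<kappa>') * (meixner_value \<nu> \<kappa> * meixner_value \<nu> \<kappa>' / meixner_norm \<nu>)) has_sum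
      (\<Sum>\<kappa>\<in>B. \<Sum>\<kappa>'\<in>B. (f \<kappa> * zweight \<kappa>) * (f \<kappa>' * zweight \<kappa>') * (of_bool (\<kappa> = \<kappa>') / zweight \<kappa>))) UNIV"
    by (intro has_sum_sum_finite B has_sum_cmult_right meixner_value_dual_orthogonal)
  also have "(\<lambda>\<nu>. \<Sum>\<kappa>\<in>B. \<Sum>\<kappa>'\<in>B. (f \<kappa> * zweight \<kappa>) * (f \<kappa>' * zweight \<kappa>') * (meixner_value \<nu> \<kappa> * meixner_value \<nu> \<kappa>' / meixner_norm \<nu>))
      = (\<lambda>\<nu>. (c \<nu>)\<^sup>2 * meixner_norm \<nu>)"
  proof
    fix \<nu>
    have "(c \<nu>)\<^sup>2 * meixner_norm \<nu> = (\<Sum>\<kappa>\<in>B. f \<kappa> * meixner_value \<nu> \<kappa> * zweight \<kappa>) * (\<Sum>\<kappa>\<in>B. f \<kappa> * meixner_value \<nu> \<kappa> * zweight \<kappa>) * (1 / meixner_norm \<nu>)"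
      using meixner_norm[of \<nu>] by (simp add: c_def power2_eq_square)
    also have "\<dots> = (\<Sum>\<kappa>\<in>B. \<Sum>\<kappa>'\<in>B. (f \<kappa> * meixner_value \<nu> \<kappa> * zweight \<kappa>) * (f \<kappa>' * meixner_value \<nu> \<kappa>' * zweight \<kappa>') * (1 / meixner_norm \<nu>))"
      by (subst sum_product) (simp only: sum_distrib_right)
    finally show "(\<Sum>\<kappa>\<in>B. \<Sum>\<kappa>'\<in>B. (f \<kappa> * zweight \<kappa>) * (f \<kappa>' * zweight \<kappa>') * (meixner_value \<nu> \<kappa> * meixner_value \<nu> \<kappa>' / meixner_norm \<nu>)) = (c \<nu>)\<^sup>2 * meixner_norm \<nu>"
      by (simp add: mult_ac)
  qed
  also have "(\<Sum>\<kappa>\<in>B. \<Sum>\<kappa>'\<in>B. (f \<kappa> * zweight \<kappa>) * (f \<kappa>' * zweight \<kappa>') * (of_bool (\<kappa> = \<kappa>') / zweight \<kappa>)) = G"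
    unfolding G_def
  proof (intro sum.cong refl)
    fix \<kappa> assume "\<kappa> \<in> B"
    have "(\<Sum>\<kappa>'\<in>B. (f \<kappa> * zweight \<kappa>) * (f \<kappa>' * zweight \<kappa>') * (of_bool (\<kappa> = \<kappa>') / zweight \<kappa>))
        = (\<Sum>\<kappa>'\<in>B. if \<kappa>' = \<kappa> then (f \<kappa>)\<^sup>2 * zweight \<kappa> else 0)"
      using zweight by (intro sum.cong) (auto simp: power2_eq_square)
    then show "(\<Sum>\<kappa>'\<in>B. (f \<kappa> * zweight \<kappa>) * (f \<kappa>' * zweight \<kappa>') * (of_bool (\<kappa> = \<kappa>') / zweight \<kappa>)) = (f \<kappa>)\<^sup>2 * zweight \<kappa>"
      using \<open>\<kappa> \<in> B\<close> B by simp
  qed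
  finally have parseval: "((\<lambda>\<nu>. (c \<nu>)\<^sup>2 * meixner_norm \<nu>) has_sum G) UNIV" .
  have "\<exists>A. finite A \<and> A \<subseteq> UNIV \<and> dist (\<Sum>\<nu>\<in>A. (c \<nu>)\<^sup>2 * meixner_norm \<nu>) G \<le> e / 2"
    by (rule has_sum_finite_approximation[OF parseval]) (use e in simp)
  then obtain A where A: "finite A" "dist (\<Sum>\<nu>\<in>A. (c \<nu>)\<^sup>2 * meixner_norm \<nu>) G \<le> e / 2" by blast
  define S where "S \<kappa> = (\<Sum>\<nu>\<in>A. c \<nu> * meixner_value \<nu> \<kappa>)" for \<kappa>
  have 1: "((\<lambda>\<kappa>. (g \<kappa>)\<^sup>2 * zweight \<kappa>) has_sum G) UNIV"
  proof (rule has_sum_finite_neutralI[of B])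
    show "G = (\<Sum>\<kappa>\<in>B. (g \<kappa>)\<^sup>2 * zweight \<kappa>)" unfolding G_def g_def by (intro sum.cong) auto
  qed (use B in \<open>auto simp: g_def\<close>)
  have 2: "((\<lambda>\<kappa>. g \<kappa> * S \<kappa> * zweight \<kappa>) has_sum (\<Sum>\<nu>\<in>A. (c \<nu>)\<^sup>2 * meixner_norm \<nu>)) UNIV"
  proof (rule has_sum_finite_neutralI[of B])
    have "(\<Sum>\<kappa>\<in>B. g \<kappa> * S \<kappa> * zweight \<kappa>) = (\<Sum>\<kappa>\<in>B. \<Sum>\<nu>\<in>A. c \<nu> * (f \<kappa> * meixner_value \<nu> \<kappa> * zweight \<kappa>))"
      by (intro sum.cong) (auto simp: g_def S_def sum_distrib_left sum_distrib_right mult_ac)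
    also have "\<dots> = (\<Sum>\<nu>\<in>A. c \<nu> * (c \<nu> * meixner_norm \<nu>))"
    proof -
      have "(\<Sum>\<kappa>\<in>B. f \<kappa> * meixner_value \<nu> \<kappa> * zweight \<kappa>) = c \<nu> * meixner_norm \<nu>" for \<nu> by (simp add: c_def meixner_norm)
      then show ?thesis by (subst sum.swap) (simp only: sum_distrib_left[symmetric])
    qed
    finally show "(\<Sum>\<nu>\<in>A. (c \<nu>)\<^sup>2 * meixner_norm \<nu>) = (\<Sum>\<kappa>\<in>B. g \<kappa> * S \<kappa> * zweight \<kappa>)"
      by (simp add: power2_eq_square mult.assoc)
  qed (use B in \<open>auto simp: g_def\<close>)
  have 3: "((\<lambda>\<kappa>. S \<kappa> * S \<kappa> * zweight \<kappa>) has_sum (\<Sum>\<nu>\<in>A. (c \<nu>)\<^sup>2 * meixner_norm \<nu>)) UNIV"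
  proof -
    have "((\<lambda>\<kappa>. \<Sum>\<nu>\<in>A. \<Sum>\<nu>'\<in>A. c \<nu> * c \<nu>' * (meixner_value \<nu> \<kappa> * meixner_value \<nu>' \<kappa> * zweight \<kappa>)) has_sum
        (\<Sum>\<nu>\<in>A. \<Sum>\<nu>'\<in>A. c \<nu> * c \<nu>' * (of_bool (\<nu> = \<nu>') * meixner_norm \<nu>))) UNIV"
      by (intro has_sum_sum_finite A has_sum_cmult_right meixner_value_orthogonal)
    also have "(\<lambda>\<kappa>. \<Sum>\<nu>\<in>A. \<Sum>\<nu>'\<in>A. c \<nu> * c \<nu>' * (meixner_value \<nu> \<kappa> * meixner_value \<nu>' \<kappa> * zweight \<kappa>)) = (\<lambda>\<kappa>. S \<kappa> * S \<kappa> * zweight \<kappa>)"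
    proof
      fix \<kappa>
      have "S \<kappa> * S \<kappa> * zweight \<kappa> = (\<Sum>\<nu>\<in>A. \<Sum>\<nu>'\<in>A. (c \<nu> * meixner_value \<nu> \<kappa>) * (c \<nu>' * meixner_value \<nu>' \<kappa>) * zweight \<kappa>)"
        unfolding S_def by (subst sum_product) (simp only: sum_distrib_right)
      then show "(\<Sum>\<nu>\<in>A. \<Sum>\<nu>'\<in>A. c \<nu> * c \<nu>' * (meixner_value \<nu> \<kappa> * meixner_value \<nu>' \<kappa> * zweight \<kappa>)) = S \<kappa> * S \<kappa> * zweight \<kappa>"
        by (simp only: mult_ac)
    qed
    also have "(\<Sum>\<nu>\<in>A. \<Sum>\<nu>'\<in>A. c \<nu> * c \<nu>' * (of_bool (\<nu> = \<nu>') * meixner_norm \<nu>)) = (\<Sum>\<nu>\<in>A. (c \<nu>)\<^sup>2 * meixner_norm \<nu>)"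
    proof (intro sum.cong refl)
      fix \<nu> assume "\<nu> \<in> A"
      have "(\<Sum>\<nu>'\<in>A. c \<nu> * c \<nu>' * (of_bool (\<nu> = \<nu>') * meixner_norm \<nu>)) = (\<Sum>\<nu>'\<in>A. if \<nu>' = \<nu> then (c \<nu>)\<^sup>2 * meixner_norm \<nu> else 0)"
        by (intro sum.cong) (auto simp: power2_eq_square)
      then show "(\<Sum>\<nu>'\<in>A. c \<nu> * c \<nu>' * (of_bool (\<nu> = \<nu>') * meixner_norm \<nu>)) = (c \<nu>)\<^sup>2 * meixner_norm \<nu>"
        using \<open>\<nu> \<in> A\<close> A(1) by simp
    qed
    finally show ?thesis .
  qed
  have "((\<lambda>\<kappa>. (g \<kappa>)\<^sup>2 * zweight \<kappa> + (- 2) * (g \<kappa> * S \<kappa> * zweight \<kappa>) + S \<kappa> * S \<kappa> * zweight \<kappa>) has_sum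
      (G + (- 2) * (\<Sum>\<nu>\<in>A. (c \<nu>)\<^sup>2 * meixner_norm \<nu>) + (\<Sum>\<nu>\<in>A. (c \<nu>)\<^sup>2 * meixner_norm \<nu>))) UNIV"
    by (intro has_sum_add has_sum_cmult_right 1 2 3)
  also have "(\<lambda>\<kappa>. (g \<kappa>)\<^sup>2 * zweight \<kappa> + (- 2) * (g \<kappa> * S \<kappa> * zweight \<kappa>) + S \<kappa> * S \<kappa> * zweight \<kappa>)
      = (\<lambda>\<kappa>. (g \<kappa> - S \<kappa>)\<^sup>2 * zweight \<kappa>)"
    by (auto simp: power2_eq_square algebra_simps)
  finally have "((\<lambda>\<kappa>. (g \<kappa> - S \<kappa>)\<^sup>2 * zweight \<kappa>) has_sum (G - (\<Sum>\<nu>\<in>A. (c \<nu>)\<^sup>2 * meixner_norm \<nu>))) UNIV" by simp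
  then have "(\<lambda>\<kappa>. (g \<kappa> - S \<kappa>)\<^sup>2 * zweight \<kappa>) summable_on UNIV"
    "infsum (\<lambda>\<kappa>. (g \<kappa> - S \<kappa>)\<^sup>2 * zweight \<kappa>) UNIV = G - (\<Sum>\<nu>\<in>A. (c \<nu>)\<^sup>2 * meixner_norm \<nu>)"
    by (auto simp: summable_on_def infsumI)
  moreover have "G - (\<Sum>\<nu>\<in>A. (c \<nu>)\<^sup>2 * meixner_norm \<nu>) < e"
    using diff_le_if_dist_le[OF A(2)] e by linarith
  ultimately show ?thesis using A(1) unfolding g_def S_def by (intro that[of A c]) auto
qed

theorem meixner_value_orthogonal_basis: "orthogonal_basis zweight meixner_value"
  unfolding orthogonal_basis_def
proof (intro conjI allI impI ballI)
  fix \<nu>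
  show "meixner_value \<nu> \<in> ell2 zweight" using meixner_value_square_summable by (simp add: ell2_def)
  show "ell2_norm zweight (meixner_value \<nu>) \<noteq> 0" using meixner_norm_pos[of \<nu>] by (simp add: ell2_norm_def ell2_inner_meixner_value)
next
  fix \<nu> \<nu>' :: young assume "\<nu> \<noteq> \<nu>'"
  then show "ell2_inner zweight (meixner_value \<nu>) (meixner_value \<nu>') = 0" by (simp add: ell2_inner_meixner_value)
next
  fix f and \<epsilon> :: real assume f: "f \<in> ell2 zweight" and "\<epsilon> > 0"
  define e where "e = \<epsilon>\<^sup>2 / 4"
  have e: "e > 0" using \<open>\<epsilon> > 0\<close> by (simp add: e_def)
  have sf: "(\<lambda>\<kappa>. (f \<kappa>)\<^sup>2 * zweight \<kappa>) summable_on UNIV" using f by (simp add: ell2_def)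
  define I where "I = infsum (\<lambda>\<kappa>. (f \<kappa>)\<^sup>2 * zweight \<kappa>) UNIV"
  have hf: "((\<lambda>\<kappa>. (f \<kappa>)\<^sup>2 * zweight \<kappa>) has_sum I) UNIV" unfolding I_def by (rule has_sum_infsum[OF sf])
  have "\<exists>B. finite B \<and> B \<subseteq> UNIV \<and> dist (\<Sum>\<kappa>\<in>B. (f \<kappa>)\<^sup>2 * zweight \<kappa>) I \<le> e / 2"
    by (rule has_sum_finite_approximation[OF hf]) (use e in simp)
  then obtain B where B: "finite B" "dist (\<Sum>\<kappa>\<in>B. (f \<kappa>)\<^sup>2 * zweight \<kappa>) I \<le> e / 2" by blast
  define g where "g \<kappa> = (if \<kappa> \<in> B then f \<kappa> else 0)" for \<kappa>
  obtain A c where A: "finite A" "(\<lambda>\<kappa>. (g \<kappa> - (\<Sum>\<nu>\<in>A. c \<nu> * meixner_value \<nu> \<kappa>))\<^sup>2 * zweight \<kappa>) summable_on UNIV"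
    "infsum (\<lambda>\<kappa>. (g \<kappa> - (\<Sum>\<nu>\<in>A. c \<nu> * meixner_value \<nu> \<kappa>))\<^sup>2 * zweight \<kappa>) UNIV < e"
    unfolding g_def using finite_support_approx[OF B(1) e, of f] by blast
  define S where "S \<kappa> = (\<Sum>\<nu>\<in>A. c \<nu> * meixner_value \<nu> \<kappa>)" for \<kappa>
  have "((\<lambda>\<kappa>. if \<kappa> \<in> B then (f \<kappa>)\<^sup>2 * zweight \<kappa> else 0) has_sum (\<Sum>\<kappa>\<in>B. (f \<kappa>)\<^sup>2 * zweight \<kappa>)) UNIV"
    using B(1) by (intro has_sum_finite_neutralI[of B]) auto
  then have "((\<lambda>\<kappa>. (f \<kappa>)\<^sup>2 * zweight \<kappa> + (- 1) * (if \<kappa> \<in> B then (f \<kappa>)\<^sup>2 * zweight \<kappa> else 0)) has_sum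
      (I + (- 1) * (\<Sum>\<kappa>\<in>B. (f \<kappa>)\<^sup>2 * zweight \<kappa>))) UNIV"
    by (intro has_sum_add has_sum_cmult_right hf)
  also have "(\<lambda>\<kappa>. (f \<kappa>)\<^sup>2 * zweight \<kappa> + (- 1) * (if \<kappa> \<in> B then (f \<kappa>)\<^sup>2 * zweight \<kappa> else 0))
      = (\<lambda>\<kappa>. (f \<kappa> - g \<kappa>)\<^sup>2 * zweight \<kappa>)"
    by (auto simp: g_def)
  finally have "((\<lambda>\<kappa>. (f \<kappa> - g \<kappa>)\<^sup>2 * zweight \<kappa>) has_sum (I - (\<Sum>\<kappa>\<in>B. (f \<kappa>)\<^sup>2 * zweight \<kappa>))) UNIV"
    by simp
  moreover have "((\<lambda>\<kappa>. (g \<kappa> - S \<kappa>)\<^sup>2 * zweight \<kappa>) has_sum infsum (\<lambda>\<kappa>. (g \<kappa> - S \<kappa>)\<^sup>2 * zweight \<kappa>) UNIV) UNIV"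
    unfolding S_def by (rule has_sum_infsum[OF A(2)])
  ultimately have bound: "((\<lambda>\<kappa>. 2 * ((f \<kappa> - g \<kappa>)\<^sup>2 * zweight \<kappa>) + 2 * ((g \<kappa> - S \<kappa>)\<^sup>2 * zweight \<kappa>)) has_sum
      (2 * (I - (\<Sum>\<kappa>\<in>B. (f \<kappa>)\<^sup>2 * zweight \<kappa>)) + 2 * infsum (\<lambda>\<kappa>. (g \<kappa> - S \<kappa>)\<^sup>2 * zweight \<kappa>) UNIV)) UNIV"
    by (intro has_sum_add has_sum_cmult_right)
  \<comment> \<open>The inequality \<open>(a + b)\<^sup>2 \<le> 2 a\<^sup>2 + 2 b\<^sup>2\<close> takes the place of the triangle inequality.\<close>
  have le: "(f \<kappa> - S \<kappa>) * (f \<kappa> - S \<kappa>) * zweight \<kappa> \<le> 2 * ((f \<kappa> - g \<kappa>)\<^sup>2 * zweight \<kappa>) + 2 * ((g \<kappa> - S \<kappa>)\<^sup>2 * zweight \<kappa>)" for \<kappa>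
  proof -
    have "(f \<kappa> - S \<kappa>) * (f \<kappa> - S \<kappa>) \<le> 2 * (f \<kappa> - g \<kappa>)\<^sup>2 + 2 * (g \<kappa> - S \<kappa>)\<^sup>2"
      using zero_le_power2[of "(f \<kappa> - g \<kappa>) - (g \<kappa> - S \<kappa>)"] by (simp add: power2_eq_square algebra_simps)
    from mult_right_mono[OF this zweight_nonneg[of \<kappa>]] show ?thesis by (simp add: algebra_simps)
  qed
  have "(\<lambda>\<kappa>. (f \<kappa> - S \<kappa>) * (f \<kappa> - S \<kappa>) * zweight \<kappa>) summable_on UNIV"
    using le zweight_nonneg bound
    by (intro summable_on_comparison_test[where g = "\<lambda>\<kappa>. (f \<kappa> - S \<kappa>) * (f \<kappa> - S \<kappa>) * zweight \<kappa>"
         and f = "\<lambda>\<kappa>. 2 * ((f \<kappa> - g \<kappa>)\<^sup>2 * zweight \<kappa>) + 2 * ((g \<kappa> - S \<kappa>)\<^sup>2 * zweight \<kappa>)"])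
       (auto simp: summable_on_def)
  then have "ell2_inner zweight (\<lambda>\<kappa>. f \<kappa> - S \<kappa>) (\<lambda>\<kappa>. f \<kappa> - S \<kappa>)
      \<le> 2 * (I - (\<Sum>\<kappa>\<in>B. (f \<kappa>)\<^sup>2 * zweight \<kappa>)) + 2 * infsum (\<lambda>\<kappa>. (g \<kappa> - S \<kappa>)\<^sup>2 * zweight \<kappa>) UNIV"
    unfolding ell2_inner_def by (intro has_sum_mono[OF has_sum_infsum bound] le)
  also have "\<dots> < 2 * e + 2 * e"
  proof -
    have "I - (\<Sum>\<kappa>\<in>B. (f \<kappa>)\<^sup>2 * zweight \<kappa>) \<le> e / 2" using B(2) by (rule diff_le_if_dist_le)
    moreover have "infsum (\<lambda>\<kappa>. (g \<kappa> - S \<kappa>)\<^sup>2 * zweight \<kappa>) UNIV < e" using A(3) by (simp only: S_def)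
    ultimately show ?thesis using e by argo
  qed
  also have "\<dots> = \<epsilon>\<^sup>2" by (simp add: e_def)
  finally have "ell2_norm zweight (\<lambda>\<kappa>. f \<kappa> - S \<kappa>) < sqrt (\<epsilon>\<^sup>2)"
    unfolding ell2_norm_def by (rule real_sqrt_less_mono)
  then have "ell2_norm zweight (\<lambda>\<kappa>. f \<kappa> - (\<Sum>\<nu>\<in>A. c \<nu> * meixner_value \<nu> \<kappa>)) < \<epsilon>"
    using \<open>\<epsilon> > 0\<close> by (simp add: S_def)
  then show "\<exists>A c. finite A \<and> ell2_norm zweight (\<lambda>x. f x - (\<Sum>i\<in>A. c i * meixner_value i x)) < \<epsilon>"
    using A(1) by blast
qed

end


section \<open>Evaluation of polynomials\<close>

lemma poly_mapping_eq_sum_single: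
  "F = (\<Sum>m\<in>Poly_Mapping.keys F. Poly_Mapping.single m (Poly_Mapping.lookup F m))"
  for F :: "'a \<Rightarrow>\<^sub>0 'b::comm_monoid_add"
proof (rule poly_mapping_eqI)
  fix k
  have "(\<Sum>m\<in>Poly_Mapping.keys F. Poly_Mapping.lookup (Poly_Mapping.single m (Poly_Mapping.lookup F m)) k)
      = (\<Sum>m\<in>Poly_Mapping.keys F. if m = k then Poly_Mapping.lookup F k else 0)"
    by (intro sum.cong) (auto simp: lookup_single when_def)
  also have "\<dots> = Poly_Mapping.lookup F k" by (simp add: in_keys_iff)
  finally show "Poly_Mapping.lookup F k = Poly_Mapping.lookup
      (\<Sum>m\<in>Poly_Mapping.keys F. Poly_Mapping.single m (Poly_Mapping.lookup F m)) k"
    by (simp add: lookup_sum)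
qed

text \<open>The value of the monomial with exponents \<open>m\<close>.\<close>

definition mono_eval :: "(nat \<Rightarrow> 'b::comm_semiring_1) \<Rightarrow> (nat \<Rightarrow>\<^sub>0 nat) \<Rightarrow> 'b" where
  "mono_eval x m = (\<Prod>i\<in>Poly_Mapping.keys m. x i ^ Poly_Mapping.lookup m i)"

lemma mono_eval_superset:
  "finite K \<Longrightarrow> Poly_Mapping.keys m \<subseteq> K \<Longrightarrow> mono_eval x m = (\<Prod>i\<in>K. x i ^ Poly_Mapping.lookup m i)"
  unfolding mono_eval_def by (rule prod.mono_neutral_left) (auto simp: in_keys_iff)

lemma mono_eval_0 [simp]: "mono_eval x 0 = 1"
  by (simp add: mono_eval_def)

lemma mono_eval_add: "mono_eval x (m + n) = mono_eval x m * mono_eval x n"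
proof -
  let ?K = "Poly_Mapping.keys m \<union> Poly_Mapping.keys n"
  have "mono_eval x (m + n) = (\<Prod>i\<in>?K. x i ^ Poly_Mapping.lookup (m + n) i)"
    using Poly_Mapping.keys_add[of m n] by (intro mono_eval_superset) auto
  also have "\<dots> = (\<Prod>i\<in>?K. x i ^ Poly_Mapping.lookup m i) * (\<Prod>i\<in>?K. x i ^ Poly_Mapping.lookup n i)"
    by (simp add: lookup_add power_add prod.distrib)
  also have "\<dots> = mono_eval x m * mono_eval x n"
    using mono_eval_superset[of ?K m x] mono_eval_superset[of ?K n x] by simp
  finally show ?thesis .
qed

lemma mono_eval_single: "mono_eval x (Poly_Mapping.single i k) = x i ^ k"
  by (simp add: mono_eval_def)

lemma mpoly_eval_eq: "mpoly_eval h x F = (\<Sum>m\<in>Poly_Mapping.keys F. h (Poly_Mapping.lookup F m) * mono_eval x m)"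
  by (simp add: mpoly_eval_def mono_eval_def)

context
  fixes h :: "'a::comm_semiring_1 \<Rightarrow> 'b::comm_semiring_1"
  assumes hom: "comm_semiring_hom h"
begin

interpretation comm_semiring_hom h by (fact hom)

lemma mpoly_eval_superset:
  "finite K \<Longrightarrow> Poly_Mapping.keys F \<subseteq> K \<Longrightarrow>
    mpoly_eval h x F = (\<Sum>m\<in>K. h (Poly_Mapping.lookup F m) * mono_eval x m)"
  unfolding mpoly_eval_eq by (rule sum.mono_neutral_left) (auto simp: in_keys_iff)

lemma mpoly_eval_0: "mpoly_eval h x 0 = 0"
  by (simp add: mpoly_eval_eq)

lemma mpoly_eval_add: "mpoly_eval h x (F + G) = mpoly_eval h x F + mpoly_eval h x G"
proof -
  let ?K = "Poly_Mapping.keys F \<union> Poly_Mapping.keys G"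
  have "mpoly_eval h x (F + G) = (\<Sum>m\<in>?K. h (Poly_Mapping.lookup (F + G) m) * mono_eval x m)"
    using Poly_Mapping.keys_add[of F G] by (intro mpoly_eval_superset) auto
  also have "\<dots> = (\<Sum>m\<in>?K. h (Poly_Mapping.lookup F m) * mono_eval x m)
      + (\<Sum>m\<in>?K. h (Poly_Mapping.lookup G m) * mono_eval x m)"
    by (simp add: lookup_add hom_add distrib_right sum.distrib)
  also have "\<dots> = mpoly_eval h x F + mpoly_eval h x G"
    using mpoly_eval_superset[of ?K F x] mpoly_eval_superset[of ?K G x] by simp
  finally show ?thesis .
qed

lemma mpoly_eval_single: "mpoly_eval h x (Poly_Mapping.single m c) = h c * mono_eval x m"
  by (simp add: mpoly_eval_eq)

lemma mpoly_eval_sum: "mpoly_eval h x (sum F A) = (\<Sum>a\<in>A. mpoly_eval h x (F a))"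
  by (induction A rule: infinite_finite_induct) (auto simp: mpoly_eval_0 mpoly_eval_add)

lemma mpoly_eval_mult: "mpoly_eval h x (F * G) = mpoly_eval h x F * mpoly_eval h x G"
proof -
  have "F * G = (\<Sum>m\<in>Poly_Mapping.keys F. \<Sum>n\<in>Poly_Mapping.keys G.
      Poly_Mapping.single (m + n) (Poly_Mapping.lookup F m * Poly_Mapping.lookup G n))"
    by (subst (1) poly_mapping_eq_sum_single[of F], subst (1) poly_mapping_eq_sum_single[of G])
       (simp add: sum_product mult_single)
  then have "mpoly_eval h x (F * G) = (\<Sum>m\<in>Poly_Mapping.keys F. \<Sum>n\<in>Poly_Mapping.keys G.
      (h (Poly_Mapping.lookup F m) * mono_eval x m) * (h (Poly_Mapping.lookup G n) * mono_eval x n))"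
    by (simp add: mpoly_eval_sum mpoly_eval_single hom_mult mono_eval_add mult_ac)
  then show ?thesis by (simp add: mpoly_eval_eq sum_product)
qed

lemma mpoly_eval_Const: "mpoly_eval h x (Const c) = h c"
  by (simp add: Const_def mpoly_eval_single)

lemma mpoly_eval_Var: "mpoly_eval h x (Var i) = x i"
  by (simp add: Var_def mpoly_eval_single mono_eval_single)

lemma mpoly_eval_1: "mpoly_eval h x 1 = 1"
  by (simp flip: single_one add: mpoly_eval_single)

lemma mpoly_eval_prod: "mpoly_eval h x (prod F A) = (\<Prod>a\<in>A. mpoly_eval h x (F a))"
  by (induction A rule: infinite_finite_induct) (auto simp: mpoly_eval_1 mpoly_eval_mult)

lemma mpoly_eval_power: "mpoly_eval h x (F ^ n) = mpoly_eval h x F ^ n"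
  by (induction n) (auto simp: mpoly_eval_1 mpoly_eval_mult)

lemma mpoly_eval_of_nat: "mpoly_eval h x (of_nat n) = of_nat n"
  by (induction n) (auto simp: mpoly_eval_0 mpoly_eval_1 mpoly_eval_add)

lemma mpoly_eval_compose:
  "mpoly_eval h x (mpoly_eval Const g F) = mpoly_eval h (\<lambda>k. mpoly_eval h x (g k)) F"
  unfolding mpoly_eval_def[of Const]
  by (simp add: mpoly_eval_sum mpoly_eval_mult mpoly_eval_Const mpoly_eval_prod mpoly_eval_power
      mpoly_eval_def[of h _ F])

end

lemma mpoly_eval_diff:
  fixes h :: "'a::comm_ring_1 \<Rightarrow> 'b::comm_ring_1"
  assumes "comm_semiring_hom h"
  shows "mpoly_eval h x (F - G) = mpoly_eval h x F - mpoly_eval h x G"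
  using mpoly_eval_add[OF assms, of x "F - G" G] by (simp add: algebra_simps)

lemma mono_eval_cong: "(\<And>i. i \<in> Poly_Mapping.keys m \<Longrightarrow> x i = y i) \<Longrightarrow> mono_eval x m = mono_eval y m"
  by (simp add: mono_eval_def)

lemma mpoly_eval_cong:
  "(\<And>m i. m \<in> Poly_Mapping.keys F \<Longrightarrow> i \<in> Poly_Mapping.keys m \<Longrightarrow> x i = y i) \<Longrightarrow> mpoly_eval h x F = mpoly_eval h y F"
  unfolding mpoly_eval_eq by (intro sum.cong refl arg_cong2[where f = "(*)"] mono_eval_cong) auto

lemma comm_semiring_hom_id: "comm_semiring_hom (\<lambda>c::'a::comm_semiring_1. c)"
  by unfold_locales auto

lemma comm_semiring_hom_Const: "comm_semiring_hom (Const :: 'a::comm_semiring_1 \<Rightarrow> _)"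
  by unfold_locales (auto simp: Const_def single_add mult_single)

lemma Const_0 [simp]: "Const 0 = 0"
  and Const_1 [simp]: "Const 1 = 1"
  by (simp_all add: Const_def)

lemma Const_add: "Const (a + b) = Const a + Const b"
  and Const_mult: "Const (a * b) = Const a * Const b"
  by (simp_all add: Const_def single_add mult_single)

text \<open>Evaluation of a real polynomial at a real point.\<close>

abbreviation reval :: "(nat \<Rightarrow> real) \<Rightarrow> real mpoly \<Rightarrow> real" where
  "reval \<equiv> mpoly_eval (\<lambda>c. c)"

lemmas reval_simps =
  mpoly_eval_0[OF comm_semiring_hom_id] mpoly_eval_1[OF comm_semiring_hom_id]
  mpoly_eval_add[OF comm_semiring_hom_id] mpoly_eval_diff[OF comm_semiring_hom_id]
  mpoly_eval_mult[OF comm_semiring_hom_id] mpoly_eval_sum[OF comm_semiring_hom_id]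
  mpoly_eval_prod[OF comm_semiring_hom_id] mpoly_eval_power[OF comm_semiring_hom_id]
  mpoly_eval_Const[OF comm_semiring_hom_id] mpoly_eval_Var[OF comm_semiring_hom_id]
  mpoly_eval_of_nat[OF comm_semiring_hom_id] mpoly_eval_compose[OF comm_semiring_hom_id]

text \<open>Uniqueness of the digits in base \<open>B\<close>, with the most significant digit first.\<close>

lemma digits_unique:
  fixes a b :: "nat \<Rightarrow> nat"
  assumes "\<forall>i<N. a i < B \<and> b i < B" "(\<Sum>i<N. a i * B ^ (N - i)) = (\<Sum>i<N. b i * B ^ (N - i))"
  shows "\<forall>i<N. a i = b i"
  using assms
proof (induction N)
  case (Suc N)
  have aN: "a N < B" "b N < B" using Suc.prems(1) by auto
  have split: "(\<Sum>i<Suc N. c i * B ^ (Suc N - i)) = B * ((\<Sum>i<N. c i * B ^ (N - i)) + c N)" for c :: "nat \<Rightarrow> nat"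
  proof -
    have "(\<Sum>i<N. c i * B ^ (Suc N - i)) = (\<Sum>i<N. B * (c i * B ^ (N - i)))"
      by (intro sum.cong) (auto simp: Suc_diff_le)
    then show ?thesis by (simp add: sum_distrib_left distrib_left)
  qed
  have dvd: "B dvd (\<Sum>i<N. c i * B ^ (N - i))" for c :: "nat \<Rightarrow> nat"
    by (intro dvd_sum dvd_mult) (auto intro: dvd_power)
  have eq: "(\<Sum>i<N. a i * B ^ (N - i)) + a N = (\<Sum>i<N. b i * B ^ (N - i)) + b N"
    using Suc.prems(2) aN unfolding split by simp
  have "a N mod B = b N mod B"
    using arg_cong[OF eq, of "\<lambda>x. x mod B"] dvd[of a] dvd[of b] by (auto elim!: dvdE)
  then have N: "a N = b N" using aN by simp
  then have "\<forall>i<N. a i = b i" using eq Suc.prems(1) by (intro Suc.IH) auto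
  then show ?case using N by (simp add: less_Suc_eq)
qed simp

lemma mpoly_variable_bound:
  obtains N where "\<And>m i. m \<in> Poly_Mapping.keys F \<Longrightarrow> i \<in> Poly_Mapping.keys m \<Longrightarrow> i < (N::nat)"
proof -
  have "finite (\<Union>m\<in>Poly_Mapping.keys F. Poly_Mapping.keys m)" by simp
  then obtain N where "\<forall>i\<in>(\<Union>m\<in>Poly_Mapping.keys F. Poly_Mapping.keys m). i < N"
    unfolding finite_nat_set_iff_bounded by blast
  then show ?thesis by (intro that[of N]) blast
qed

lemma mpoly_exponent_bound:
  fixes F :: "'a::zero mpoly"
  obtains B where "\<And>m i. m \<in> Poly_Mapping.keys F \<Longrightarrow> Poly_Mapping.lookup m i < (B::nat)"
proof -
  have "finite (insert 0 (\<Union>m\<in>Poly_Mapping.keys F. Poly_Mapping.lookup m ` Poly_Mapping.keys m))" by simp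
  then obtain B where B: "\<forall>k\<in>insert 0 (\<Union>m\<in>Poly_Mapping.keys F. Poly_Mapping.lookup m ` Poly_Mapping.keys m). k < B"
    unfolding finite_nat_set_iff_bounded by blast
  show ?thesis
  proof (rule that[of B])
    fix m i assume "m \<in> Poly_Mapping.keys F"
    then show "Poly_Mapping.lookup m i < B"
      using B by (cases "i \<in> Poly_Mapping.keys m") (auto simp: in_keys_iff)
  qed
qed

text \<open>A polynomial is determined by its values at strictly decreasing sequences of naturals. No bound on
  the variables of \<open>P\<close> is required, since the assumption leaves \<open>y i\<close> for \<open>i \<ge> N\<close> arbitrary.\<close>

lemma mpoly_eq_0_if_vanishing:
  fixes P :: "real mpoly"
  assumes vanish: "\<And>y :: nat \<Rightarrow> nat. (\<And>i j. i < j \<Longrightarrow> j < N \<Longrightarrow> y j < y i) \<Longrightarrow> reval (\<lambda>i. real (y i)) P = 0"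
  shows "P = 0"
proof (rule ccontr)
  assume "P \<noteq> 0"
  obtain N' where N': "\<And>m i. m \<in> Poly_Mapping.keys P \<Longrightarrow> i \<in> Poly_Mapping.keys m \<Longrightarrow> i < N'"
    using mpoly_variable_bound by blast
  obtain B' where B': "\<And>m i. m \<in> Poly_Mapping.keys P \<Longrightarrow> Poly_Mapping.lookup m i < B'"
    using mpoly_exponent_bound by blast
  define M where "M = max N N'"
  define B where "B = max B' 2"
  have M: "Poly_Mapping.keys m \<subseteq> {..<M}" if "m \<in> Poly_Mapping.keys P" for m
    using N'[OF that] by (auto simp: M_def less_max_iff_disj)
  have B: "Poly_Mapping.lookup m i < B" if "m \<in> Poly_Mapping.keys P" for m i
    using B'[OF that, of i] by (simp add: B_def)
  define e where "e m = (\<Sum>i<M. Poly_Mapping.lookup m i * B ^ (M - i))" for m :: "nat \<Rightarrow>\<^sub>0 nat"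
  have inj: "inj_on e (Poly_Mapping.keys P)"
  proof (rule inj_onI)
    fix m m' assume mm: "m \<in> Poly_Mapping.keys P" "m' \<in> Poly_Mapping.keys P" "e m = e m'"
    have "\<forall>i<M. Poly_Mapping.lookup m i = Poly_Mapping.lookup m' i"
      using mm B by (intro digits_unique[of _ _ B]) (auto simp: e_def)
    moreover have "Poly_Mapping.lookup m i = Poly_Mapping.lookup m' i" if "\<not> i < M" for i
      using M[OF mm(1)] M[OF mm(2)] that by (metis in_keys_iff lessThan_iff subsetD)
    ultimately show "m = m'" by (intro poly_mapping_eqI) blast
  qed
  define Q where "Q = (\<Sum>m\<in>Poly_Mapping.keys P. Polynomial.monom (Poly_Mapping.lookup P m) (e m))"
  have root: "poly Q (real t) = 0" if t: "t \<ge> 2" for t :: nat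
  proof -
    \<comment> \<open>Kronecker substitution: distinct monomials become distinct powers of \<open>t\<close>.\<close>
    define y where "y i = t ^ (B ^ (M - i))" for i
    have "y j < y i" if "i < j" "j < M" for i j
      using that t by (auto simp: y_def B_def intro!: power_strict_increasing)
    then have "reval (\<lambda>i. real (y i)) P = 0"
      by (intro vanish) (auto simp: M_def less_max_iff_disj)
    also have "reval (\<lambda>i. real (y i)) P = poly Q (real t)"
      unfolding mpoly_eval_eq Q_def poly_sum
    proof (intro sum.cong refl)
      fix m assume m: "m \<in> Poly_Mapping.keys P"
      have "mono_eval (\<lambda>i. real (y i)) m = (\<Prod>i<M. real (y i) ^ Poly_Mapping.lookup m i)"
        using M[OF m] by (intro mono_eval_superset) auto
      also have "\<dots> = real t ^ e m"
        by (simp add: y_def e_def power_sum mult.commute flip: power_mult)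
      finally show "Poly_Mapping.lookup P m * mono_eval (\<lambda>i. real (y i)) m
          = poly (Polynomial.monom (Poly_Mapping.lookup P m) (e m)) (real t)"
        by (simp add: poly_monom)
    qed
    finally show ?thesis .
  qed
  have "Q = 0"
  proof (rule ccontr)
    assume "Q \<noteq> 0"
    then have "finite {x. poly Q x = 0}" by (rule poly_roots_finite)
    moreover have "real ` {2..} \<subseteq> {x. poly Q x = 0}" using root by auto
    ultimately have "finite (real ` {2::nat..})" by (rule finite_subset[rotated])
    then have "finite {2::nat..}" by (rule finite_imageD) simp
    then show False by (simp add: infinite_Ici)
  qed
  obtain m where m: "m \<in> Poly_Mapping.keys P"
    using \<open>P \<noteq> 0\<close> by (metis ex_in_conv keys_eq_empty)
  have "coeff Q (e m) = (\<Sum>m'\<in>Poly_Mapping.keys P. if m' = m then Poly_Mapping.lookup P m else 0)"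
    unfolding Q_def coeff_sum using inj m by (intro sum.cong) (auto simp: inj_on_def)
  also have "\<dots> = Poly_Mapping.lookup P m" using m by simp
  finally show False using \<open>Q = 0\<close> m by (simp add: in_keys_iff)
qed

text \<open>Along any line a polynomial is a univariate polynomial, with a degree bound that does not depend on
  the line.\<close>

lemma mpoly_eval_line:
  fixes F :: "real mpoly"
  obtains D where "\<And>a b. \<exists>p. degree p \<le> D \<and> (\<forall>c. poly p c = reval (\<lambda>k. a k + c * b k) F)"
proof
  define D where "D = (\<Sum>m\<in>Poly_Mapping.keys F. \<Sum>i\<in>Poly_Mapping.keys m. Poly_Mapping.lookup m i)"
  fix a b :: "nat \<Rightarrow> real"
  define p where "p = mpoly_eval (\<lambda>c. [:c:]) (\<lambda>k. [:a k, b k:]) F"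
  have "degree p \<le> D"
    unfolding p_def mpoly_eval_eq
  proof (intro degree_sum_le finite_keys)
    fix m assume m: "m \<in> Poly_Mapping.keys F"
    have "degree ([:Poly_Mapping.lookup F m:] * mono_eval (\<lambda>k. [:a k, b k:]) m)
        \<le> degree (mono_eval (\<lambda>k. [:a k, b k:]) m)"
      using degree_mult_le[of "[:Poly_Mapping.lookup F m:]" "mono_eval (\<lambda>k. [:a k, b k:]) m"] by simp
    also have "\<dots> \<le> (\<Sum>i\<in>Poly_Mapping.keys m. degree ([:a i, b i:] ^ Poly_Mapping.lookup m i))"
      unfolding mono_eval_def using degree_prod_sum_le[of "Poly_Mapping.keys m" "\<lambda>i. [:a i, b i:] ^ Poly_Mapping.lookup m i"]
      by (simp add: o_def)
    also have "\<dots> \<le> (\<Sum>i\<in>Poly_Mapping.keys m. Poly_Mapping.lookup m i)"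
    proof (rule sum_mono)
      fix i
      have "degree ([:a i, b i:] ^ Poly_Mapping.lookup m i) \<le> degree [:a i, b i:] * Poly_Mapping.lookup m i"
        by (rule degree_power_le)
      also have "\<dots> \<le> 1 * Poly_Mapping.lookup m i" by (intro mult_right_mono) auto
      finally show "degree ([:a i, b i:] ^ Poly_Mapping.lookup m i) \<le> Poly_Mapping.lookup m i" by simp
    qed
    also have "\<dots> \<le> D" unfolding D_def using m by (intro member_le_sum) auto
    finally show "degree ([:Poly_Mapping.lookup F m:] * mono_eval (\<lambda>k. [:a k, b k:]) m) \<le> D" .
  qed
  moreover have "poly p c = reval (\<lambda>k. a k + c * b k) F" for c
    by (simp add: p_def mpoly_eval_eq mono_eval_def poly_sum poly_prod poly_power)
  ultimately show "\<exists>p. degree p \<le> D \<and> (\<forall>c. poly p c = reval (\<lambda>k. a k + c * b k) F)" by blast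
qed


section \<open>Symmetric functions as functions on diagrams\<close>

lemma in_boxes_iff: "(i, j) \<in> boxes \<kappa> \<longleftrightarrow> j < yrow \<kappa> i"
  by (simp add: boxes_def)

lemma boxes_iff_ycol: "(i, j) \<in> boxes \<kappa> \<longleftrightarrow> i < ycol \<kappa> j"
proof -
  have "{i. (i, j) \<in> boxes \<kappa>} = {..<ycol \<kappa> j}"
    unfolding ycol_def
  proof (rule downset_nat_eq_lessThan_card)
    show "finite {i. (i, j) \<in> boxes \<kappa>}"
      by (rule finite_subset[of _ "fst ` boxes \<kappa>"]) force+
    show "i' \<in> {i. (i, j) \<in> boxes \<kappa>}" if "i \<in> {i. (i, j) \<in> boxes \<kappa>}" "i' \<le> i" for i i'
      using that yrow_antimono[of i' i \<kappa>] by (auto simp: in_boxes_iff)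
  qed
  then show ?thesis by blast
qed

lemma diag_boxes_iff: "(i, i) \<in> boxes \<kappa> \<longleftrightarrow> i < diag_length \<kappa>"
proof -
  have "{i. (i, i) \<in> boxes \<kappa>} = {..<diag_length \<kappa>}"
    unfolding diag_length_def
  proof (rule downset_nat_eq_lessThan_card)
    show "finite {i. (i, i) \<in> boxes \<kappa>}"
      by (rule finite_subset[of _ "fst ` boxes \<kappa>"]) force+
    show "i' \<in> {i. (i, i) \<in> boxes \<kappa>}" if "i \<in> {i. (i, i) \<in> boxes \<kappa>}" "i' \<le> i" for i i'
      using that yrow_antimono[of i' i \<kappa>] by (auto simp: in_boxes_iff)
  qed
  then show ?thesis by blast
qed

text \<open>Summation of a difference over the contents of all boxes, row by row, and in the next lemma hook by
  hook. The comparison of both expresses power sums of Frobenius coordinates in terms of rows.\<close>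

lemma content_telescope_rows:
  fixes G :: "real \<Rightarrow> real"
  assumes "ylength \<kappa> \<le> N"
  shows "(\<Sum>(i, j)\<in>boxes \<kappa>. G (real j - real i + 1) - G (real j - real i))
    = (\<Sum>i<N. G (real (yrow \<kappa> i) - real i) - G (- real i))"
proof -
  have "(\<Sum>(i, j)\<in>boxes \<kappa>. G (real j - real i + 1) - G (real j - real i))
      = (\<Sum>i<N. \<Sum>j<yrow \<kappa> i. G (real j - real i + 1) - G (real j - real i))"
    unfolding boxes_eq_Sigma[OF assms] by (subst sum.Sigma) auto
  also have "\<dots> = (\<Sum>i<N. G (real (yrow \<kappa> i) - real i) - G (- real i))"
  proof (intro sum.cong refl)
    fix i
    have "(\<Sum>j<yrow \<kappa> i. G (real j - real i + 1) - G (real j - real i))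
        = (\<Sum>j<yrow \<kappa> i. G (real (Suc j) - real i) - G (real j - real i))"
      by (intro sum.cong) (auto simp: algebra_simps)
    also have "\<dots> = G (real (yrow \<kappa> i) - real i) - G (real 0 - real i)"
      by (rule sum_lessThan_telescope)
    finally show "(\<Sum>j<yrow \<kappa> i. G (real j - real i + 1) - G (real j - real i))
        = G (real (yrow \<kappa> i) - real i) - G (- real i)" by simp
  qed
  finally show ?thesis .
qed

lemma content_telescope_hooks:
  fixes G :: "real \<Rightarrow> real"
  shows "(\<Sum>(i, j)\<in>boxes \<kappa>. G (real j - real i + 1) - G (real j - real i))
    = (\<Sum>i<diag_length \<kappa>. G (real (yrow \<kappa> i) - real i) - G (real i - real (ycol \<kappa> i) + 1))"
proof -
  define d where "d = diag_length \<kappa>"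
  define H where "H i j = G (real j - real i + 1) - G (real j - real i)" for i j :: nat
  define A where "A = (SIGMA i:{..<d}. {i..<yrow \<kappa> i})"
  define B where "B = prod.swap ` (SIGMA j:{..<d}. {Suc j..<ycol \<kappa> j})"
  have diag: "i < yrow \<kappa> i \<longleftrightarrow> i < d" for i
    using diag_boxes_iff[of i \<kappa>] by (simp add: in_boxes_iff d_def)
  have "boxes \<kappa> = A \<union> B"
  proof (intro equalityI subsetI)
    fix x assume "x \<in> boxes \<kappa>"
    then obtain i j where x: "x = (i, j)" "j < yrow \<kappa> i" by (cases x) (auto simp: in_boxes_iff)
    show "x \<in> A \<union> B"
    proof (cases "i \<le> j")
      case True
      then have "i < d" using x(2) by (simp flip: diag)
      then show ?thesis using True x by (auto simp: A_def)
    next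
      case False
      then have "j < yrow \<kappa> j" using x(2) yrow_antimono[of j i \<kappa>] by simp
      then have "j < d" by (simp add: diag)
      moreover have "i < ycol \<kappa> j" using x by (simp flip: boxes_iff_ycol add: in_boxes_iff)
      ultimately have "(j, i) \<in> (SIGMA j:{..<d}. {Suc j..<ycol \<kappa> j})" using False by auto
      then show ?thesis by (force simp: B_def x)
    qed
  next
    fix x assume "x \<in> A \<union> B"
    then show "x \<in> boxes \<kappa>"
      by (auto simp: A_def B_def in_boxes_iff) (simp flip: boxes_iff_ycol in_boxes_iff)
  qed
  moreover have "A \<inter> B = {}" by (auto simp: A_def B_def)
  moreover have "finite A" "finite B" by (auto simp: A_def B_def)
  ultimately have "(\<Sum>(i, j)\<in>boxes \<kappa>. H i j) = (\<Sum>(i, j)\<in>A. H i j) + (\<Sum>(i, j)\<in>B. H i j)"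
    by (simp add: sum.union_disjoint)
  also have "(\<Sum>(i, j)\<in>A. H i j) = (\<Sum>i<d. \<Sum>j\<in>{i..<yrow \<kappa> i}. H i j)"
    unfolding A_def by (subst sum.Sigma) auto
  also have "\<dots> = (\<Sum>i<d. G (real (yrow \<kappa> i) - real i) - G 0)"
  proof (intro sum.cong refl)
    fix i assume "i \<in> {..<d}"
    then have le: "i \<le> yrow \<kappa> i" using diag[of i] by simp
    have "(\<Sum>j\<in>{i..<yrow \<kappa> i}. H i j) = (\<Sum>j\<in>{i..<yrow \<kappa> i}. G (real (Suc j) - real i) - G (real j - real i))"
      by (intro sum.cong) (auto simp: H_def algebra_simps)
    also have "\<dots> = G (real (yrow \<kappa> i) - real i) - G (real i - real i)"
      by (rule sum_Suc_diff'[OF le])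
    finally show "(\<Sum>j\<in>{i..<yrow \<kappa> i}. H i j) = G (real (yrow \<kappa> i) - real i) - G 0" by simp
  qed
  also have "(\<Sum>(i, j)\<in>B. H i j) = (\<Sum>j<d. \<Sum>i\<in>{Suc j..<ycol \<kappa> j}. H i j)"
  proof -
    have "(\<Sum>(i, j)\<in>B. H i j) = (\<Sum>(j, i)\<in>(SIGMA j:{..<d}. {Suc j..<ycol \<kappa> j}). H i j)"
      unfolding B_def by (subst sum.reindex) (auto simp: case_prod_beta)
    then show ?thesis by (subst sum.Sigma) auto
  qed
  also have "\<dots> = (\<Sum>j<d. G 0 - G (real j - real (ycol \<kappa> j) + 1))"
  proof (intro sum.cong refl)
    fix j assume "j \<in> {..<d}"
    then have le: "Suc j \<le> ycol \<kappa> j"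
      using diag_boxes_iff[of j \<kappa>] boxes_iff_ycol[of j j \<kappa>] by (simp add: d_def)
    define g where "g i = - G (real j - real i + 1)" for i :: nat
    have "(\<Sum>i\<in>{Suc j..<ycol \<kappa> j}. H i j) = (\<Sum>i\<in>{Suc j..<ycol \<kappa> j}. g (Suc i) - g i)"
      by (intro sum.cong) (auto simp: H_def g_def algebra_simps)
    also have "\<dots> = g (ycol \<kappa> j) - g (Suc j)"
      by (rule sum_Suc_diff'[OF le])
    finally show "(\<Sum>i\<in>{Suc j..<ycol \<kappa> j}. H i j) = G 0 - G (real j - real (ycol \<kappa> j) + 1)"
      by (simp add: g_def)
  qed
  finally show ?thesis by (simp add: H_def d_def sum_subtractf)
qed

lemma power_sum_rows:
  assumes "ylength \<kappa> \<le> N"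
  shows "power_sum k \<kappa> = (\<Sum>i<N. (real (yrow \<kappa> i) - (real i + 1/2)) ^ k - (- (real i + 1/2)) ^ k)"
proof -
  define G where "G x = (x - 1/2) ^ k" for x :: real
  have "power_sum k \<kappa> = (\<Sum>i<diag_length \<kappa>. G (real (yrow \<kappa> i) - real i) - G (real i - real (ycol \<kappa> i) + 1))"
    unfolding power_sum_def
  proof (intro sum.cong refl)
    fix i
    have "- (real (ycol \<kappa> i) - real i - 1/2) = real i - real (ycol \<kappa> i) + 1 - 1/2" by simp
    then show "(real (yrow \<kappa> i) - real i - 1/2) ^ k - (- (real (ycol \<kappa> i) - real i - 1/2)) ^ k
        = G (real (yrow \<kappa> i) - real i) - G (real i - real (ycol \<kappa> i) + 1)"
      unfolding G_def by (simp only:)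
  qed
  also have "\<dots> = (\<Sum>i<N. G (real (yrow \<kappa> i) - real i) - G (- real i))"
    by (simp only: content_telescope_rows[OF assms] flip: content_telescope_hooks)
  also have "\<dots> = (\<Sum>i<N. (real (yrow \<kappa> i) - (real i + 1/2)) ^ k - (- (real i + 1/2)) ^ k)"
  proof (intro sum.cong refl)
    fix i
    have "real (yrow \<kappa> i) - real i - 1/2 = real (yrow \<kappa> i) - (real i + 1/2)"
      "- real i - 1/2 = - (real i + 1/2)" by simp_all
    then show "G (real (yrow \<kappa> i) - real i) - G (- real i)
        = (real (yrow \<kappa> i) - (real i + 1/2)) ^ k - (- (real i + 1/2)) ^ k"
      unfolding G_def by (simp only:)
  qed
  finally show ?thesis .
qed

text \<open>The shifted power sum \<open>p\<^sup>*\<^bsub>k+1\<^esub>\<close> in \<open>N\<close> variables.\<close>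

definition row_power_sum :: "nat \<Rightarrow> (nat \<Rightarrow> real) \<Rightarrow> nat \<Rightarrow> real" where
  "row_power_sum N x k = (\<Sum>i<N. (x i - (real i + 1/2)) ^ Suc k - (- (real i + 1/2)) ^ Suc k)"

lemma reval_sym_to_shifted: "reval x (sym_to_shifted F N) = reval (row_power_sum N x) F"
  unfolding sym_to_shifted_def
  by (simp add: reval_simps shifted_power_sum_def row_power_sum_def[abs_def] del: power_Suc)

lemma realize_rows:
  assumes "ylength \<kappa> \<le> N"
  shows "realize F \<kappa> = reval (row_power_sum N (\<lambda>i. real (yrow \<kappa> i))) F"
  unfolding realize_def row_power_sum_def[abs_def] power_sum_rows[OF assms] ..

lemma young_of_rows:
  assumes "\<And>i j. i \<le> j \<Longrightarrow> j < N \<Longrightarrow> y j \<le> (y i :: nat)"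
  obtains \<kappa> where "ylength \<kappa> \<le> N" "\<And>i. i < N \<Longrightarrow> yrow \<kappa> i = y i"
proof
  define f where "f i = (if i < N then y i else 0)" for i
  have "antimono f" unfolding antimono_def f_def using assms by auto
  moreover have "finite {i. f i \<noteq> 0}" by (rule finite_subset[of _ "{..<N}"]) (auto simp: f_def)
  ultimately have f: "yrow (Young f) = f" by (intro Young_inverse) simp
  show "ylength (Young f) \<le> N" by (simp add: f f_def flip: yrow_eq_0_iff)
  show "yrow (Young f) i = y i" if "i < N" for i using that by (simp add: f f_def)
qed

lemma sym_to_shifted_eq_0:
  assumes "\<And>\<kappa>. ylength \<kappa> \<le> N \<Longrightarrow> realize F \<kappa> = 0"
  shows "sym_to_shifted F N = 0"
proof (rule mpoly_eq_0_if_vanishing[of N])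
  fix y :: "nat \<Rightarrow> nat" assume y: "\<And>i j. i < j \<Longrightarrow> j < N \<Longrightarrow> y j < y i"
  obtain \<kappa> where \<kappa>: "ylength \<kappa> \<le> N" "\<And>i. i < N \<Longrightarrow> yrow \<kappa> i = y i"
  proof -
    have "y j \<le> y i" if "i \<le> j" "j < N" for i j using y[of i j] that by (cases "i = j") auto
    then show thesis using young_of_rows[of N y] that by blast
  qed
  have "row_power_sum N (\<lambda>i. real (y i)) = row_power_sum N (\<lambda>i. real (yrow \<kappa> i))"
    unfolding row_power_sum_def using \<kappa>(2) by (intro ext sum.cong) auto
  then show "reval (\<lambda>i. real (y i)) (sym_to_shifted F N) = 0"
    using assms[OF \<kappa>(1)] realize_rows[OF \<kappa>(1)] by (simp add: reval_sym_to_shifted)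
qed

text \<open>For a square matrix, injectivity implies surjectivity.\<close>

lemma square_system_solvable:
  fixes A :: "'a \<Rightarrow> 'a \<Rightarrow> real"
  assumes fin: "finite Y"
    and inj: "\<forall>u. (\<forall>y\<in>Y. (\<Sum>x\<in>Y. u x * A x y) = 0) \<longrightarrow> (\<forall>x\<in>Y. u x = 0)"
  obtains u where "\<And>y. y \<in> Y \<Longrightarrow> (\<Sum>x\<in>Y. u x * A x y) = f y"
proof -
  obtain h where h: "bij_betw h {0..<card Y} Y" using ex_bij_betw_nat_finite[OF fin] by blast
  define N where "N = card Y"
  define g where "g = the_inv_into {0..<N} h"
  have gh: "g (h i) = i" if "i < N" for i
    unfolding g_def using h that by (intro the_inv_into_f_f) (auto simp: bij_betw_def N_def)
  have sum_h: "(\<Sum>x\<in>Y. \<phi> x) = (\<Sum>i\<in>{0..<N}. \<phi> (h i))" for \<phi> :: "'a \<Rightarrow> real"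
    using sum.reindex_bij_betw[OF h, of \<phi>] by (simp add: N_def)
  have hY: "y \<in> Y \<Longrightarrow> \<exists>i<N. y = h i" for y using h unfolding bij_betw_def N_def by (metis atLeastLessThan_iff imageE)
  have hY': "i < N \<Longrightarrow> h i \<in> Y" for i using h by (auto simp: bij_betw_def N_def)
  define M where "M = Matrix.mat N N (\<lambda>(j, i). A (h i) (h j))"
  have M: "M \<in> carrier_mat N N" by (simp add: M_def)
  have mult: "vec_index (M *\<^sub>v v) j = (\<Sum>i\<in>{0..<N}. vec_index v i * A (h i) (h j))" if "j < N" "v \<in> carrier_vec N" for v j
    using that by (simp add: scalar_prod_def M_def mult.commute)
  have "Determinant.det M \<noteq> 0"
  proof
    assume "Determinant.det M = 0"
    then obtain v where v: "v \<in> carrier_vec N" "v \<noteq> 0\<^sub>v N" "M *\<^sub>v v = 0\<^sub>v N"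
      using det_0_iff_vec_prod_zero[OF M] by blast
    have "vec_index v (g x) = 0" if "x \<in> Y" for x
    proof (rule inj[rule_format, OF _ that])
      fix y assume "y \<in> Y"
      then obtain j where j: "j < N" "y = h j" using hY by blast
      have "(\<Sum>i\<in>{0..<N}. vec_index v (g (h i)) * A (h i) (h j)) = (\<Sum>i\<in>{0..<N}. vec_index v i * A (h i) (h j))"
        by (intro sum.cong) (auto simp: gh)
      also have "\<dots> = 0" using mult[OF j(1) v(1)] v(3) j(1) by simp
      finally show "(\<Sum>x\<in>Y. vec_index v (g x) * A x y) = 0" by (simp add: sum_h j)
    qed
    then have "vec_index v i = 0" if "i < N" for i using hY'[OF that] gh[OF that] by force
    then have "v = 0\<^sub>v N" using v(1) by (intro eq_vecI) auto
    then show False using v(2) by simp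
  qed
  then obtain B where B: "B \<in> carrier_mat N N" "M * B = 1\<^sub>m N"
    using det_non_zero_imp_unit[OF M, of "()"] unfolding Units_def by (auto simp: ring_mat_def)
  define v where "v = B *\<^sub>v Matrix.vec N (\<lambda>j. f (h j))"
  have v: "v \<in> carrier_vec N" using B by (simp add: v_def)
  have "M *\<^sub>v v = (M * B) *\<^sub>v Matrix.vec N (\<lambda>j. f (h j))"
    unfolding v_def by (rule assoc_mult_mat_vec[symmetric, OF M B(1)]) simp
  then have Mv: "M *\<^sub>v v = Matrix.vec N (\<lambda>j. f (h j))" using B by simp
  show ?thesis
  proof (rule that[of "\<lambda>x. vec_index v (g x)"])
    fix y assume "y \<in> Y"
    then obtain j where j: "j < N" "y = h j" using hY by blast
    have "(\<Sum>i\<in>{0..<N}. vec_index v (g (h i)) * A (h i) (h j)) = (\<Sum>i\<in>{0..<N}. vec_index v i * A (h i) (h j))"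
      by (intro sum.cong) (auto simp: gh)
    also have "\<dots> = f y" using mult[OF j(1) v] Mv j by simp
    finally show "(\<Sum>x\<in>Y. vec_index v (g x) * A x y) = f y" by (simp add: sum_h j)
  qed
qed

text \<open>Power sums of the points \<open>1, \<dots>, n\<close> with suitable real multiplicities take arbitrary values.\<close>

lemma vandermonde_system_solvable:
  fixes v :: "nat \<Rightarrow> real"
  obtains c where "\<And>k. k < n \<Longrightarrow> (\<Sum>i<n. c i * real (Suc i) ^ Suc k) = v k"
proof -
  have inj: "\<forall>u. (\<forall>k\<in>{..<n}. (\<Sum>i<n. u i * real (Suc i) ^ Suc k) = 0) \<longrightarrow> (\<forall>j\<in>{..<n}. u j = 0)"
  proof (intro allI impI ballI)
    fix u :: "nat \<Rightarrow> real" and j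
    assume u: "\<forall>k\<in>{..<n}. (\<Sum>i<n. u i * real (Suc i) ^ Suc k) = 0" and j: "j \<in> {..<n}"
    define p where "p = [:0, 1:] * (\<Prod>i\<in>{..<n}-{j}. [:- real (Suc i), 1:])"
    have "degree (\<Prod>i\<in>{..<n}-{j}. [:- real (Suc i), 1:]) = n - 1"
      using j by (subst degree_prod_eq_sum_degree) auto
    then have deg: "degree p \<le> n"
      unfolding p_def using j degree_mult_le[of "[:0, 1:]" "\<Prod>i\<in>{..<n}-{j}. [:- real (Suc i), 1:]"] by auto
    have p0: "coeff p 0 = 0" by (simp add: p_def flip: poly_0_coeff_0)
    have "(\<Sum>i<n. u i * poly p (real (Suc i))) = (\<Sum>i<n. \<Sum>k\<le>n. coeff p k * (u i * real (Suc i) ^ k))"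
    proof -
      have "poly p x = (\<Sum>k\<le>n. coeff p k * x ^ k)" for x
        unfolding poly_altdef by (rule sum.mono_neutral_left) (use deg in \<open>auto simp: coeff_eq_0\<close>)
      then show ?thesis by (simp add: sum_distrib_left mult_ac del: of_nat_Suc)
    qed
    also have "\<dots> = (\<Sum>k\<le>n. coeff p k * (\<Sum>i<n. u i * real (Suc i) ^ k))"
      by (subst sum.swap) (simp only: sum_distrib_left)
    also have "\<dots> = 0"
    proof (intro sum.neutral ballI)
      fix k assume "k \<in> {..n}"
      then show "coeff p k * (\<Sum>i<n. u i * real (Suc i) ^ k) = 0"
        using p0 u by (cases k) auto
    qed
    finally have "(\<Sum>i<n. u i * poly p (real (Suc i))) = 0" .
    moreover have "(\<Sum>i<n. u i * poly p (real (Suc i))) = (\<Sum>i<n. if i = j then u j * poly p (real (Suc j)) else 0)"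
    proof (intro sum.cong refl)
      fix i assume i: "i \<in> {..<n}"
      have "poly p (real (Suc i)) = 0" if "i \<noteq> j"
        using i that by (auto simp: p_def poly_prod intro!: prod_zero)
      then show "u i * poly p (real (Suc i)) = (if i = j then u j * poly p (real (Suc j)) else 0)" by auto
    qed
    moreover have "poly p (real (Suc j)) \<noteq> 0" by (auto simp: p_def poly_prod)
    ultimately show "u j = 0" using j by simp
  qed
  obtain c where "\<And>k. k \<in> {..<n} \<Longrightarrow> (\<Sum>i<n. c i * real (Suc i) ^ Suc k) = v k"
    using square_system_solvable[where Y = "{..<n}" and A = "\<lambda>i k. real (Suc i) ^ Suc k" and f = v, OF _ inj] by auto
  then show ?thesis by (intro that[of c]) simp
qed

text \<open>The power sums are algebraically independent as functions on diagrams. The vanishing of \<open>F\<close> on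
  diagrams extends to the power sums of arbitrary real points \<open>u\<^sub>0, \<dots>, u\<^bsub>N-1\<^esub>\<close>, up to a constant
  vector \<open>b\<close>. Letting the points \<open>1, \<dots>, n\<close> occur among the \<open>u\<^sub>l\<close> with multiplicities \<open>c\<^sub>i \<le> D\<close>, and the
  point 0 otherwise, makes the power sums linear in \<open>c\<close>; a polynomial of degree at most \<open>D\<close> in
  each \<open>c\<^sub>i\<close> with these zeros vanishes for all real \<open>c\<close>, and hence \<open>F\<close> vanishes everywhere.\<close>

lemma realize_eq_0:
  assumes "\<And>\<kappa>. realize F \<kappa> = 0"
  shows "F = 0"
proof -
  obtain n where n: "\<And>m i. m \<in> Poly_Mapping.keys F \<Longrightarrow> i \<in> Poly_Mapping.keys m \<Longrightarrow> i < n"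
    using mpoly_variable_bound by blast
  obtain D where D: "\<And>a b. \<exists>p. degree p \<le> D \<and> (\<forall>c. poly p c = reval (\<lambda>k. a k + c * b k) F)"
    using mpoly_eval_line by blast
  define N where "N = n * D"
  define b where "b k = (\<Sum>i<N. (- (real i + 1/2)) ^ Suc k)" for k
  define pt where "pt c k = (\<Sum>i<n. c i * real (Suc i) ^ Suc k) - b k" for c :: "nat \<Rightarrow> real" and k
  have "sym_to_shifted F N = 0" using assms by (intro sym_to_shifted_eq_0)
  then have zero: "reval (row_power_sum N x) F = 0" for x
    using reval_sym_to_shifted[of x F N] by (simp add: reval_simps)
  \<comment> \<open>One multiplicity after the other is freed from the restriction to \<open>0, \<dots>, D\<close>.\<close>
  have "\<forall>c. (\<forall>i. j \<le> i \<longrightarrow> i < n \<longrightarrow> c i \<in> real ` {..D}) \<longrightarrow> reval (pt c) F = 0" for j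
  proof (induction j)
    case 0
    show ?case
    proof (intro allI impI)
      fix c :: "nat \<Rightarrow> real" assume "\<forall>i. 0 \<le> i \<longrightarrow> i < n \<longrightarrow> c i \<in> real ` {..D}"
      then have "\<forall>i. \<exists>r. i < n \<longrightarrow> r \<le> D \<and> c i = real r" by auto
      then obtain r where r: "\<And>i. i < n \<Longrightarrow> r i \<le> D" "\<And>i. i < n \<Longrightarrow> c i = real (r i)" by metis
      \<comment> \<open>The \<open>i\<close>-th block of length \<open>D\<close> contains the point \<open>i + 1\<close> with multiplicity \<open>r i\<close>.\<close>
      define u where "u l = (if l mod D < r (l div D) then real (Suc (l div D)) else 0)" for l
      have "row_power_sum N (\<lambda>l. u l + (real l + 1/2)) k = pt c k" for k
      proof -
        have "(\<Sum>l<N. u l ^ Suc k) = (\<Sum>i<n. \<Sum>l\<in>{i*D..<i*D+D}. u l ^ Suc k)"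
          unfolding N_def by (rule sum.nat_group[symmetric])
        also have "\<dots> = (\<Sum>i<n. c i * real (Suc i) ^ Suc k)"
        proof (intro sum.cong refl)
          fix i assume i: "i \<in> {..<n}"
          have "(\<Sum>l\<in>{i*D..<i*D+D}. u l ^ Suc k) = (\<Sum>l<D. u (i * D + l) ^ Suc k)"
            by (rule sum.reindex_bij_witness[of _ "\<lambda>l. i * D + l" "\<lambda>l. l - i * D"]) auto
          also have "\<dots> = (\<Sum>l<D. if l < r i then real (Suc i) ^ Suc k else 0)"
            by (intro sum.cong) (auto simp: u_def simp del: power_Suc of_nat_Suc)
          also have "\<dots> = (\<Sum>l\<in>{..<D} \<inter> {l. l < r i}. real (Suc i) ^ Suc k)"
            by (simp only: sum.inter_restrict[OF finite_lessThan] mem_Collect_eq)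
          also have "{..<D} \<inter> {l. l < r i} = {..<r i}" using r(1)[of i] i by auto
          finally show "(\<Sum>l\<in>{i*D..<i*D+D}. u l ^ Suc k) = c i * real (Suc i) ^ Suc k"
            using r(2)[of i] i by simp
        qed
        finally show ?thesis
          by (simp add: row_power_sum_def pt_def b_def sum_subtractf del: power_Suc)
      qed
      then have "row_power_sum N (\<lambda>l. u l + (real l + 1/2)) = pt c" by (rule ext)
      then show "reval (pt c) F = 0" using zero by metis
    qed
  next
    case (Suc j)
    show ?case
    proof (intro allI impI)
      fix c :: "nat \<Rightarrow> real" assume c: "\<forall>i. Suc j \<le> i \<longrightarrow> i < n \<longrightarrow> c i \<in> real ` {..D}"
      show "reval (pt c) F = 0"
      proof (cases "j < n")
        case False
        then show ?thesis using Suc.IH by auto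
      next
        case True
        define a where "a k = (\<Sum>i\<in>{..<n}-{j}. c i * real (Suc i) ^ Suc k) - b k" for k
        obtain p where p: "degree p \<le> D" "\<And>r. poly p r = reval (\<lambda>k. a k + r * real (Suc j) ^ Suc k) F"
          using D[of a "\<lambda>k. real (Suc j) ^ Suc k"] by blast
        have pt: "reval (pt (c(j := r))) F = poly p r" for r
        proof -
          have "pt (c(j := r)) k = a k + r * real (Suc j) ^ Suc k" for k
          proof -
            have "(\<Sum>i<n. (c(j := r)) i * real (Suc i) ^ Suc k)
                = r * real (Suc j) ^ Suc k + (\<Sum>i\<in>{..<n}-{j}. (c(j := r)) i * real (Suc i) ^ Suc k)"
              using True by (subst sum.remove[of _ j]) auto
            also have "(\<Sum>i\<in>{..<n}-{j}. (c(j := r)) i * real (Suc i) ^ Suc k)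
                = (\<Sum>i\<in>{..<n}-{j}. c i * real (Suc i) ^ Suc k)"
              by (intro sum.cong) auto
            finally show ?thesis by (simp add: pt_def a_def del: power_Suc of_nat_Suc)
          qed
          then have "pt (c(j := r)) = (\<lambda>k. a k + r * real (Suc j) ^ Suc k)" by (rule ext)
          then show ?thesis by (simp only: p(2))
        qed
        have "p = 0"
        proof (rule ccontr)
          assume "p \<noteq> 0"
          have "real ` {..D} \<subseteq> {x. poly p x = 0}"
          proof (rule image_subsetI)
            fix r assume "r \<in> {..D}"
            then have "\<forall>i. j \<le> i \<longrightarrow> i < n \<longrightarrow> (c(j := real r)) i \<in> real ` {..D}"
              using c by auto
            then have "reval (pt (c(j := real r))) F = 0" using Suc.IH by blast
            then show "real r \<in> {x. poly p x = 0}" by (simp add: pt)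
          qed
          then have "card (real ` {..D}) \<le> card {x. poly p x = 0}"
            using \<open>p \<noteq> 0\<close> by (intro card_mono poly_roots_finite)
          moreover have "card {x. poly p x = 0} \<le> degree p"
            using \<open>p \<noteq> 0\<close> by (rule card_poly_roots_bound)
          ultimately show False using p(1) by (simp add: card_image inj_on_def)
        qed
        then show ?thesis using pt[of "c j"] by simp
      qed
    qed
  qed
  then have pt0: "reval (pt c) F = 0" for c
    using spec[of _ c] by (metis leD)
  have "reval v F = 0" for v
  proof -
    obtain c where c: "\<And>k. k < n \<Longrightarrow> (\<Sum>i<n. c i * real (Suc i) ^ Suc k) = v k + b k"
      using vandermonde_system_solvable[of n "\<lambda>k. v k + b k"] by blast
    have "reval v F = reval (pt c) F"
      using n c by (intro mpoly_eval_cong) (auto simp: pt_def simp del: power_Suc of_nat_Suc)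
    then show ?thesis using pt0 by simp
  qed
  then show "F = 0" by (intro mpoly_eq_0_if_vanishing[of 0])
qed


section \<open>Determinants of inverse factorials\<close>

lemma det_mat_leibniz:
  "Determinant.det (Matrix.mat N N (\<lambda>(i, j). f i j))
    = (\<Sum>p | p permutes {0..<N}. of_int (sign p) * (\<Prod>i = 0..<N. f i (p i)))"
  unfolding Determinant.det_def by (auto intro!: sum.cong prod.cong dest: permutes_in_image)

text \<open>Multiplying the entries of one row, or one column, by \<open>h\<close> and summing over the choice of that row,
  or column, gives the same result.\<close>

lemma sum_det_mult_row:
  fixes f h :: "nat \<Rightarrow> nat \<Rightarrow> 'a::comm_ring_1"
  shows "(\<Sum>r = 0..<N. Determinant.det (Matrix.mat N N (\<lambda>(i, j). (if i = r then h i j else 1) * f i j)))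
    = (\<Sum>p | p permutes {0..<N}. of_int (sign p) * ((\<Sum>i = 0..<N. h i (p i)) * (\<Prod>i = 0..<N. f i (p i))))"
proof -
  have "(\<Sum>r = 0..<N. Determinant.det (Matrix.mat N N (\<lambda>(i, j). (if i = r then h i j else 1) * f i j)))
      = (\<Sum>p | p permutes {0..<N}. \<Sum>r = 0..<N. of_int (sign p) * (\<Prod>i = 0..<N. (if i = r then h i (p i) else 1) * f i (p i)))"
    unfolding det_mat_leibniz by (rule sum.swap)
  also have "\<dots> = (\<Sum>p | p permutes {0..<N}. \<Sum>r = 0..<N. of_int (sign p) * (h r (p r) * (\<Prod>i = 0..<N. f i (p i))))"
    by (intro sum.cong refl) (simp add: prod.distrib prod.delta')
  finally show ?thesis by (simp add: sum_distrib_left sum_distrib_right)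
qed

lemma sum_det_mult_col:
  fixes f h :: "nat \<Rightarrow> nat \<Rightarrow> 'a::comm_ring_1"
  shows "(\<Sum>r = 0..<N. Determinant.det (Matrix.mat N N (\<lambda>(i, j). (if j = r then h i j else 1) * f i j)))
    = (\<Sum>p | p permutes {0..<N}. of_int (sign p) * ((\<Sum>i = 0..<N. h i (p i)) * (\<Prod>i = 0..<N. f i (p i))))"
proof -
  have "(\<Sum>r = 0..<N. Determinant.det (Matrix.mat N N (\<lambda>(i, j). (if j = r then h i j else 1) * f i j)))
      = (\<Sum>p | p permutes {0..<N}. \<Sum>r = 0..<N. of_int (sign p) * (\<Prod>i = 0..<N. (if p i = r then h i (p i) else 1) * f i (p i)))"
    unfolding det_mat_leibniz by (rule sum.swap)
  also have "\<dots> = (\<Sum>p | p permutes {0..<N}. \<Sum>r = 0..<N. of_int (sign p) * (h r (p r) * (\<Prod>i = 0..<N. f i (p i))))"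
  proof (rule sum.cong[OF refl])
    fix p assume "p \<in> {p. p permutes {0..<N}}"
    then have p: "p permutes {0..<N}" by simp
    have eq: "p i = p k \<longleftrightarrow> i = k" for i k using permutes_inj[OF p] by (auto dest: injD)
    have "(\<Sum>r = 0..<N. of_int (sign p) * (\<Prod>i = 0..<N. (if p i = r then h i (p i) else 1) * f i (p i)))
        = (\<Sum>k = 0..<N. of_int (sign p) * (\<Prod>i = 0..<N. (if p i = p k then h i (p i) else 1) * f i (p i)))"
      by (subst sum.permute[OF p]) (simp add: o_def)
    also have "\<dots> = (\<Sum>k = 0..<N. of_int (sign p) * (h k (p k) * (\<Prod>i = 0..<N. f i (p i))))"
      unfolding eq by (intro sum.cong refl) (simp add: prod.distrib prod.delta')
    finally show "(\<Sum>r = 0..<N. of_int (sign p) * (\<Prod>i = 0..<N. (if p i = r then h i (p i) else 1) * f i (p i)))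
        = (\<Sum>r = 0..<N. of_int (sign p) * (h r (p r) * (\<Prod>i = 0..<N. f i (p i))))" .
  qed
  finally show ?thesis by (simp add: sum_distrib_left sum_distrib_right)
qed

lemma det_row_linear:
  fixes A :: "nat \<Rightarrow> nat \<Rightarrow> 'a::comm_ring_1"
  assumes "r < N"
  shows "Determinant.det (Matrix.mat N N (\<lambda>(i, j). if i = r then (\<Sum>s\<in>S. c s * f s j) else A i j))
    = (\<Sum>s\<in>S. c s * Determinant.det (Matrix.mat N N (\<lambda>(i, j). if i = r then f s j else A i j)))"
proof -
  have prod: "(\<Prod>i = 0..<N. if i = r then g (p i) else A i (p i))
      = g (p r) * (\<Prod>i\<in>{0..<N}-{r}. A i (p i))" for g p
  proof -
    have "(\<Prod>i = 0..<N. if i = r then g (p i) else A i (p i))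
        = g (p r) * (\<Prod>i\<in>{0..<N}-{r}. if i = r then g (p i) else A i (p i))"
      using assms by (subst prod.remove[of _ r]) auto
    also have "(\<Prod>i\<in>{0..<N}-{r}. if i = r then g (p i) else A i (p i)) = (\<Prod>i\<in>{0..<N}-{r}. A i (p i))"
      by (intro prod.cong) auto
    finally show ?thesis .
  qed
  have "Determinant.det (Matrix.mat N N (\<lambda>(i, j). if i = r then (\<Sum>s\<in>S. c s * f s j) else A i j))
      = (\<Sum>p | p permutes {0..<N}. \<Sum>s\<in>S. c s * (of_int (sign p) * (f s (p r) * (\<Prod>i\<in>{0..<N}-{r}. A i (p i)))))"
    unfolding det_mat_leibniz
    by (intro sum.cong refl)
       (simp add: prod[where g = "\<lambda>j. \<Sum>s\<in>S. c s * f s j"] sum_distrib_left sum_distrib_right mult_ac)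
  also have "\<dots> = (\<Sum>s\<in>S. c s * Determinant.det (Matrix.mat N N (\<lambda>(i, j). if i = r then f s j else A i j)))"
    unfolding det_mat_leibniz by (subst sum.swap) (simp add: prod sum_distrib_left)
  finally show ?thesis .
qed

text \<open>The inverse factorial on the integers, extended by 0 to negative arguments. With this convention
  \<open>ifact_rec\<close> holds without restrictions.\<close>

definition ifact :: "int \<Rightarrow> real" where
  "ifact k = (if k < 0 then 0 else 1 / fact (nat k))"

lemma ifact_0 [simp]: "ifact 0 = 1"
  by (simp add: ifact_def)

lemma ifact_rec: "of_int k * ifact k = ifact (k - 1)"
proof (cases "k \<le> 0")
  case True
  then show ?thesis by (cases "k = 0") (auto simp: ifact_def)
next
  case False
  then have "nat k = Suc (nat (k - 1))" by simp
  then have "(fact (nat k) :: real) = of_int k * fact (nat (k - 1))" using False by simp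
  then show ?thesis using False by (simp add: ifact_def)
qed

text \<open>The determinant of the matrix with entries \<open>1 / (l\<^sub>j - m\<^sub>i)!\<close>, where \<open>i, j < N\<close>.\<close>

definition ifact_det :: "nat \<Rightarrow> (nat \<Rightarrow> int) \<Rightarrow> (nat \<Rightarrow> int) \<Rightarrow> real" where
  "ifact_det N l m = Determinant.det (Matrix.mat N N (\<lambda>(i, j). ifact (l j - m i)))"

lemma ifact_det_cong:
  assumes "\<And>i. i < N \<Longrightarrow> l i = l' i" "\<And>i. i < N \<Longrightarrow> m i = m' i"
  shows "ifact_det N l m = ifact_det N l' m'"
  unfolding ifact_det_def using assms by (intro arg_cong[where f = Determinant.det] cong_mat) auto

lemma ifact_det_shift_sum:
  "(\<Sum>r = 0..<N. ifact_det N (l(r := l r - 1)) m) = of_int ((\<Sum>j = 0..<N. l j) - (\<Sum>i = 0..<N. m i)) * ifact_det N l m"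
proof -
  have "(\<Sum>r = 0..<N. ifact_det N (l(r := l r - 1)) m)
      = (\<Sum>r = 0..<N. Determinant.det (Matrix.mat N N (\<lambda>(i, j). (if j = r then of_int (l j - m i) else 1) * ifact (l j - m i))))"
  proof (intro sum.cong refl)
    fix r
    have "ifact ((l(r := l r - 1)) j - m i) = (if j = r then of_int (l j - m i) else 1) * ifact (l j - m i)" for i j
    proof -
      have "l r - 1 - m i = (l r - m i) - 1" by simp
      then show ?thesis
        by (cases "j = r") (simp_all only: ifact_rec fun_upd_same fun_upd_other if_True if_False mult_1 simp_thms)
    qed
    then show "ifact_det N (l(r := l r - 1)) m = Determinant.det (Matrix.mat N N
        (\<lambda>(i, j). (if j = r then of_int (l j - m i) else 1) * ifact (l j - m i)))"
      by (simp only: ifact_det_def)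
  qed
  also have "\<dots> = (\<Sum>p | p permutes {0..<N}. of_int (sign p) *
      ((\<Sum>i = 0..<N. of_int (l (p i) - m i)) * (\<Prod>i = 0..<N. ifact (l (p i) - m i))))"
    by (rule sum_det_mult_col)
  also have "\<dots> = (\<Sum>p | p permutes {0..<N}. of_int (sign p) *
      (of_int ((\<Sum>j = 0..<N. l j) - (\<Sum>i = 0..<N. m i)) * (\<Prod>i = 0..<N. ifact (l (p i) - m i))))"
  proof (intro sum.cong refl arg_cong2[where f = "(*)"])
    fix p assume "p \<in> {p. p permutes {0..<N}}"
    then have "(\<Sum>j = 0..<N. l j) = (\<Sum>i = 0..<N. l (p i))"
      by (subst sum.permute[of p]) (auto simp: o_def)
    then show "(\<Sum>i = 0..<N. of_int (l (p i) - m i)) = real_of_int ((\<Sum>j = 0..<N. l j) - (\<Sum>i = 0..<N. m i))"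
      by (simp add: sum_subtractf)
  qed
  also have "\<dots> = of_int ((\<Sum>j = 0..<N. l j) - (\<Sum>i = 0..<N. m i)) * ifact_det N l m"
    unfolding ifact_det_def det_mat_leibniz by (simp only: sum_distrib_left mult_ac)
  finally show ?thesis .
qed

lemma power_mult_ifact:
  "\<exists>c. \<forall>x. (of_int x + a) ^ k * ifact (x - m) = (\<Sum>s\<le>k. c s * ifact (x - (m + int s)))"
proof (induction k)
  case 0
  show ?case by (rule exI[of _ "\<lambda>_. 1"]) simp
next
  case (Suc k)
  then obtain c where c: "\<And>x. (of_int x + a) ^ k * ifact (x - m) = (\<Sum>s\<le>k. c s * ifact (x - (m + int s)))"
    by blast
  define b where "b s = (of_int (m + int s) + a) * c s" for s
  \<comment> \<open>This uses \<open>(x + a) / (x - m)! = 1 / (x - m - 1)! + (m + a) / (x - m)!\<close>.\<close>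
  define c' where "c' s = (if s \<le> k then b s else 0) + (if s = 0 then 0 else c (s - 1))" for s
  have "(of_int x + a) ^ Suc k * ifact (x - m) = (\<Sum>s\<le>Suc k. c' s * ifact (x - (m + int s)))" for x
  proof -
    have step: "(of_int x + a) * (c s * ifact (x - (m + int s)))
        = b s * ifact (x - (m + int s)) + c s * ifact (x - (m + int (Suc s)))" for s
    proof -
      have "x - (m + int (Suc s)) = x - (m + int s) - 1" by simp
      then have "ifact (x - (m + int (Suc s))) = of_int (x - (m + int s)) * ifact (x - (m + int s))"
        by (simp only: ifact_rec)
      then show ?thesis unfolding b_def by (simp only: of_int_diff of_int_add) (simp add: algebra_simps)
    qed
    have "(of_int x + a) ^ Suc k * ifact (x - m) = (\<Sum>s\<le>k. (of_int x + a) * (c s * ifact (x - (m + int s))))"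
      by (simp add: c mult.assoc sum_distrib_left)
    also have "\<dots> = (\<Sum>s\<le>k. b s * ifact (x - (m + int s))) + (\<Sum>s\<le>k. c s * ifact (x - (m + int (Suc s))))"
      unfolding step by (rule sum.distrib)
    also have "(\<Sum>s\<le>k. b s * ifact (x - (m + int s))) = (\<Sum>s\<le>Suc k. (if s \<le> k then b s else 0) * ifact (x - (m + int s)))"
      by simp
    also have "(\<Sum>s\<le>k. c s * ifact (x - (m + int (Suc s)))) = (\<Sum>s\<le>Suc k. (if s = 0 then 0 else c (s - 1)) * ifact (x - (m + int s)))"
      by (subst sum.atMost_Suc_shift) simp
    finally show ?thesis by (simp only: c'_def distrib_right sum.distrib)
  qed
  then show ?case by blast
qed

text \<open>Multiplication by a power sum in the \<open>l\<^sub>j\<close> acts on the exponents \<open>m\<close> only; the coefficients do not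
  depend on \<open>l\<close>.\<close>

lemma power_sum_mult_ifact_det:
  fixes a :: real and k :: nat and m :: "nat \<Rightarrow> nat"
  shows "\<exists>c. \<forall>l. (\<Sum>j = 0..<N. (of_int (l j) + a) ^ k) * ifact_det N l (\<lambda>i. int (m i))
    = (\<Sum>r = 0..<N. \<Sum>s\<le>k. c r s * ifact_det N l (\<lambda>i. int ((m(r := m r + s)) i)))"
proof -
  have "\<forall>r. \<exists>c. \<forall>x. (of_int x + a) ^ k * ifact (x - int (m r)) = (\<Sum>s\<le>k. c s * ifact (x - (int (m r) + int s)))"
    using power_mult_ifact by blast
  then obtain c where c: "\<And>r x. (of_int x + a) ^ k * ifact (x - int (m r)) = (\<Sum>s\<le>k. c r s * ifact (x - (int (m r) + int s)))"
    by metis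
  have "(\<Sum>j = 0..<N. (of_int (l j) + a) ^ k) * ifact_det N l (\<lambda>i. int (m i))
    = (\<Sum>r = 0..<N. \<Sum>s\<le>k. c r s * ifact_det N l (\<lambda>i. int ((m(r := m r + s)) i)))" for l :: "nat \<Rightarrow> int"
  proof -
    have "(\<Sum>j = 0..<N. (of_int (l j) + a) ^ k) * ifact_det N l (\<lambda>i. int (m i))
      = (\<Sum>p | p permutes {0..<N}. of_int (sign p) *
      ((\<Sum>i = 0..<N. (of_int (l (p i)) + a) ^ k) * (\<Prod>i = 0..<N. ifact (l (p i) - int (m i)))))"
      unfolding ifact_det_def det_mat_leibniz sum_distrib_left
    proof (intro sum.cong refl)
      fix p assume "p \<in> {p. p permutes {0..<N}}"
      then have "(\<Sum>j = 0..<N. (of_int (l j) + a) ^ k) = (\<Sum>i = 0..<N. (of_int (l (p i)) + a) ^ k)"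
        by (subst sum.permute[of p]) (auto simp: o_def)
      then show "(\<Sum>j = 0..<N. (of_int (l j) + a) ^ k) * (of_int (sign p) * (\<Prod>i = 0..<N. ifact (l (p i) - int (m i))))
        = of_int (sign p) * ((\<Sum>i = 0..<N. (of_int (l (p i)) + a) ^ k) * (\<Prod>i = 0..<N. ifact (l (p i) - int (m i))))"
        by simp
    qed
    also have "\<dots> = (\<Sum>r = 0..<N. Determinant.det (Matrix.mat N N
        (\<lambda>(i, j). (if i = r then (of_int (l j) + a) ^ k else 1) * ifact (l j - int (m i)))))"
      by (rule sum_det_mult_row[symmetric])
    also have "\<dots> = (\<Sum>r = 0..<N. \<Sum>s\<le>k. c r s * ifact_det N l (\<lambda>i. int ((m(r := m r + s)) i)))"
    proof (intro sum.cong refl)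
      fix r assume r: "r \<in> {0..<N}"
      have "Determinant.det (Matrix.mat N N
          (\<lambda>(i, j). (if i = r then (of_int (l j) + a) ^ k else 1) * ifact (l j - int (m i))))
        = Determinant.det (Matrix.mat N N (\<lambda>(i, j). if i = r
            then (\<Sum>s\<le>k. c r s * ifact (l j - (int (m r) + int s))) else ifact (l j - int (m i))))"
        by (intro arg_cong[where f = Determinant.det] cong_mat) (auto simp: c)
      also have "\<dots> = (\<Sum>s\<le>k. c r s * Determinant.det (Matrix.mat N N (\<lambda>(i, j). if i = r
            then ifact (l j - (int (m r) + int s)) else ifact (l j - int (m i)))))"
        using r by (intro det_row_linear) simp
      also have "\<dots> = (\<Sum>s\<le>k. c r s * ifact_det N l (\<lambda>i. int ((m(r := m r + s)) i)))"
        unfolding ifact_det_def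
        by (intro sum.cong refl arg_cong2[where f = "(*)"] arg_cong[where f = Determinant.det] cong_mat) auto
      finally show "Determinant.det (Matrix.mat N N
          (\<lambda>(i, j). (if i = r then (of_int (l j) + a) ^ k else 1) * ifact (l j - int (m i))))
        = (\<Sum>s\<le>k. c r s * ifact_det N l (\<lambda>i. int ((m(r := m r + s)) i)))" .
    qed
    finally show ?thesis .
  qed
  then show ?thesis by blast
qed

text \<open>The strictly decreasing sequence \<open>\<kappa>\<^sub>i + N - i\<close>, written for rows numbered from 0.\<close>

definition maya :: "nat \<Rightarrow> young \<Rightarrow> nat \<Rightarrow> int" where
  "maya N \<kappa> i = int (yrow \<kappa> i) + int N - 1 - int i"

lemma sum_maya:
  assumes "ylength \<kappa> \<le> N"
  shows "(\<Sum>i = 0..<N. maya N \<kappa> i) = int (ysize \<kappa>) + (\<Sum>i = 0..<N. int i)"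
proof -
  have "(\<Sum>i = 0..<N. maya N \<kappa> i) = int (\<Sum>i<N. yrow \<kappa> i) + (\<Sum>i = 0..<N. int N - 1 - int i)"
  proof -
    have "maya N \<kappa> i = int (yrow \<kappa> i) + (int N - 1 - int i)" for i by (simp add: maya_def)
    then show ?thesis by (simp only: sum.distrib of_nat_sum atLeast0LessThan)
  qed
  also have "(\<Sum>i = 0..<N. int N - 1 - int i) = (\<Sum>i = 0..<N. int i)"
    by (rule sum.reindex_bij_witness[of _ "\<lambda>i. N - 1 - i" "\<lambda>i. N - 1 - i"]) auto
  finally show ?thesis using ysize_eq_sum[OF assms] by simp
qed

lemma maya_strict: "i < j \<Longrightarrow> maya N \<kappa> j < maya N \<kappa> i"
  using yrow_antimono[of i j \<kappa>] by (simp add: maya_def)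

lemma ifact_det_zero_column:
  assumes "r < N" "\<And>i. i < N \<Longrightarrow> l r < m i"
  shows "ifact_det N l m = 0"
  unfolding ifact_det_def det_mat_leibniz
proof (intro sum.neutral ballI)
  fix p assume "p \<in> {p. p permutes {0..<N}}"
  then have p: "p permutes {0..<N}" by simp
  obtain i where i: "i \<in> {0..<N}" "p i = r"
    using permutes_image[OF p] assms(1) by (metis atLeastLessThan_iff imageE le0)
  then have "ifact (l (p i) - m i) = 0" using assms(2)[of i] by (simp add: ifact_def)
  then have "(\<Prod>i = 0..<N. ifact (l (p i) - m i)) = 0" using i(1) by (intro prod_zero) auto
  then show "of_int (sign p) * (\<Prod>i = 0..<N. ifact (l (p i) - m i)) = 0" by simp
qed

lemma ifact_det_equal_columns:
  assumes "r < N" "r' < N" "r \<noteq> r'" "l r = l r'"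
  shows "ifact_det N l m = 0"
  unfolding ifact_det_def
  by (rule det_identical_columns[of _ N r r']) (use assms in auto)

text \<open>The determinants satisfy the branching rule. Rows from which no box can be removed contribute a
  determinant with two equal columns or, for the last row, a zero column.\<close>

lemma ifact_det_maya_rec:
  assumes "ylength \<kappa> \<le> N" "\<And>i. i < N \<Longrightarrow> m i \<ge> 0"
  shows "(real (ysize \<kappa>) - of_int ((\<Sum>i = 0..<N. m i) - (\<Sum>i = 0..<N. int i))) * ifact_det N (maya N \<kappa>) m
    = (\<Sum>\<rho>\<in>downs \<kappa>. ifact_det N (maya N \<rho>) m)"
proof -
  let ?l = "maya N \<kappa>"
  have "(real (ysize \<kappa>) - of_int ((\<Sum>i = 0..<N. m i) - (\<Sum>i = 0..<N. int i))) * ifact_det N ?l m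
      = of_int ((\<Sum>j = 0..<N. ?l j) - (\<Sum>i = 0..<N. m i)) * ifact_det N ?l m"
    unfolding sum_maya[OF assms(1)] by simp
  also have "\<dots> = (\<Sum>r = 0..<N. ifact_det N (?l(r := ?l r - 1)) m)"
    by (rule ifact_det_shift_sum[symmetric])
  also have "\<dots> = (\<Sum>r\<in>{r. removable \<kappa> r}. ifact_det N (?l(r := ?l r - 1)) m)"
  proof (rule sum.mono_neutral_right)
    show "{r. removable \<kappa> r} \<subseteq> {0..<N}"
    proof
      fix r assume "r \<in> {r. removable \<kappa> r}"
      then have "r < ylength \<kappa>" by (simp add: removable_less)
      then show "r \<in> {0..<N}" using assms(1) by simp
    qed
    show "\<forall>r\<in>{0..<N} - {r. removable \<kappa> r}. ifact_det N (?l(r := ?l r - 1)) m = 0"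
    proof
      fix r assume "r \<in> {0..<N} - {r. removable \<kappa> r}"
      then have r: "r < N" "yrow \<kappa> (Suc r) = yrow \<kappa> r"
        using yrow_antimono[of r "Suc r" \<kappa>] by (auto simp: removable_def)
      show "ifact_det N (?l(r := ?l r - 1)) m = 0"
      proof (cases "Suc r < N")
        case True
        then show ?thesis using r
          by (intro ifact_det_equal_columns[of r N "Suc r"]) (auto simp: maya_def)
      next
        case False
        then have "Suc r = N" using r by simp
        then have "yrow \<kappa> r = 0" using r(2) assms(1) yrow_eq_0_iff[of \<kappa> N] by simp
        then show ?thesis using r \<open>Suc r = N\<close> assms(2)
          by (intro ifact_det_zero_column[of r N]) (fastforce simp: maya_def)+
      qed
    qed
  qed auto
  also have "\<dots> = (\<Sum>\<rho>\<in>downs \<kappa>. ifact_det N (maya N \<rho>) m)"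
    unfolding downs_eq
  proof (subst sum.reindex[OF inj_on_ydec], intro sum.cong refl)
    fix r assume "r \<in> {r. removable \<kappa> r}"
    then have r: "removable \<kappa> r" by simp
    then have "yrow \<kappa> r > 0" by (simp add: removable_def)
    then show "ifact_det N (?l(r := ?l r - 1)) m = ((\<lambda>\<rho>. ifact_det N (maya N \<rho>) m) \<circ> ydec \<kappa>) r"
      by (auto simp: maya_def yrow_ydec[OF r] intro!: ifact_det_cong)
  qed
  finally show ?thesis .
qed

lemma ylength_downs: "ylength \<kappa> \<le> N \<Longrightarrow> \<rho> \<in> downs \<kappa> \<Longrightarrow> ylength \<rho> \<le> N"
  using ylength_mono contained_downs le_trans by blast

lemma ifact_det_expansion:
  assumes "ylength \<kappa> \<le> N" "\<And>i. i < N \<Longrightarrow> m i \<ge> 0"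
  shows "ifact_det N (maya N \<kappa>) m = (\<Sum>\<mu>\<in>{\<mu>. int (ysize \<mu>) = (\<Sum>i = 0..<N. m i) - (\<Sum>i = 0..<N. int i) \<and> ylength \<mu> \<le> N}.
     ifact_det N (maya N \<mu>) m * ndim \<kappa> \<mu>)"
  using assms by (intro ndim_expansion[where g = "\<lambda>\<kappa>. ifact_det N (maya N \<kappa>) m"] ifact_det_maya_rec) (auto intro: ylength_downs)

lemma permutes_strict_mono_id:
  assumes p: "p permutes {0..<N::nat}" and mono: "\<And>i j. i < j \<Longrightarrow> j < N \<Longrightarrow> p i < p j"
  shows "p = id"
proof (rule permutes_natset_ge[OF p])
  have "i < N \<longrightarrow> i \<le> p i" for i
  proof (induction i)
    case (Suc i)
    then show ?case using mono[of i "Suc i"] by auto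
  qed simp
  then show "\<forall>i\<in>{0..<N}. i \<le> p i" by auto
qed

lemma ifact_det_maya_same_size:
  assumes "ylength \<kappa> \<le> N" "ylength \<mu> \<le> N" "ysize \<kappa> = ysize \<mu>"
  shows "ifact_det N (maya N \<kappa>) (maya N \<mu>) = of_bool (\<kappa> = \<mu>)"
proof -
  let ?l = "maya N \<kappa>" and ?m = "maya N \<mu>"
  have vanish: "(\<Prod>i = 0..<N. ifact (?l (p i) - ?m i)) = 0 \<or> (p = id \<and> \<kappa> = \<mu>)" if p: "p permutes {0..<N}" for p
  proof (cases "\<forall>i<N. ?m i \<le> ?l (p i)")
    case False
    then obtain i where "i < N" "?l (p i) < ?m i" by (auto simp: not_le)
    then have "(\<Prod>i = 0..<N. ifact (?l (p i) - ?m i)) = 0" by (intro prod_zero) (auto simp: ifact_def)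
    then show ?thesis ..
  next
    case True
    have "(\<Sum>i = 0..<N. ?l (p i)) = (\<Sum>i = 0..<N. ?l i)"
      by (subst (2) sum.permute[OF p]) (simp add: o_def)
    then have "(\<Sum>i = 0..<N. ?l (p i) - ?m i) = 0"
      using assms by (simp add: sum_subtractf sum_maya)
    then have "\<forall>i\<in>{0..<N}. ?l (p i) - ?m i = 0"
      using True by (subst (asm) sum_nonneg_eq_0_iff) auto
    then have eq: "?l (p i) = ?m i" if "i < N" for i using that by simp
    have "p i < p j" if "i < j" "j < N" for i j
    proof (rule ccontr)
      assume "\<not> p i < p j"
      moreover have "p i \<noteq> p j" using permutes_inj[OF p] that by (auto dest: injD)
      ultimately have "?l (p i) < ?l (p j)" by (intro maya_strict) simp
      then show False using eq[of i] eq[of j] that maya_strict[of i j N \<mu>] by simp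
    qed
    then have id: "p = id" by (rule permutes_strict_mono_id[OF p])
    have "yrow \<kappa> i = yrow \<mu> i" for i
    proof (cases "i < N")
      case True
      then show ?thesis using eq[of i] by (simp add: id maya_def)
    next
      case False
      then show ?thesis using assms(1,2) yrow_eq_0_iff[of \<kappa> i] yrow_eq_0_iff[of \<mu> i] by simp
    qed
    then show ?thesis using id young_eqI by blast
  qed
  have "ifact_det N ?l ?m = (\<Sum>p | p permutes {0..<N}. if p = id then of_bool (\<kappa> = \<mu>) else 0)"
    unfolding ifact_det_def det_mat_leibniz
  proof (intro sum.cong refl)
    fix p assume "p \<in> {p. p permutes {0..<N}}"
    then show "of_int (sign p) * (\<Prod>i = 0..<N. ifact (?l (p i) - ?m i)) = (if p = id then of_bool (\<kappa> = \<mu>) else 0)"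
      using vanish[of p] by (auto simp: sign_id)
  qed
  also have "\<dots> = of_bool (\<kappa> = \<mu>)"
    by (simp add: finite_permutations permutes_id)
  finally show ?thesis .
qed

text \<open>Aitken's determinantal formula for the number of standard tableaux of skew shape.\<close>

theorem ifact_det_maya_eq_ndim:
  assumes "ylength \<kappa> \<le> N" "ylength \<mu> \<le> N"
  shows "ifact_det N (maya N \<kappa>) (maya N \<mu>) = ndim \<kappa> \<mu>"
proof -
  have "ifact_det N (maya N \<kappa>) (maya N \<mu>) = (\<Sum>\<nu>\<in>{\<nu>. ysize \<nu> = ysize \<mu> \<and> ylength \<nu> \<le> N}.
     ifact_det N (maya N \<nu>) (maya N \<mu>) * ndim \<kappa> \<nu>)"
    using ifact_det_expansion[OF assms(1), of "maya N \<mu>"] sum_maya[OF assms(2)] by (simp add: maya_def)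
  also have "\<dots> = (\<Sum>\<nu>\<in>{\<nu>. ysize \<nu> = ysize \<mu> \<and> ylength \<nu> \<le> N}. if \<nu> = \<mu> then ndim \<kappa> \<mu> else 0)"
    by (intro sum.cong refl) (auto simp: ifact_det_maya_same_size assms)
  also have "\<dots> = ndim \<kappa> \<mu>"
  proof -
    have "finite {\<nu>. ysize \<nu> = ysize \<mu> \<and> ylength \<nu> \<le> N}"
      by (rule finite_subset[OF _ finite_ysize_eq[of "ysize \<mu>"]]) auto
    then show ?thesis using assms by simp
  qed
  finally show ?thesis .
qed

lemma falling_of_nat: "falling (real L) n = fact L * ifact (int L - int n)"
proof (cases "n \<le> L")
  case True
  then show ?thesis
  proof (induction n)
    case 0
    then show ?case by (simp add: falling_def ifact_def)
  next
    case (Suc n)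
    then have "falling (real L) (Suc n) = fact L * ifact (int L - int n) * (real L - real n)"
      by (simp add: falling_def)
    also have "\<dots> = fact L * (of_int (int L - int n) * ifact (int L - int n))"
      by simp
    also have "\<dots> = fact L * ifact (int L - int (Suc n))"
      by (simp only: ifact_rec) (simp add: algebra_simps)
    finally show ?case .
  qed
next
  case False
  then have "falling (real L) n = 0"
    unfolding falling_def by (intro prod_zero) auto
  then show ?thesis using False by (simp add: ifact_def)
qed

lemma falling_det:
  "Determinant.det (Matrix.mat N N (\<lambda>(i, j). falling (real (L j)) (m i)))
    = (\<Prod>j = 0..<N. fact (L j)) * ifact_det N (\<lambda>j. int (L j)) (\<lambda>i. int (m i))"
  unfolding ifact_det_def det_mat_leibniz sum_distrib_left
proof (intro sum.cong refl)
  fix p assume "p \<in> {p. p permutes {0..<N}}"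
  then have "(\<Prod>j = 0..<N. fact (L j) :: real) = (\<Prod>i = 0..<N. fact (L (p i)))"
    by (subst prod.permute[of p]) (auto simp: o_def)
  then show "of_int (sign p) * (\<Prod>i = 0..<N. falling (real (L (p i))) (m i))
      = (\<Prod>j = 0..<N. fact (L j)) * (of_int (sign p) * (\<Prod>i = 0..<N. ifact (int (L (p i)) - int (m i))))"
    by (simp add: falling_of_nat prod.distrib)
qed


section \<open>Expansion in normalized dimensions\<close>

text \<open>The span of the functions \<open>\<kappa> \<mapsto> det[1 / (l\<^sub>j - m\<^sub>i)!]\<close> on diagrams, where \<open>m\<close> ranges over sequences
  of naturals whose sum exceeds that of \<open>0, \<dots>, N - 1\<close> by at most \<open>n\<close>. The \<open>m\<^sub>i\<close> need not be distinct
  or ordered.\<close>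

inductive ifact_det_span :: "nat \<Rightarrow> nat \<Rightarrow> (young \<Rightarrow> real) \<Rightarrow> bool" for N n where
  zero: "ifact_det_span N n (\<lambda>_. 0)"
| step: "ifact_det_span N n g \<Longrightarrow> (\<Sum>i = 0..<N. m i) \<le> n + (\<Sum>i = 0..<N. i) \<Longrightarrow>
    ifact_det_span N n (\<lambda>\<kappa>. g \<kappa> + c * ifact_det N (maya N \<kappa>) (\<lambda>i. int (m i)))"

lemma ifact_det_span_add:
  assumes "ifact_det_span N n f" "ifact_det_span N n g"
  shows "ifact_det_span N n (\<lambda>\<kappa>. f \<kappa> + g \<kappa>)"
  using assms(2)
proof induction
  case zero
  then show ?case using assms(1) by simp
next
  case (step g m c)
  show ?case using ifact_det_span.step[OF step.IH step.hyps(2), of c] by (simp add: add.assoc)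
qed

lemma ifact_det_span_scale:
  assumes "ifact_det_span N n f"
  shows "ifact_det_span N n (\<lambda>\<kappa>. a * f \<kappa>)"
  using assms
proof induction
  case zero
  then show ?case by (simp add: ifact_det_span.zero)
next
  case (step g m c)
  show ?case using ifact_det_span.step[OF step.IH step.hyps(2), of "a * c"] by (simp add: distrib_left mult.assoc)
qed

lemma ifact_det_span_basis:
  "(\<Sum>i = 0..<N. m i) \<le> n + (\<Sum>i = 0..<N. i) \<Longrightarrow> ifact_det_span N n (\<lambda>\<kappa>. ifact_det N (maya N \<kappa>) (\<lambda>i. int (m i)))"
  using ifact_det_span.step[OF ifact_det_span.zero, where m = m and c = 1] by simp

lemma ifact_det_span_sum:
  "(\<And>i. i \<in> I \<Longrightarrow> ifact_det_span N n (f i)) \<Longrightarrow> ifact_det_span N n (\<lambda>\<kappa>. \<Sum>i\<in>I. f i \<kappa>)"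
  by (induction I rule: infinite_finite_induct) (auto intro: ifact_det_span.zero ifact_det_span_add)

lemma ifact_det_span_mono:
  assumes "ifact_det_span N n f" "n \<le> n'"
  shows "ifact_det_span N n' f"
  using assms(1)
proof induction
  case zero
  show ?case by (rule ifact_det_span.zero)
next
  case (step g m c)
  then show ?case using assms(2) by (intro ifact_det_span.step) auto
qed

text \<open>The shifted power sums of the first \<open>N\<close> rows of \<open>\<kappa>\<close>.\<close>

abbreviation row_sums :: "nat \<Rightarrow> young \<Rightarrow> nat \<Rightarrow> real" where
  "row_sums N \<kappa> \<equiv> row_power_sum N (\<lambda>i. real (yrow \<kappa> i))"

lemma row_sums_maya:
  "row_sums N \<kappa> k = (\<Sum>j = 0..<N. (of_int (maya N \<kappa> j) + (1/2 - real N)) ^ Suc k)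
     + - (\<Sum>j = 0..<N. (- (real j + 1/2)) ^ Suc k)"
proof -
  have "real (yrow \<kappa> j) - (real j + 1/2) = of_int (maya N \<kappa> j) + (1/2 - real N)" for j
    by (simp add: maya_def)
  then show ?thesis by (simp only: row_power_sum_def sum_subtractf atLeast0LessThan)
qed

lemma ifact_det_span_power_sum:
  assumes "ifact_det_span N n g"
  shows "ifact_det_span N (n + Suc k) (\<lambda>\<kappa>. row_sums N \<kappa> k * g \<kappa>)"
  using assms
proof induction
  case zero
  show ?case by (simp add: ifact_det_span.zero)
next
  case (step g m c)
  define b where "b = - (\<Sum>j = 0..<N. (- (real j + 1/2)) ^ Suc k)"
  obtain d where d: "\<And>l. (\<Sum>j = 0..<N. (of_int (l j) + (1/2 - real N)) ^ Suc k) * ifact_det N l (\<lambda>i. int (m i))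
    = (\<Sum>r = 0..<N. \<Sum>s\<le>Suc k. d r s * ifact_det N l (\<lambda>i. int ((m(r := m r + s)) i)))"
    using power_sum_mult_ifact_det[where k = "Suc k" and a = "1/2 - real N" and N = N and m = m] by (auto simp only:)
  have "ifact_det_span N (n + Suc k) (\<lambda>\<kappa>. (\<Sum>r = 0..<N. \<Sum>s\<le>Suc k. d r s * ifact_det N (maya N \<kappa>) (\<lambda>i. int ((m(r := m r + s)) i)))
      + b * ifact_det N (maya N \<kappa>) (\<lambda>i. int (m i)))"
  proof (intro ifact_det_span_add ifact_det_span_sum ifact_det_span_scale)
    show "ifact_det_span N (n + Suc k) (\<lambda>\<kappa>. ifact_det N (maya N \<kappa>) (\<lambda>i. int (m i)))"
      using step.hyps(2) by (intro ifact_det_span_basis) simp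
    fix r s assume rs: "r \<in> {0..<N}" "s \<in> {..Suc k}"
    have "(\<Sum>i = 0..<N. (m(r := m r + s)) i) = (\<Sum>i = 0..<N. m i + (if i = r then s else 0))"
      by (intro sum.cong) auto
    also have "\<dots> = (\<Sum>i = 0..<N. m i) + s" using rs by (simp add: sum.distrib)
    finally show "ifact_det_span N (n + Suc k) (\<lambda>\<kappa>. ifact_det N (maya N \<kappa>) (\<lambda>i. int ((m(r := m r + s)) i)))"
      using step.hyps(2) rs by (intro ifact_det_span_basis) simp
  qed
  then have "ifact_det_span N (n + Suc k) (\<lambda>\<kappa>. row_sums N \<kappa> k * ifact_det N (maya N \<kappa>) (\<lambda>i. int (m i)))"
    unfolding row_sums_maya distrib_right d b_def .
  then have "ifact_det_span N (n + Suc k) (\<lambda>\<kappa>. row_sums N \<kappa> k * g \<kappa> + c * (row_sums N \<kappa> k * ifact_det N (maya N \<kappa>) (\<lambda>i. int (m i))))"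
    by (intro ifact_det_span_add step.IH ifact_det_span_scale)
  then show ?case by (simp only: distrib_left mult.left_commute)
qed

text \<open>The weight of a monomial in the power sums, where \<open>p\<^sub>k\<close>, the variable of index \<open>k - 1\<close>, has
  weight \<open>k\<close>.\<close>

definition mweight :: "(nat \<Rightarrow>\<^sub>0 nat) \<Rightarrow> nat" where
  "mweight m = (\<Sum>k\<in>Poly_Mapping.keys m. Suc k * Poly_Mapping.lookup m k)"

lemma ifact_det_span_power:
  "ifact_det_span N n g \<Longrightarrow> ifact_det_span N (n + Suc k * e) (\<lambda>\<kappa>. row_sums N \<kappa> k ^ e * g \<kappa>)"
proof (induction e)
  case (Suc e)
  then have "ifact_det_span N (n + Suc k * e + Suc k) (\<lambda>\<kappa>. row_sums N \<kappa> k * (row_sums N \<kappa> k ^ e * g \<kappa>))"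
    by (intro ifact_det_span_power_sum) simp
  then show ?case by (simp add: mult.assoc add_ac)
qed simp

lemma ifact_det_span_prod:
  assumes "finite K" "ifact_det_span N n g"
  shows "ifact_det_span N (n + (\<Sum>k\<in>K. Suc k * e k)) (\<lambda>\<kappa>. (\<Prod>k\<in>K. row_sums N \<kappa> k ^ e k) * g \<kappa>)"
  using assms(1)
proof (induction K rule: finite_induct)
  case empty
  then show ?case using assms(2) by simp
next
  case (insert k K)
  from ifact_det_span_power[OF insert.IH, of k "e k"] show ?case
    using insert.hyps by (simp add: mult.assoc add_ac)
qed

lemma ifact_det_span_mpoly:
  assumes F: "\<And>m. m \<in> Poly_Mapping.keys F \<Longrightarrow> mweight m \<le> n"
  shows "ifact_det_span N n (\<lambda>\<kappa>. reval (row_sums N \<kappa>) F * ifact_det N (maya N \<kappa>) (maya N empty_young))"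
proof -
  have maya: "ifact_det N l (maya N empty_young) = ifact_det N l (\<lambda>i. int (N - Suc i))" for l
    by (rule ifact_det_cong) (auto simp: maya_def empty_young.rep_eq)
  have "(\<Sum>i = 0..<N. N - Suc i) = (\<Sum>i = 0..<N. i)"
    by (rule sum.reindex_bij_witness[of _ "\<lambda>i. N - Suc i" "\<lambda>i. N - Suc i"]) auto
  then have base: "ifact_det_span N 0 (\<lambda>\<kappa>. ifact_det N (maya N \<kappa>) (maya N empty_young))"
    unfolding maya by (intro ifact_det_span_basis) simp
  have "ifact_det_span N n (\<lambda>\<kappa>. \<Sum>m\<in>Poly_Mapping.keys F. Poly_Mapping.lookup F m *
      ((\<Prod>k\<in>Poly_Mapping.keys m. row_sums N \<kappa> k ^ Poly_Mapping.lookup m k) * ifact_det N (maya N \<kappa>) (maya N empty_young)))"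
  proof (intro ifact_det_span_sum ifact_det_span_scale)
    fix m assume "m \<in> Poly_Mapping.keys F"
    then have "mweight m \<le> n" by (rule F)
    moreover have "ifact_det_span N (0 + mweight m) (\<lambda>\<kappa>. (\<Prod>k\<in>Poly_Mapping.keys m. row_sums N \<kappa> k ^ Poly_Mapping.lookup m k)
        * ifact_det N (maya N \<kappa>) (maya N empty_young))"
      unfolding mweight_def by (intro ifact_det_span_prod base) simp
    ultimately show "ifact_det_span N n (\<lambda>\<kappa>. (\<Prod>k\<in>Poly_Mapping.keys m. row_sums N \<kappa> k ^ Poly_Mapping.lookup m k)
        * ifact_det N (maya N \<kappa>) (maya N empty_young))"
      by (intro ifact_det_span_mono[of N "0 + mweight m" _ n]) auto
  qed
  then show ?thesis by (simp add: mpoly_eval_def sum_distrib_right mult.assoc)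
qed

lemma ifact_det_span_expansion:
  assumes "ifact_det_span N n g"
  shows "\<exists>c. \<forall>\<kappa>. ylength \<kappa> \<le> N \<longrightarrow> g \<kappa> = (\<Sum>\<mu>\<in>{\<mu>. ysize \<mu> \<le> n \<and> ylength \<mu> \<le> N}. c \<mu> * ndim \<kappa> \<mu>)"
  using assms
proof induction
  case zero
  show ?case by (rule exI[of _ "\<lambda>_. 0"]) simp
next
  case (step g m a)
  then obtain c where c: "\<And>\<kappa>. ylength \<kappa> \<le> N \<Longrightarrow>
      g \<kappa> = (\<Sum>\<mu>\<in>{\<mu>. ysize \<mu> \<le> n \<and> ylength \<mu> \<le> N}. c \<mu> * ndim \<kappa> \<mu>)" by blast
  define k where "k = (\<Sum>i = 0..<N. int (m i)) - (\<Sum>i = 0..<N. int i)"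
  have "int (\<Sum>i = 0..<N. m i) \<le> int (n + (\<Sum>i = 0..<N. i))" using step.hyps(2) by (simp only: of_nat_le_iff)
  then have k: "k \<le> int n" by (simp add: k_def)
  define d where "d \<mu> = (if int (ysize \<mu>) = k then ifact_det N (maya N \<mu>) (\<lambda>i. int (m i)) else 0)" for \<mu>
  have fin: "finite {\<mu>. ysize \<mu> \<le> n \<and> ylength \<mu> \<le> N}"
    by (rule finite_subset[OF _ finite_ysize_le[of n]]) auto
  have "g \<kappa> + a * ifact_det N (maya N \<kappa>) (\<lambda>i. int (m i))
      = (\<Sum>\<mu>\<in>{\<mu>. ysize \<mu> \<le> n \<and> ylength \<mu> \<le> N}. (c \<mu> + a * d \<mu>) * ndim \<kappa> \<mu>)"
    if \<kappa>: "ylength \<kappa> \<le> N" for \<kappa>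
  proof -
    have "ifact_det N (maya N \<kappa>) (\<lambda>i. int (m i))
        = (\<Sum>\<mu>\<in>{\<mu>. int (ysize \<mu>) = k \<and> ylength \<mu> \<le> N}. ifact_det N (maya N \<mu>) (\<lambda>i. int (m i)) * ndim \<kappa> \<mu>)"
      unfolding k_def by (rule ifact_det_expansion[OF \<kappa>]) simp
    also have "\<dots> = (\<Sum>\<mu>\<in>{\<mu>. ysize \<mu> \<le> n \<and> ylength \<mu> \<le> N}. d \<mu> * ndim \<kappa> \<mu>)"
      using k fin by (intro sum.mono_neutral_cong_left) (auto simp: d_def)
    finally show ?thesis
      by (simp add: c[OF \<kappa>] distrib_right sum.distrib sum_distrib_left mult.assoc)
  qed
  then show ?case by (intro exI[of _ "\<lambda>\<mu>. c \<mu> + a * d \<mu>"]) blast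
qed

lemma ndim_independent:
  assumes "\<And>\<kappa>. ysize \<kappa> \<le> n \<Longrightarrow> (\<Sum>\<mu>\<in>{\<mu>. ysize \<mu> \<le> n}. c \<mu> * ndim \<kappa> \<mu>) = (\<Sum>\<mu>\<in>{\<mu>. ysize \<mu> \<le> n}. c' \<mu> * ndim \<kappa> \<mu>)"
    and "ysize \<kappa> \<le> n"
  shows "c \<kappa> = c' \<kappa>"
  using assms(2)
proof (induction \<kappa> rule: young_size_induct)
  case (step \<kappa>)
  have split: "(\<Sum>\<mu>\<in>{\<mu>. ysize \<mu> \<le> n}. b \<mu> * ndim \<kappa> \<mu>)
      = b \<kappa> + (\<Sum>\<mu>\<in>{\<mu>. ysize \<mu> < ysize \<kappa>}. b \<mu> * ndim \<kappa> \<mu>)" for b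
  proof -
    have fin: "finite (insert \<kappa> {\<mu>. ysize \<mu> < ysize \<kappa>})"
      by (rule finite_subset[OF _ finite_ysize_le[of "ysize \<kappa>"]]) auto
    have "(\<Sum>\<mu>\<in>{\<mu>. ysize \<mu> \<le> n}. b \<mu> * ndim \<kappa> \<mu>) = (\<Sum>\<mu>\<in>insert \<kappa> {\<mu>. ysize \<mu> < ysize \<kappa>}. b \<mu> * ndim \<kappa> \<mu>)"
      using step.prems by (intro sum.mono_neutral_right) (auto simp: ndim_eq_size)
    then show ?thesis using fin by simp
  qed
  have "(\<Sum>\<mu>\<in>{\<mu>. ysize \<mu> < ysize \<kappa>}. c \<mu> * ndim \<kappa> \<mu>) = (\<Sum>\<mu>\<in>{\<mu>. ysize \<mu> < ysize \<kappa>}. c' \<mu> * ndim \<kappa> \<mu>)"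
    using step by (intro sum.cong) auto
  then show ?case using assms(1)[OF step.prems] unfolding split by simp
qed

text \<open>The coefficients obtained for diagrams with at most \<open>N\<close> rows do not depend on \<open>N \<ge> n\<close>, because they
  are determined by the diagrams of size at most \<open>n\<close>.\<close>

lemma realize_expansion:
  assumes F: "\<And>m. m \<in> Poly_Mapping.keys F \<Longrightarrow> mweight m \<le> n"
  obtains c where "\<And>\<kappa>. realize F \<kappa> = (\<Sum>\<mu>\<in>{\<mu>. ysize \<mu> \<le> n}. c \<mu> * fs_value \<mu> \<kappa>)"
proof -
  have "\<exists>c. \<forall>\<kappa>. ylength \<kappa> \<le> N \<longrightarrow> realize F \<kappa> * ndim \<kappa> empty_young = (\<Sum>\<mu>\<in>{\<mu>. ysize \<mu> \<le> n}. c \<mu> * ndim \<kappa> \<mu>)"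
    if N: "n \<le> N" for N
  proof -
    have "{\<mu>. ysize \<mu> \<le> n \<and> ylength \<mu> \<le> N} = {\<mu>. ysize \<mu> \<le> n}"
      using N ylength_le_ysize le_trans by blast
    moreover have "ifact_det_span N n (\<lambda>\<kappa>. reval (row_sums N \<kappa>) F * ifact_det N (maya N \<kappa>) (maya N empty_young))"
      by (rule ifact_det_span_mpoly[OF F])
    ultimately obtain c where c: "\<And>\<kappa>. ylength \<kappa> \<le> N \<Longrightarrow> reval (row_sums N \<kappa>) F * ifact_det N (maya N \<kappa>) (maya N empty_young)
        = (\<Sum>\<mu>\<in>{\<mu>. ysize \<mu> \<le> n}. c \<mu> * ndim \<kappa> \<mu>)"
      using ifact_det_span_expansion by fastforce
    have "ylength empty_young \<le> N" by (simp add: ylength_def empty_young.rep_eq)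
    then show ?thesis using c by (auto simp: realize_rows ifact_det_maya_eq_ndim)
  qed
  then obtain c where c: "\<And>N \<kappa>. n \<le> N \<Longrightarrow> ylength \<kappa> \<le> N \<Longrightarrow>
      realize F \<kappa> * ndim \<kappa> empty_young = (\<Sum>\<mu>\<in>{\<mu>. ysize \<mu> \<le> n}. c N \<mu> * ndim \<kappa> \<mu>)" by metis
  show ?thesis
  proof (rule that[of "c n"])
    fix \<kappa>
    define N where "N = max n (ylength \<kappa>)"
    have N: "n \<le> N" "ylength \<kappa> \<le> N" by (auto simp: N_def)
    have eq: "c N \<mu> = c n \<mu>" if "ysize \<mu> \<le> n" for \<mu>
    proof (rule ndim_independent[of n "c N" "c n", OF _ that])
      fix \<rho> assume "ysize \<rho> \<le> n"
      then have \<rho>: "ylength \<rho> \<le> n" using ylength_le_ysize le_trans by blast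
      show "(\<Sum>\<mu>\<in>{\<mu>. ysize \<mu> \<le> n}. c N \<mu> * ndim \<rho> \<mu>) = (\<Sum>\<mu>\<in>{\<mu>. ysize \<mu> \<le> n}. c n \<mu> * ndim \<rho> \<mu>)"
        using c[of n \<rho>] c[of N \<rho>] N \<rho> by simp
    qed
    have "realize F \<kappa> * ndim \<kappa> empty_young = (\<Sum>\<mu>\<in>{\<mu>. ysize \<mu> \<le> n}. c n \<mu> * ndim \<kappa> \<mu>)"
      unfolding c[OF N] by (intro sum.cong) (auto simp: eq)
    then show "realize F \<kappa> = (\<Sum>\<mu>\<in>{\<mu>. ysize \<mu> \<le> n}. c n \<mu> * fs_value \<mu> \<kappa>)"
      using ndim_empty_pos[of \<kappa>] by (simp add: fs_value_def sum_divide_distrib[symmetric] eq_divide_eq)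
  qed
qed

lemma fs_value_independent:
  assumes "\<And>\<kappa>. ysize \<kappa> \<le> n \<Longrightarrow> (\<Sum>\<mu>\<in>{\<mu>. ysize \<mu> \<le> n}. c \<mu> * fs_value \<mu> \<kappa>) = (\<Sum>\<mu>\<in>{\<mu>. ysize \<mu> \<le> n}. c' \<mu> * fs_value \<mu> \<kappa>)"
    and "ysize \<kappa> \<le> n"
  shows "c \<kappa> = c' \<kappa>"
proof (rule ndim_independent[OF _ assms(2)])
  fix \<kappa> assume "ysize \<kappa> \<le> n"
  from assms(1)[OF this] show "(\<Sum>\<mu>\<in>{\<mu>. ysize \<mu> \<le> n}. c \<mu> * ndim \<kappa> \<mu>) = (\<Sum>\<mu>\<in>{\<mu>. ysize \<mu> \<le> n}. c' \<mu> * ndim \<kappa> \<mu>)"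
    using ndim_empty_pos[of \<kappa>] by (simp add: fs_value_def sum_divide_distrib[symmetric])
qed

text \<open>The diagram \<open>\<kappa>\<close> as the multiset of its column lengths: \<open>k + 1\<close> occurs \<open>\<kappa>\<^sub>k - \<kappa>\<^bsub>k+1\<^esub>\<close> times, with
  rows numbered from 0. As an exponent vector this is a monomial in the power sums, of weight \<open>|\<kappa>|\<close>.\<close>

definition row_gaps :: "young \<Rightarrow> (nat \<Rightarrow>\<^sub>0 nat)" where
  "row_gaps \<kappa> = Abs_poly_mapping (\<lambda>k. yrow \<kappa> k - yrow \<kappa> (Suc k))"

lemma lookup_row_gaps: "Poly_Mapping.lookup (row_gaps \<kappa>) k = yrow \<kappa> k - yrow \<kappa> (Suc k)"
proof -
  have "finite {k. yrow \<kappa> k - yrow \<kappa> (Suc k) \<noteq> 0}"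
    by (rule finite_subset[OF _ finite_yrow[of \<kappa>]]) auto
  then show ?thesis by (simp add: row_gaps_def)
qed

lemma inj_row_gaps: "inj row_gaps"
proof (rule injI, rule young_eqI)
  fix \<kappa> \<kappa>' i assume eq: "row_gaps \<kappa> = row_gaps \<kappa>'"
  define N where "N = max i (max (ylength \<kappa>) (ylength \<kappa>'))"
  have "j \<le> N \<Longrightarrow> yrow \<kappa> (N - j) = yrow \<kappa>' (N - j)" for j
  proof (induction j)
    case 0
    have "yrow \<kappa> N = 0" "yrow \<kappa>' N = 0" by (auto simp: yrow_eq_0_iff N_def)
    then show ?case by simp
  next
    case (Suc j)
    then have j: "Suc (N - Suc j) = N - j" by simp
    have "yrow \<kappa> (N - Suc j) - yrow \<kappa> (N - j) = yrow \<kappa>' (N - Suc j) - yrow \<kappa>' (N - j)"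
      using arg_cong[OF eq, of "\<lambda>m. Poly_Mapping.lookup m (N - Suc j)"] by (simp add: lookup_row_gaps j)
    moreover have "yrow \<kappa> (N - j) \<le> yrow \<kappa> (N - Suc j)" "yrow \<kappa>' (N - j) \<le> yrow \<kappa>' (N - Suc j)"
      by (intro yrow_antimono; simp)+
    moreover have "yrow \<kappa> (N - j) = yrow \<kappa>' (N - j)" using Suc by simp
    ultimately show ?case by linarith
  qed
  from this[of "N - i"] show "yrow \<kappa> i = yrow \<kappa>' i" by (simp add: N_def)
qed

lemma mweight_row_gaps: "mweight (row_gaps \<kappa>) = ysize \<kappa>"
proof -
  define N where "N = ylength \<kappa>"
  have "mweight (row_gaps \<kappa>) = (\<Sum>k<N. Suc k * Poly_Mapping.lookup (row_gaps \<kappa>) k)"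
    unfolding mweight_def
  proof (rule sum.mono_neutral_left)
    have "yrow \<kappa> k = 0" if "\<not> k < N" for k using that by (simp add: yrow_eq_0_iff N_def)
    then show "Poly_Mapping.keys (row_gaps \<kappa>) \<subseteq> {..<N}"
      by (force simp: in_keys_iff lookup_row_gaps)
  qed (auto simp: in_keys_iff)
  also have "\<dots> = (\<Sum>k<N. yrow \<kappa> k)"
  proof -
    have "(\<Sum>k<M. Suc k * (yrow \<kappa> k - yrow \<kappa> (Suc k))) + M * yrow \<kappa> M = (\<Sum>k<M. yrow \<kappa> k)" for M
    proof (induction M)
      case (Suc M)
      have eq: "Suc M * (yrow \<kappa> M - yrow \<kappa> (Suc M)) + Suc M * yrow \<kappa> (Suc M) = Suc M * yrow \<kappa> M"
        using yrow_antimono[of M "Suc M" \<kappa>] by (simp only: add_mult_distrib2[symmetric]) simp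
      show ?case
        unfolding sum.lessThan_Suc add.assoc eq using Suc.IH by simp
    qed simp
    from this[of N] show ?thesis
      using yrow_eq_0_iff[of \<kappa> N] by (simp add: N_def lookup_row_gaps)
  qed
  finally show ?thesis by (simp add: ysize_eq_sum[of \<kappa> N] N_def)
qed

lemma realize_diff: "realize (F - G) \<kappa> = realize F \<kappa> - realize G \<kappa>"
  and realize_sum: "realize (sum H A) \<kappa> = (\<Sum>a\<in>A. realize (H a) \<kappa>)"
  and realize_Const_mult: "realize (Const c * F) \<kappa> = c * realize F \<kappa>"
  by (simp_all add: realize_def reval_simps)

lemma realize_inject: "(\<And>\<kappa>. realize F \<kappa> = realize G \<kappa>) \<Longrightarrow> F = G"
  using realize_eq_0[of "F - G"] by (simp add: realize_diff)

text \<open>The monomials indexed by diagrams of size at most \<open>n\<close> are independent already as functions on these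
  diagrams, so they interpolate any function there; the interpolant of \<open>fs_value \<mu>\<close> agrees with it
  everywhere because both are combinations of the functions \<open>fs_value \<nu>\<close>, \<open>|\<nu>| \<le> n\<close>.\<close>

lemma fs_value_realizable: "\<exists>F. \<forall>\<kappa>. realize F \<kappa> = fs_value \<mu> \<kappa>"
proof -
  define n where "n = ysize \<mu>"
  define Y where "Y = {\<kappa>. ysize \<kappa> \<le> n}"
  have Y: "finite Y" by (simp add: Y_def)
  define A where "A x y = realize (Poly_Mapping.single (row_gaps x) 1) y" for x y
  define G where "G u = (\<Sum>x\<in>Y. Poly_Mapping.single (row_gaps x) (u x))" for u :: "young \<Rightarrow> real"
  have G: "realize (G u) y = (\<Sum>x\<in>Y. u x * A x y)" for u y
    by (simp add: G_def A_def realize_def reval_simps mpoly_eval_single[OF comm_semiring_hom_id])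
  have weight: "mweight m \<le> n" if m: "m \<in> Poly_Mapping.keys (G u)" for m u
  proof -
    have "Poly_Mapping.keys (G u) \<subseteq> (\<Union>x\<in>Y. Poly_Mapping.keys (Poly_Mapping.single (row_gaps x) (u x)))"
      unfolding G_def by (rule Poly_Mapping.keys_sum)
    then obtain x where "x \<in> Y" "m \<in> Poly_Mapping.keys (Poly_Mapping.single (row_gaps x) (u x))"
      using m by blast
    then have "x \<in> Y" "m = row_gaps x" by (auto split: if_splits)
    then show ?thesis by (simp add: mweight_row_gaps Y_def)
  qed
  have lookup_G: "Poly_Mapping.lookup (G u) (row_gaps x) = u x" if "x \<in> Y" for u x
  proof -
    have "Poly_Mapping.lookup (G u) (row_gaps x) = (\<Sum>x'\<in>Y. if x' = x then u x else 0)"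
      unfolding G_def lookup_sum
      by (intro sum.cong) (auto simp: lookup_single when_def dest: injD[OF inj_row_gaps])
    then show ?thesis using that Y by simp
  qed
  have inj: "\<forall>u. (\<forall>y\<in>Y. (\<Sum>x\<in>Y. u x * A x y) = 0) \<longrightarrow> (\<forall>x\<in>Y. u x = 0)"
  proof (intro allI impI ballI)
    fix u x assume zero: "\<forall>y\<in>Y. (\<Sum>x\<in>Y. u x * A x y) = 0" and x: "x \<in> Y"
    obtain c where c: "\<And>\<kappa>. realize (G u) \<kappa> = (\<Sum>\<nu>\<in>{\<nu>. ysize \<nu> \<le> n}. c \<nu> * fs_value \<nu> \<kappa>)"
      using realize_expansion[OF weight[where u = u]] by blast
    have "c \<kappa> = 0" if "ysize \<kappa> \<le> n" for \<kappa>
    proof (rule fs_value_independent[of n c "\<lambda>_. 0", OF _ that])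
      fix \<kappa> assume "ysize \<kappa> \<le> n"
      then have "realize (G u) \<kappa> = 0" using zero by (simp add: G Y_def)
      then show "(\<Sum>\<nu>\<in>{\<nu>. ysize \<nu> \<le> n}. c \<nu> * fs_value \<nu> \<kappa>) = (\<Sum>\<nu>\<in>{\<nu>. ysize \<nu> \<le> n}. 0 * fs_value \<nu> \<kappa>)"
        by (simp add: c)
    qed
    then have "realize (G u) \<kappa> = 0" for \<kappa> by (simp add: c)
    then have "G u = 0" by (rule realize_eq_0)
    then show "u x = 0" using lookup_G[OF x, of u] by simp
  qed
  obtain u where u: "\<And>y. y \<in> Y \<Longrightarrow> (\<Sum>x\<in>Y. u x * A x y) = fs_value \<mu> y"
    using square_system_solvable[where Y = Y and A = A and f = "fs_value \<mu>", OF Y inj] by blast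
  obtain c where c: "\<And>\<kappa>. realize (G u) \<kappa> = (\<Sum>\<nu>\<in>{\<nu>. ysize \<nu> \<le> n}. c \<nu> * fs_value \<nu> \<kappa>)"
    using realize_expansion[OF weight[where u = u]] by blast
  have delta: "(\<Sum>\<nu>\<in>{\<nu>. ysize \<nu> \<le> n}. of_bool (\<nu> = \<mu>) * fs_value \<nu> \<kappa>) = fs_value \<mu> \<kappa>" for \<kappa>
  proof -
    have "(\<Sum>\<nu>\<in>{\<nu>. ysize \<nu> \<le> n}. of_bool (\<nu> = \<mu>) * fs_value \<nu> \<kappa>) = (\<Sum>\<nu>\<in>{\<nu>. ysize \<nu> \<le> n}. if \<nu> = \<mu> then fs_value \<mu> \<kappa> else 0)"
      by (intro sum.cong) auto
    then show ?thesis by (simp add: n_def)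
  qed
  have "c \<kappa> = of_bool (\<kappa> = \<mu>)" if "ysize \<kappa> \<le> n" for \<kappa>
  proof (rule fs_value_independent[of n c "\<lambda>\<kappa>. of_bool (\<kappa> = \<mu>)", OF _ that])
    fix \<kappa> assume "ysize \<kappa> \<le> n"
    then have "realize (G u) \<kappa> = fs_value \<mu> \<kappa>" unfolding G by (intro u) (simp add: Y_def)
    then show "(\<Sum>\<nu>\<in>{\<nu>. ysize \<nu> \<le> n}. c \<nu> * fs_value \<nu> \<kappa>) = (\<Sum>\<nu>\<in>{\<nu>. ysize \<nu> \<le> n}. of_bool (\<nu> = \<mu>) * fs_value \<nu> \<kappa>)"
      by (simp add: c delta del: of_bool_eq_iff)
  qed
  then have "realize (G u) \<kappa> = (\<Sum>\<nu>\<in>{\<nu>. ysize \<nu> \<le> n}. of_bool (\<nu> = \<mu>) * fs_value \<nu> \<kappa>)" for \<kappa>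
    unfolding c by (intro sum.cong) auto
  then show ?thesis unfolding delta by blast
qed

text \<open>Vandermonde's determinant for falling powers. As a polynomial in the first point it vanishes at the
  other points, and its leading coefficient is the determinant of the remaining points.\<close>

lemma falling_vandermonde:
  fixes x :: "nat \<Rightarrow> real"
  assumes "inj_on x {..<N}"
  shows "Determinant.det (Matrix.mat N N (\<lambda>(i, j). falling (x j) (N - Suc i)))
    = (\<Prod>(i, j)\<in>{(i, j). i < j \<and> j < N}. x i - x j)"
  using assms
proof (induction N arbitrary: x)
  case 0
  then show ?case by (simp add: det_mat_leibniz)
next
  case (Suc N)
  define M where "M y = Matrix.mat (Suc N) (Suc N) (\<lambda>(i, j). falling (if j = 0 then y else x j) (Suc N - Suc i))" for y
  have M: "M y \<in> carrier_mat (Suc N) (Suc N)" for y by (simp add: M_def)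
  define cof where "cof i = (-1) ^ i * Determinant.det (mat_delete (M 0) i 0)" for i
  define q where "q = (\<Sum>i<Suc N. Polynomial.smult (cof i) (\<Prod>k<N - i. [:- real k, 1:]))"
  have del: "mat_delete (M y) i 0 = mat_delete (M 0) i 0" for y i
    unfolding mat_delete_def M_def by (intro eq_matI) auto
  have det: "Determinant.det (M y) = poly q y" for y
  proof -
    have "Determinant.det (M y) = (\<Sum>i<Suc N. M y $$ (i, 0) * cofactor (M y) i 0)"
      using laplace_expansion_column[OF M, of 0 y] by simp
    also have "\<dots> = (\<Sum>i<Suc N. falling y (N - i) * cof i)"
    proof (intro sum.cong refl)
      fix i assume "i \<in> {..<Suc N}"
      then have "M y $$ (i, 0) = falling y (N - i)" by (simp add: M_def)
      then show "M y $$ (i, 0) * cofactor (M y) i 0 = falling y (N - i) * cof i"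
        by (simp add: cofactor_def del[of y] cof_def)
    qed
    also have "\<dots> = poly q y"
    proof -
      have "poly (\<Prod>k<n. [:- real k, 1:]) y = falling y n" for n
        by (simp add: poly_prod falling_def)
      then show ?thesis by (simp only: q_def poly_sum poly_smult mult.commute)
    qed
    finally show ?thesis .
  qed
  have deg_prod: "degree (\<Prod>k<n. [:- real k, 1:]) = n" for n
    by (subst degree_prod_eq_sum_degree) auto
  have lead_prod: "coeff (\<Prod>k<n. [:- real k, 1:]) n = 1" for n
    using lead_coeff_prod[of "\<lambda>k. [:- real k, 1:]" "{..<n}"] deg_prod[of n] by simp
  have deg_q: "degree q \<le> N"
    unfolding q_def by (intro degree_sum_le) (auto intro!: order_trans[OF degree_smult_le] simp: deg_prod)
  have "coeff q N = (\<Sum>i<Suc N. if i = 0 then cof 0 else 0)"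
    unfolding q_def coeff_sum
  proof (intro sum.cong refl)
    fix i assume "i \<in> {..<Suc N}"
    then show "coeff (Polynomial.smult (cof i) (\<Prod>k<N - i. [:- real k, 1:])) N = (if i = 0 then cof 0 else 0)"
      using lead_prod[of N] coeff_eq_0[of "\<Prod>k<N - i. [:- real k, 1:]" N] deg_prod[of "N - i"] by auto
  qed
  then have coeff_q: "coeff q N = cof 0" by simp
  define R where "R = (\<Prod>j\<in>{1..N}. [:- x j, 1:])"
  have deg_R: "degree R = N" unfolding R_def by (subst degree_prod_eq_sum_degree) auto
  have coeff_R: "coeff R N = 1"
    using lead_coeff_prod[of "\<lambda>j. [:- x j, 1:]" "{1..N}"] deg_R by (simp add: R_def)
  have "q = Polynomial.smult (cof 0) R"
  proof (rule ccontr)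
    define r where "r = q - Polynomial.smult (cof 0) R"
    assume "q \<noteq> Polynomial.smult (cof 0) R"
    then have r: "r \<noteq> 0" by (simp add: r_def)
    have "degree r \<le> N" unfolding r_def
      using deg_q deg_R by (intro degree_diff_le) (auto intro: order_trans[OF degree_smult_le])
    moreover have "coeff r N = 0" by (simp add: r_def coeff_q coeff_R)
    ultimately have deg_r: "degree r < N \<or> N = 0 \<and> r = 0"
      using r by (metis leading_coeff_0_iff le_neq_implies_less)
    have "x ` {1..N} \<subseteq> {y. poly r y = 0}"
    proof (rule image_subsetI)
      fix j assume j: "j \<in> {1..N}"
      have "Determinant.det (M (x j)) = 0"
        using j by (intro det_identical_columns[OF M, of 0 j]) (auto simp: M_def intro!: eq_vecI)
      moreover have "poly R (x j) = 0"
        using j by (auto simp: R_def poly_prod intro!: prod_zero)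
      ultimately show "x j \<in> {y. poly r y = 0}" by (simp add: r_def det)
    qed
    then have "card (x ` {1..N}) \<le> card {y. poly r y = 0}"
      using r by (intro card_mono poly_roots_finite)
    moreover have "card (x ` {1..N}) = N"
      using Suc.prems by (subst card_image) (auto simp: inj_on_def)
    moreover have "card {y. poly r y = 0} \<le> degree r" using r by (rule card_poly_roots_bound)
    ultimately show False using deg_r r by linarith
  qed
  then have "Determinant.det (M (x 0)) = cof 0 * (\<Prod>j\<in>{1..N}. x 0 - x j)"
    by (simp add: det R_def poly_prod)
  also have "cof 0 = Determinant.det (Matrix.mat N N (\<lambda>(i, j). falling (x (Suc j)) (N - Suc i)))"
    unfolding cof_def by (simp, intro arg_cong[where f = Determinant.det])
      (auto simp: mat_delete_def M_def intro!: eq_matI)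
  also have "\<dots> = (\<Prod>(i, j)\<in>{(i, j). i < j \<and> j < N}. x (Suc i) - x (Suc j))"
    using Suc.prems by (intro Suc.IH) (auto simp: inj_on_def)
  also have "\<dots> * (\<Prod>j\<in>{1..N}. x 0 - x j) = (\<Prod>(i, j)\<in>{(i, j). i < j \<and> j < Suc N}. x i - x j)"
  proof -
    define P where "P = map_prod Suc Suc ` {(i, j). i < j \<and> j < N}"
    have "{(i, j). i < j \<and> j < Suc N} = P \<union> Pair 0 ` {1..N}"
    proof (intro equalityI subsetI)
      fix y assume "y \<in> {(i, j). i < j \<and> j < Suc N}"
      then obtain i j where y: "y = (i, j)" "i < j" "j < Suc N" by auto
      show "y \<in> P \<union> Pair 0 ` {1..N}"
      proof (cases i)
        case 0
        then show ?thesis using y by auto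
      next
        case (Suc i')
        obtain j' where "j = Suc j'" using y by (cases j) auto
        then have "y = map_prod Suc Suc (i', j')" "(i', j') \<in> {(i, j). i < j \<and> j < N}" using y Suc by auto
        then show ?thesis unfolding P_def by blast
      qed
    qed (auto simp: P_def)
    moreover have "P \<inter> Pair 0 ` {1..N} = {}" by (auto simp: P_def)
    moreover have fin: "finite {(i, j). i < j \<and> j < N}"
      by (rule finite_subset[of _ "{..<N} \<times> {..<N}"]) auto
    ultimately have "(\<Prod>(i, j)\<in>{(i, j). i < j \<and> j < Suc N}. x i - x j)
        = (\<Prod>(i, j)\<in>P. x i - x j) * (\<Prod>(i, j)\<in>Pair 0 ` {1..N}. x i - x j)"
      by (simp add: prod.union_disjoint P_def)
    also have "(\<Prod>(i, j)\<in>P. x i - x j) = (\<Prod>(i, j)\<in>{(i, j). i < j \<and> j < N}. x (Suc i) - x (Suc j))"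
      unfolding P_def by (subst prod.reindex) (auto simp: inj_on_def case_prod_beta)
    also have "(\<Prod>(i, j)\<in>Pair 0 ` {1..N}. x i - x j) = (\<Prod>j\<in>{1..N}. x 0 - x j)"
      by (subst prod.reindex) (auto simp: inj_on_def)
    finally show ?thesis by simp
  qed
  also have "M (x 0) = Matrix.mat (Suc N) (Suc N) (\<lambda>(i, j). falling (x j) (Suc N - Suc i))"
    unfolding M_def by (intro cong_mat) auto
  finally show ?case by (simp add: mult.commute)
qed


section \<open>Identification of the Frobenius--Schur functions\<close>

lemma mpoly_eqI_reval: "(\<And>x. reval x P = reval x Q) \<Longrightarrow> P = Q"
  using mpoly_eq_0_if_vanishing[of 0 "P - Q"] by (simp add: reval_simps)

lemma comm_ring_hom_reval: "comm_ring_hom (reval x)"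
  by unfold_locales (simp_all add: reval_simps)

lemma falling_hom: "reval x (falling F n) = falling (reval x F) n"
  by (simp add: falling_def reval_simps)

text \<open>The quotient that defines the factorial Schur polynomial is exhibited instead of proving divisibility
  by the Vandermonde product: it is a shift of the polynomial attached to \<open>G\<close>.\<close>

lemma shifted_schur_eq:
  assumes G: "\<And>\<kappa>. realize G \<kappa> = fs_value \<nu> \<kappa>"
  shows "shifted_schur \<nu> N = sym_to_shifted G N"
proof (cases "ylength \<nu> \<le> N")
  case False
  have "sym_to_shifted G N = 0"
  proof (rule sym_to_shifted_eq_0)
    fix \<kappa> assume "ylength \<kappa> \<le> N"
    then have "\<not> contained \<nu> \<kappa>" using False ylength_mono[of \<nu> \<kappa>] by auto
    then show "realize G \<kappa> = 0" by (simp add: G fs_value_def ndim_not_contained)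
  qed
  moreover have "mpoly_eval Const f 0 = 0" for f :: "nat \<Rightarrow> real mpoly"
    by (simp add: mpoly_eval_0[OF comm_semiring_hom_Const])
  ultimately show ?thesis using False by (simp add: shifted_schur_def factorial_schur_def)
next
  case True
  define P where "P = mpoly_eval Const (\<lambda>i. Var i - of_nat (N - Suc i)) (sym_to_shifted G N)"
  define V :: "real mpoly" where "V = (\<Prod>(i, j)\<in>{(i, j). i < j \<and> j < N}. Var i - Var j)"
  define A where "A = Matrix.mat N N (\<lambda>(i, j). falling (Var j :: real mpoly) (yrow \<nu> i + (N - Suc i)))"
  have fin: "finite {(i, j). i < j \<and> j < N}"
    by (rule finite_subset[of _ "{..<N} \<times> {..<N}"]) auto
  have reval_V: "reval x V = (\<Prod>(i, j)\<in>{(i, j). i < j \<and> j < N}. x i - x j)" for x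
    by (simp add: V_def case_prod_beta reval_simps)
  have reval_A: "reval x (Determinant.det A) = Determinant.det (Matrix.mat N N (\<lambda>(i, j). falling (x j) (yrow \<nu> i + (N - Suc i))))" for x
  proof -
    interpret comm_ring_hom "reval x" by (rule comm_ring_hom_reval)
    have "reval x (Determinant.det A) = Determinant.det (map_mat (reval x) A)" by (rule hom_det[symmetric])
    also have "map_mat (reval x) A = Matrix.mat N N (\<lambda>(i, j). falling (x j) (yrow \<nu> i + (N - Suc i)))"
      by (intro eq_matI) (auto simp: A_def falling_hom reval_simps)
    finally show ?thesis .
  qed
  have "P * V - Determinant.det A = 0"
  proof (rule mpoly_eq_0_if_vanishing[of N])
    fix y :: "nat \<Rightarrow> nat" assume y: "\<And>i j. i < j \<Longrightarrow> j < N \<Longrightarrow> y j < y i"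
    have ge: "N - Suc i \<le> y i" if "i < N" for i
    proof -
      have "j < N \<longrightarrow> j \<le> y (N - Suc j)" for j
      proof (induction j)
        case (Suc j)
        show ?case
        proof
          assume "Suc j < N"
          then have "y (N - Suc j) < y (N - Suc (Suc j))" by (intro y) auto
          then show "Suc j \<le> y (N - Suc (Suc j))" using Suc \<open>Suc j < N\<close> by simp
        qed
      qed simp
      from this[of "N - Suc i"] show ?thesis using that by simp
    qed
    have mono: "y j - (N - Suc j) \<le> y i - (N - Suc i)" if "i \<le> j" "j < N" for i j
      using that
    proof (induction j)
      case (Suc j)
      show ?case
      proof (cases "i = Suc j")
        case False
        then have "y j - (N - Suc j) \<le> y i - (N - Suc i)" using Suc by simp
        moreover have "y (Suc j) - (N - Suc (Suc j)) \<le> y j - (N - Suc j)"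
          using y[of j "Suc j"] Suc.prems by simp
        ultimately show ?thesis by simp
      qed simp
    qed simp
    obtain \<kappa> where \<kappa>: "ylength \<kappa> \<le> N" "\<And>i. i < N \<Longrightarrow> yrow \<kappa> i = y i - (N - Suc i)"
      using young_of_rows[of N "\<lambda>i. y i - (N - Suc i)", OF mono] by blast
    have row: "real (y i) - real (N - Suc i) = real (yrow \<kappa> i)" if "i < N" for i
      using \<kappa>(2)[OF that] ge[OF that] by (simp add: of_nat_diff)
    have "reval (\<lambda>i. real (y i)) P = reval (row_power_sum N (\<lambda>i. real (y i) - real (N - Suc i))) G"
      by (simp add: P_def reval_simps reval_sym_to_shifted)
    also have "row_power_sum N (\<lambda>i. real (y i) - real (N - Suc i)) = row_sums N \<kappa>"
      unfolding row_power_sum_def by (intro ext sum.cong refl) (simp only: row lessThan_iff)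
    also have "reval (row_sums N \<kappa>) G = ndim \<kappa> \<nu> / ndim \<kappa> empty_young"
      by (simp add: G fs_value_def flip: realize_rows[OF \<kappa>(1)])
    finally have P: "reval (\<lambda>i. real (y i)) P = ndim \<kappa> \<nu> / ndim \<kappa> empty_young" .
    have my: "int (y j) = maya N \<kappa> j" if "j < N" for j
      using row[OF that] that by (simp add: maya_def)
    have det: "Determinant.det (Matrix.mat N N (\<lambda>(i, j). falling (real (y j)) (yrow \<mu> i + (N - Suc i))))
        = (\<Prod>j = 0..<N. fact (y j)) * ndim \<kappa> \<mu>" if "ylength \<mu> \<le> N" for \<mu>
    proof -
      have "ifact_det N (\<lambda>j. int (y j)) (\<lambda>i. int (yrow \<mu> i + (N - Suc i))) = ifact_det N (maya N \<kappa>) (maya N \<mu>)"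
        by (intro ifact_det_cong) (auto simp: my, auto simp: maya_def)
      then show ?thesis using falling_det[of N y] \<kappa>(1) that by (simp add: ifact_det_maya_eq_ndim)
    qed
    have "inj_on (\<lambda>i. real (y i)) {..<N}"
    proof (rule inj_onI)
      fix i j assume "i \<in> {..<N}" "j \<in> {..<N}" "real (y i) = real (y j)"
      then show "i = j" using y[of i j] y[of j i] by (cases i j rule: linorder_cases) auto
    qed
    from falling_vandermonde[OF this]
    have "reval (\<lambda>i. real (y i)) V = (\<Prod>j = 0..<N. fact (y j)) * ndim \<kappa> empty_young"
      using det[of empty_young] by (simp add: reval_V empty_young.rep_eq ylength_def)
    then show "reval (\<lambda>i. real (y i)) (P * V - Determinant.det A) = 0"
      using ndim_empty_pos[of \<kappa>] True by (simp add: reval_simps P reval_A det)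
  qed
  then have PV: "P * V = Determinant.det A" by simp
  \<comment> \<open>The product does not vanish at the point \<open>0, 1, 2, \<dots>\<close>.\<close>
  have "V \<noteq> 0"
  proof
    assume "V = 0"
    then have "reval (\<lambda>i. real i) V = 0" by (simp add: reval_simps)
    then show False using fin unfolding reval_V by (auto simp: prod_zero_iff)
  qed
  then have "factorial_schur \<nu> N = P"
    using True PV unfolding factorial_schur_def V_def[symmetric] A_def[symmetric]
    by (auto intro!: the_equality simp flip: PV)
  then have "shifted_schur \<nu> N = mpoly_eval Const (\<lambda>i. Var i + of_nat (N - Suc i)) P"
    by (simp add: shifted_schur_def)
  also have "\<dots> = sym_to_shifted G N"
    unfolding P_def by (rule mpoly_eqI_reval) (simp add: reval_simps)
  finally show ?thesis .
qed

lemma FS_eqI: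
  assumes G: "\<And>\<kappa>. realize G \<kappa> = fs_value \<nu> \<kappa>"
  shows "FS \<nu> = G"
  unfolding FS_def shifted_to_sym_def
proof (rule the_equality)
  show "\<forall>N\<ge>1. sym_to_shifted G N = shifted_schur \<nu> N" by (simp add: shifted_schur_eq[OF G])
  fix F assume F: "\<forall>N\<ge>1. sym_to_shifted F N = shifted_schur \<nu> N"
  show "F = G"
  proof (rule realize_inject)
    fix \<kappa>
    define N where "N = max 1 (ylength \<kappa>)"
    have "sym_to_shifted F N = sym_to_shifted G N"
      using F by (simp add: shifted_schur_eq[OF G] N_def)
    then show "realize F \<kappa> = realize G \<kappa>"
      using realize_rows[of \<kappa> N] by (simp add: N_def flip: reval_sym_to_shifted)
  qed
qed

theorem realize_FS: "realize (FS \<nu>) \<kappa> = fs_value \<nu> \<kappa>"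
  using fs_value_realizable[of \<nu>] FS_eqI by metis

lemma FS_spans:
  obtains n c where "F = (\<Sum>\<mu>\<in>{\<mu>. ysize \<mu> \<le> n}. Const (c \<mu>) * FS \<mu>)"
proof -
  obtain n where n: "\<And>m. m \<in> Poly_Mapping.keys F \<Longrightarrow> mweight m \<le> n"
    using finite_nat_set_iff_bounded_le[of "mweight ` Poly_Mapping.keys F"] by auto
  obtain c where c: "\<And>\<kappa>. realize F \<kappa> = (\<Sum>\<mu>\<in>{\<mu>. ysize \<mu> \<le> n}. c \<mu> * fs_value \<mu> \<kappa>)"
    using realize_expansion[OF n] by blast
  have "F = (\<Sum>\<mu>\<in>{\<mu>. ysize \<mu> \<le> n}. Const (c \<mu>) * FS \<mu>)"
    by (rule realize_inject) (simp add: c realize_sum realize_Const_mult realize_FS)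
  then show ?thesis by (rule that)
qed


section \<open>The moment functional\<close>

lemma lookup_complexify: "Poly_Mapping.lookup (complexify F) m = of_real (Poly_Mapping.lookup F m)"
  by (simp add: complexify_def Poly_Mapping.map.rep_eq when_def)

lemma complexify_sum: "complexify (sum F A) = (\<Sum>a\<in>A. complexify (F a))"
  by (rule poly_mapping_eqI) (simp add: lookup_complexify lookup_sum)

lemma complexify_Const_mult: "complexify (Const c * F) = Const (of_real c) * complexify F"
  by (rule poly_mapping_eqI) (simp add: lookup_complexify lookup_Const_mult)

lemma complexify_Re_Im:
  "F = complexify (Poly_Mapping.map Re F) + Const \<i> * complexify (Poly_Mapping.map Im F)"
  by (rule poly_mapping_eqI)
     (simp add: lookup_complexify lookup_add lookup_Const_mult Poly_Mapping.map.rep_eq when_def complex_eq_iff)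

text \<open>The value at \<open>\<kappa>\<close> of an element of the complexification of Sym.\<close>

definition ceval :: "young \<Rightarrow> symC \<Rightarrow> complex" where
  "ceval \<kappa> = mpoly_eval (\<lambda>c. c) (\<lambda>k. complex_of_real (power_sum (Suc k) \<kappa>))"

lemma ceval_add: "ceval \<kappa> (F + G) = ceval \<kappa> F + ceval \<kappa> G"
  and ceval_Const_mult: "ceval \<kappa> (Const c * F) = c * ceval \<kappa> F"
  by (simp_all add: ceval_def mpoly_eval_add[OF comm_semiring_hom_id] mpoly_eval_mult[OF comm_semiring_hom_id]
      mpoly_eval_Const[OF comm_semiring_hom_id])

lemma ceval_complexify: "ceval \<kappa> (complexify F) = of_real (realize F \<kappa>)"
proof -
  have "Poly_Mapping.keys (complexify F) = Poly_Mapping.keys F"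
    by (auto simp: in_keys_iff lookup_complexify)
  then show ?thesis
    by (simp add: ceval_def realize_def mpoly_eval_def lookup_complexify)
qed

text \<open>For admissible parameters each factor \<open>(z + c)(z' + c)\<close> is real.\<close>

lemma content_product_real:
  assumes "admissible z z'"
  shows "(z + of_real c) * (z' + of_real c) = of_real (content_weight.box_weight (Re (z + z')) (Re (z * z')) c)"
  using admissible_cases[OF assms]
proof
  assume "z \<in> \<real> \<and> z' \<in> \<real>"
  then show ?thesis
    by (auto simp: content_weight.box_weight_def power2_eq_square algebra_simps elim!: Reals_cases)
next
  assume "z' = cnj z"
  then show ?thesis
    by (simp add: content_weight.box_weight_def power2_eq_square complex_eq_iff algebra_simps)
qed

lemma skew_poch_product:
  assumes "admissible z z'"
  shows "skew_poch z \<nu> \<mu> * skew_poch z' \<nu> \<mu> = of_real (content_weight.skew_weight (Re (z + z')) (Re (z * z')) \<nu> \<mu>)"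
proof -
  have "(z + of_int (int j - int i)) * (z' + of_int (int j - int i))
      = of_real (content_weight.box_weight (Re (z + z')) (Re (z * z')) (real j - real i))" for i j :: nat
    using content_product_real[OF assms, of "real j - real i"] by simp
  then show ?thesis
    by (simp add: skew_poch_def content_weight.skew_weight_def case_prod_beta flip: prod.distrib)
qed

lemma meixner_weight_admissible:
  assumes "admissible z z'" "0 < \<xi>" "\<xi> < 1"
  shows "meixner_weight (Re (z + z')) (Re (z * z')) \<xi>"
proof
  fix \<kappa>
  have "ypoch z \<kappa> * ypoch z' \<kappa> \<in> \<real>\<^sub>\<ge>\<^sub>0" using assms(1) by (simp add: admissible_def)
  then show "0 \<le> content_weight.skew_weight (Re (z + z')) (Re (z * z')) \<kappa> empty_young"
    by (simp add: ypoch_def skew_poch_product[OF assms(1)])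
qed (use assms in auto)

context
  fixes z z' :: complex and \<xi> s t :: real
  assumes adm: "admissible z z'" and xi: "0 < \<xi>" "\<xi> < 1"
    and s: "s = Re (z + z')" and t: "t = Re (z * z')"
begin

interpretation W: meixner_weight s t \<xi>
  unfolding s t by (rule meixner_weight_admissible[OF adm xi])

lemma z_measure_eq: "z_measure z z' \<xi> \<kappa> = W.zweight \<kappa>"
proof -
  have "z * z' = of_real t"
    using content_product_real[OF adm, folded s t, of 0] by (simp add: content_weight.box_weight_def)
  then have p: "of_real (1 - \<xi>) powr (z * z') = complex_of_real ((1 - \<xi>) powr t)"
    using xi by (metis powr_of_real less_imp_le diff_ge_0_iff_ge)
  have "ypoch z \<kappa> * ypoch z' \<kappa> = of_real (W.skew_weight \<kappa> empty_young)"
    by (simp add: ypoch_def skew_poch_product[OF adm, folded s t])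
  moreover have "of_nat (ydim \<kappa>) / fact (ysize \<kappa>) = complex_of_real (ndim \<kappa> empty_young)"
    by (simp add: ydim_def ndim_def)
  ultimately have "z_weight z z' \<xi> \<kappa> = complex_of_real (W.zweight \<kappa>)"
    unfolding z_weight_def p W.zweight_def mult.assoc[of _ "ypoch z \<kappa>"] by simp
  then show ?thesis by (simp add: z_measure_def)
qed

lemma meixner_coeff_eq:
  assumes "contained \<mu> \<nu>"
  shows "meixner_coeff z z' \<xi> \<nu> \<mu> = of_real (W.meixner_entry \<nu> \<mu>)"
proof -
  have "meixner_coeff z z' \<xi> \<nu> \<mu> = ((-1) ^ (ysize \<nu> - ysize \<mu>) * of_real (\<xi> / (1 - \<xi>)) ^ (ysize \<nu> - ysize \<mu>)) *
     (of_nat (skew_dim \<nu> \<mu>) / fact (ysize \<nu> - ysize \<mu>)) * of_real (W.skew_weight \<nu> \<mu>)"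
    unfolding meixner_coeff_def skew_poch_product[OF adm, folded s t, symmetric] by (simp only: mult.assoc)
  also have "of_nat (skew_dim \<nu> \<mu>) / fact (ysize \<nu> - ysize \<mu>) = complex_of_real (ndim \<nu> \<mu>)"
    using assms by (simp add: ndim_def)
  also have "(-1) ^ (ysize \<nu> - ysize \<mu>) * of_real (\<xi> / (1 - \<xi>)) ^ (ysize \<nu> - ysize \<mu>)
      = complex_of_real ((- W.eta) ^ (ysize \<nu> - ysize \<mu>))"
    by (simp add: W.eta_def power_minus[of "\<xi> / (1 - \<xi>)"] del: of_real_divide)
  finally show ?thesis by (simp add: W.meixner_entry_def)
qed

lemma meixner_eq:
  "meixner z z' \<xi> \<nu> = complexify (\<Sum>\<mu>\<in>{\<mu>. contained \<mu> \<nu>}. Const (W.meixner_entry \<nu> \<mu>) * FS \<mu>)"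
  unfolding meixner_def complexify_sum complexify_Const_mult
  by (intro sum.cong) (auto simp: meixner_coeff_eq)

lemma realize_real_meixner: "realize (real_meixner z z' \<xi> \<nu>) = W.meixner_value \<nu>"
proof
  fix \<kappa>
  have "real_meixner z z' \<xi> \<nu> = (\<Sum>\<mu>\<in>{\<mu>. contained \<mu> \<nu>}. Const (W.meixner_entry \<nu> \<mu>) * FS \<mu>)"
    unfolding real_meixner_def meixner_eq
    by (rule poly_mapping_eqI) (simp add: Poly_Mapping.map.rep_eq when_def lookup_complexify)
  then show "realize (real_meixner z z' \<xi> \<nu>) \<kappa> = W.meixner_value \<nu> \<kappa>"
    by (simp add: realize_sum realize_Const_mult realize_FS W.meixner_value_def)
qed

lemma ceval_meixner: "ceval \<kappa> (meixner z z' \<xi> \<nu>) = of_real (W.meixner_value \<nu> \<kappa>)"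
  by (simp add: ceval_complexify realize_real_meixner flip: complexify_real_meixner[OF adm])

lemma realize_summable: "(\<lambda>\<kappa>. realize F \<kappa> * z_measure z z' \<xi> \<kappa>) summable_on UNIV"
proof -
  obtain n c where F: "F = (\<Sum>\<mu>\<in>{\<mu>. ysize \<mu> \<le> n}. Const (c \<mu>) * FS \<mu>)" using FS_spans by blast
  have "((\<lambda>\<kappa>. \<Sum>\<mu>\<in>{\<mu>. ysize \<mu> \<le> n}. c \<mu> * (fs_value \<mu> \<kappa> * W.zweight \<kappa>)) has_sum
      (\<Sum>\<mu>\<in>{\<mu>. ysize \<mu> \<le> n}. c \<mu> * infsum (\<lambda>\<kappa>. fs_value \<mu> \<kappa> * W.zweight \<kappa>) UNIV)) UNIV"
    by (intro has_sum_sum_finite has_sum_cmult_right has_sum_infsum W.fs_value_summable finite_ysize_le)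
  also have "(\<lambda>\<kappa>. \<Sum>\<mu>\<in>{\<mu>. ysize \<mu> \<le> n}. c \<mu> * (fs_value \<mu> \<kappa> * W.zweight \<kappa>)) = (\<lambda>\<kappa>. realize F \<kappa> * z_measure z z' \<xi> \<kappa>)"
    by (simp add: F realize_sum realize_Const_mult realize_FS z_measure_eq sum_distrib_right mult.assoc)
  finally show ?thesis by (auto simp: summable_on_def)
qed

lemma ceval_summable: "(\<lambda>\<kappa>. ceval \<kappa> F * of_real (z_measure z z' \<xi> \<kappa>)) summable_on UNIV"
proof -
  have real: "(\<lambda>\<kappa>. ceval \<kappa> (complexify G) * of_real (z_measure z z' \<xi> \<kappa>)) summable_on UNIV" for G
    using summable_on_of_real[OF realize_summable[of G], where 'a = complex] by (simp add: ceval_complexify)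
  have "(\<lambda>\<kappa>. ceval \<kappa> (complexify (Poly_Mapping.map Re F)) * of_real (z_measure z z' \<xi> \<kappa>)
      + \<i> * (ceval \<kappa> (complexify (Poly_Mapping.map Im F)) * of_real (z_measure z z' \<xi> \<kappa>))) summable_on UNIV"
    by (intro summable_on_add summable_on_cmult_right real)
  then show ?thesis
    by (subst complexify_Re_Im) (simp add: ceval_add ceval_Const_mult distrib_right mult.assoc)
qed

text \<open>The expectation under the z-measure, on the complexification of Sym.\<close>

definition expect :: "symC \<Rightarrow> complex" where
  "expect F = infsum (\<lambda>\<kappa>. ceval \<kappa> F * of_real (z_measure z z' \<xi> \<kappa>)) UNIV"

lemma expect_linear: "Vector_Spaces.linear (\<lambda>c F. Const c * F) (*) expect"
  unfolding Vector_Spaces.linear_iff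
proof (intro conjI allI)
  show "vector_space (\<lambda>c (F :: symC). Const c * F)"
    by unfold_locales (auto simp: Const_add Const_mult algebra_simps)
  show "vector_space ((*) :: complex \<Rightarrow> complex \<Rightarrow> complex)"
    by unfold_locales (auto simp: algebra_simps)
  show "expect (F + G) = expect F + expect G" for F G
    unfolding expect_def ceval_add distrib_right by (intro infsum_add ceval_summable)
  show "expect (Const c * F) = c * expect F" for c F
    unfolding expect_def ceval_Const_mult mult.assoc by (rule infsum_cmult_right')
qed

lemma expect_meixner: "expect (meixner z z' \<xi> \<nu>) = (if \<nu> = empty_young then 1 else 0)"
proof -
  have "((\<lambda>\<kappa>. complex_of_real (W.meixner_value \<nu> \<kappa> * W.zweight \<kappa>)) has_sum complex_of_real (of_bool (\<nu> = empty_young))) UNIV"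
    unfolding has_sum_of_real_iff by (rule W.meixner_value_expectation)
  then have "expect (meixner z z' \<xi> \<nu>) = complex_of_real (of_bool (\<nu> = empty_young))"
    unfolding expect_def by (simp add: ceval_meixner z_measure_eq infsumI)
  then show ?thesis by simp
qed

text \<open>Both functionals agree on the Meixner functions, hence on the \<open>FS\<^sub>\<nu>\<close> by induction on the size of
  \<open>\<nu>\<close>, hence everywhere.\<close>

lemma meixner_functional_eq: "meixner_functional z z' \<xi> = expect"
  unfolding meixner_functional_def
proof (rule the_equality)
  show "Vector_Spaces.linear (\<lambda>c F. Const c * F) (*) expect \<and>
      (\<forall>\<nu>. expect (meixner z z' \<xi> \<nu>) = (if \<nu> = empty_young then 1 else 0))"
    by (simp add: expect_linear expect_meixner)
  fix \<phi> assume \<phi>: "Vector_Spaces.linear (\<lambda>c F. Const c * F) (*) \<phi> \<and>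
      (\<forall>\<nu>. \<phi> (meixner z z' \<xi> \<nu>) = (if \<nu> = empty_young then 1 else 0))"
  define \<delta> where "\<delta> F = \<phi> F - expect F" for F
  have add: "\<delta> (F + G) = \<delta> F + \<delta> G" and scale: "\<delta> (Const c * F) = c * \<delta> F" for F G c
    using \<phi> expect_linear by (simp_all add: \<delta>_def Vector_Spaces.linear_iff algebra_simps)
  have zero: "\<delta> 0 = 0" using scale[of 0 0] by simp
  have sum: "\<delta> (sum H A) = (\<Sum>a\<in>A. \<delta> (H a))" if "finite A" for H :: "young \<Rightarrow> symC" and A
    using that by (induction A rule: finite_induct) (auto simp: add zero)
  have FS: "\<delta> (complexify (FS \<nu>)) = 0" for \<nu>
  proof (induction \<nu> rule: young_size_induct)
    case (step \<nu>)
    have "0 = \<delta> (meixner z z' \<xi> \<nu>)" using \<phi> by (simp add: \<delta>_def expect_meixner)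
    also have "\<dots> = (\<Sum>\<mu>\<in>{\<mu>. contained \<mu> \<nu>}. of_real (W.meixner_entry \<nu> \<mu>) * \<delta> (complexify (FS \<mu>)))"
      by (simp add: meixner_eq complexify_sum complexify_Const_mult sum scale)
    also have "\<dots> = (\<Sum>\<mu>\<in>{\<mu>. contained \<mu> \<nu>}. if \<mu> = \<nu> then \<delta> (complexify (FS \<nu>)) else 0)"
    proof (intro sum.cong refl)
      fix \<mu> assume "\<mu> \<in> {\<mu>. contained \<mu> \<nu>}"
      then have "\<mu> \<noteq> \<nu> \<Longrightarrow> ysize \<mu> < ysize \<nu>" using contained_eqI[of \<mu> \<nu>] by (auto simp flip: not_le)
      then show "of_real (W.meixner_entry \<nu> \<mu>) * \<delta> (complexify (FS \<mu>)) = (if \<mu> = \<nu> then \<delta> (complexify (FS \<nu>)) else 0)"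
        using step by (auto simp: W.meixner_entry_def)
    qed
    also have "\<dots> = \<delta> (complexify (FS \<nu>))" by simp
    finally show ?case by simp
  qed
  have real: "\<delta> (complexify G) = 0" for G
  proof -
    obtain n c where "G = (\<Sum>\<mu>\<in>{\<mu>. ysize \<mu> \<le> n}. Const (c \<mu>) * FS \<mu>)" using FS_spans by blast
    then show ?thesis by (simp add: complexify_sum complexify_Const_mult sum scale FS)
  qed
  have "\<delta> F = 0" for F
    by (subst complexify_Re_Im) (simp add: add scale real)
  then show "\<phi> = expect" by (auto simp: \<delta>_def)
qed

lemma realize_has_sum_functional:
  "((\<lambda>\<kappa>. complex_of_real (realize F \<kappa> * z_measure z z' \<xi> \<kappa>)) has_sum meixner_functional z z' \<xi> (complexify F)) UNIV"
  using has_sum_infsum[OF ceval_summable[of "complexify F"]]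
  by (simp add: meixner_functional_eq expect_def ceval_complexify)

lemma positive_weight:
  assumes "principal_series z z' \<or> complementary_series z z'"
  shows "W.box_weight (real_of_int c) > 0"
proof -
  have "(z + of_int c) * (z' + of_int c) = complex_of_real (W.box_weight (real_of_int c))"
    using content_product_real[OF adm, folded s t, of "real_of_int c"] by simp
  then have eq: "W.box_weight (real_of_int c) = Re ((z + of_int c) * (z' + of_int c))" by simp
  from assms show ?thesis
  proof
    assume "principal_series z z'"
    then have z: "z \<notin> \<int>" "z' = cnj z" by (auto simp: principal_series_def)
    have "z + of_int c \<noteq> 0"
    proof
      assume "z + of_int c = 0"
      then have "z = of_int (- c)" by (simp add: eq_neg_iff_add_eq_0)
      then show False using z(1) by (metis Ints_of_int)
    qed
    moreover have "(z + of_int c) * (z' + of_int c) = of_real ((cmod (z + of_int c))\<^sup>2)"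
      using complex_norm_square[of "z + of_int c"] by (simp add: z(2))
    ultimately show ?thesis unfolding eq by simp
  next
    assume "complementary_series z z'"
    then obtain k :: int where k: "z \<in> \<real>" "z' \<in> \<real>" "of_int k < Re z" "Re z < of_int k + 1"
      "of_int k < Re z'" "Re z' < of_int k + 1"
      by (auto simp: complementary_series_def)
    have "W.box_weight (real_of_int c) = (Re z + of_int c) * (Re z' + of_int c)"
      using k(1,2) by (simp add: eq complex_is_Real_iff)
    \<comment> \<open>No integer lies between \<open>z\<close> and \<open>z'\<close>, so both factors have the same sign.\<close>
    moreover have "(Re z + of_int c) * (Re z' + of_int c) > 0"
    proof (cases "k + c \<ge> 0")
      case True
      then have "real_of_int k + of_int c \<ge> 0" by linarith
      then show ?thesis using k by (intro mult_pos_pos) linarith+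
    next
      case False
      then have "real_of_int k + of_int c + 1 \<le> 0" by linarith
      then show ?thesis using k by (intro mult_neg_neg) linarith+
    qed
    ultimately show ?thesis by simp
  qed
qed

lemma meixner_orthogonal_basis:
  assumes "principal_series z z' \<or> complementary_series z z'"
  shows "orthogonal_basis (z_measure z z' \<xi>) (\<lambda>\<nu>. realize (real_meixner z z' \<xi> \<nu>))"
proof -
  interpret P: positive_meixner_weight s t \<xi>
  proof
    fix \<kappa>
    show "W.skew_weight \<kappa> empty_young > 0"
      unfolding W.skew_weight_def
    proof (intro prod_pos, clarify)
      fix i j :: nat
      show "0 < W.box_weight (real j - real i)"
        using positive_weight[OF assms, of "int j - int i"] by simp
    qed
  qed
  have "z_measure z z' \<xi> = W.zweight" by (rule ext) (rule z_measure_eq)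
  moreover have "(\<lambda>\<nu>. realize (real_meixner z z' \<xi> \<nu>)) = W.meixner_value" by (rule ext) (rule realize_real_meixner)
  ultimately show ?thesis using P.meixner_value_orthogonal_basis by simp
qed

end

theorem theorem5p27:
  fixes z z' :: complex and \<xi> :: real
  assumes "admissible z z'" and "0 < \<xi>" and "\<xi> < 1"
  shows "(\<forall>F :: sym.
            ((\<lambda>\<kappa>. complex_of_real (realize F \<kappa> * z_measure z z' \<xi> \<kappa>))
               has_sum meixner_functional z z' \<xi> (complexify F)) UNIV) \<and>
         (principal_series z z' \<or> complementary_series z z' \<longrightarrow>
            orthogonal_basis (z_measure z z' \<xi>) (\<lambda>\<nu>. realize (real_meixner z z' \<xi> \<nu>)))"
  using realize_has_sum_functional[OF assms refl refl] meixner_orthogonal_basis[OF assms refl refl] by blast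

end
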